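(* The Polish topology on $\mathrm{Isom}(\mathbf{H})$, i.e. the topology of pointwise convergence on $\mathbf{H}$, is the unique separable Hausdorff group topology on the abstract group $\mathrm{Isom}(\mathbf{H})$.
   Context: $\mathcal{H}$ is an infinite-dimensional separable real Hilbert space with Hilbert basis $(e_i)_{i\in\mathbb{N}}$, and $Q(x)=x_0^2-\sum_{i\ge1}x_i^2$ with polarized symmetric bilinear form $(\cdot,\cdot)$. The infinite-dimensional separable hyperbolic space is $\mathbf{H}=\{x\in\mathcal{H}: Q(x)=1,\ x_0>0\}$ with metric $\cosh d(x,y)=(x,y)$. $\mathrm{Isom}(\mathbf{H})$ is its isometry group. The topology of pointwise convergence is the coarsest group topology making all orbit maps $g\mapsto gx$, $x\in\mathbf{H}$, continuous. Separable means having a countable dense subset. *)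

theory Defs
  imports "HOL-Analysis.Analysis" "HOL-Algebra.Bij"
begin

definition hilbert_basis :: "(nat \<Rightarrow> 'a::{real_inner, complete_space}) \<Rightarrow> bool" where
  "hilbert_basis e \<longleftrightarrow>
     (\<forall>i j. e i \<bullet> e j = (if i = j then 1 else 0)) \<and> closure (span (range e)) = UNIV"

definition lorentz_Q :: "(nat \<Rightarrow> 'a::{real_inner, complete_space}) \<Rightarrow> 'a \<Rightarrow> real" where
  "lorentz_Q e x = (x \<bullet> e 0)\<^sup>2 - (\<Sum>\<^sub>\<infinity>i\<in>{1..}. (x \<bullet> e i)\<^sup>2)"

definition lorentz_form :: "(nat \<Rightarrow> 'a::{real_inner, complete_space}) \<Rightarrow> 'a \<Rightarrow> 'a \<Rightarrow> real" where
  "lorentz_form e x y = (lorentz_Q e (x + y) - lorentz_Q e x - lorentz_Q e y) / 2"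

definition hyperbolic_space :: "(nat \<Rightarrow> 'a::{real_inner, complete_space}) \<Rightarrow> 'a set" where
  "hyperbolic_space e = {x. lorentz_Q e x = 1 \<and> x \<bullet> e 0 > 0}"

text \<open>On the hyperbolic space the form takes values \<open>\<ge> 1\<close>, so \<open>arcosh\<close> yields the nonnegative
  solution of \<open>cosh d = (x, y)\<close>. The value \<open>0\<close> elsewhere is there because the locale
  \<^locale>\<open>Metric_space\<close> asks for nonnegativity and symmetry on the whole type.\<close>

definition hyperbolic_dist :: "(nat \<Rightarrow> 'a::{real_inner, complete_space}) \<Rightarrow> 'a \<Rightarrow> 'a \<Rightarrow> real" where
  "hyperbolic_dist e x y =
     (if x \<in> hyperbolic_space e \<and> y \<in> hyperbolic_space e then arcosh (lorentz_form e x y) else 0)"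

definition hyperbolic_topology :: "(nat \<Rightarrow> 'a::{real_inner, complete_space}) \<Rightarrow> 'a topology" where
  "hyperbolic_topology e = Metric_space.mtopology (hyperbolic_space e) (hyperbolic_dist e)"

text \<open>As in \<^const>\<open>BijGroup\<close>, group elements are extensional functions, and the
  multiplication is composition.\<close>

definition Isom :: "(nat \<Rightarrow> 'a::{real_inner, complete_space}) \<Rightarrow> ('a \<Rightarrow> 'a) monoid" where
  "Isom e = (BijGroup (hyperbolic_space e))
     \<lparr>carrier := {g \<in> Bij (hyperbolic_space e).
        \<forall>x\<in>hyperbolic_space e. \<forall>y\<in>hyperbolic_space e.
          hyperbolic_dist e (g x) (g y) = hyperbolic_dist e x y}\<rparr>"

definition group_topology :: "('g, 'b) monoid_scheme \<Rightarrow> 'g topology \<Rightarrow> bool" where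
  "group_topology G T \<longleftrightarrow>
     group G \<and> topspace T = carrier G \<and>
     continuous_map (prod_topology T T) T (\<lambda>(g, h). g \<otimes>\<^bsub>G\<^esub> h) \<and>
     continuous_map T T (\<lambda>g. inv\<^bsub>G\<^esub> g)"

definition orbit_maps_continuous ::
    "(nat \<Rightarrow> 'a::{real_inner, complete_space}) \<Rightarrow> ('a \<Rightarrow> 'a) topology \<Rightarrow> bool" where
  "orbit_maps_continuous e T \<longleftrightarrow>
     (\<forall>x\<in>hyperbolic_space e. continuous_map T (hyperbolic_topology e) (\<lambda>g. g x))"

text \<open>A predicate rather than a function, since the existence of a coarsest such topology is not
  automatic; the coarsest one is clearly unique.\<close>

definition pointwise_convergence_topology ::
    "(nat \<Rightarrow> 'a::{real_inner, complete_space}) \<Rightarrow> ('a \<Rightarrow> 'a) topology \<Rightarrow> bool" where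
  "pointwise_convergence_topology e T \<longleftrightarrow>
     group_topology (Isom e) T \<and> orbit_maps_continuous e T \<and>
     (\<forall>S. group_topology (Isom e) S \<and> orbit_maps_continuous e S \<longrightarrow>
        (\<forall>U. openin T U \<longrightarrow> openin S U))"

definition polish_space :: "'b topology \<Rightarrow> bool" where
  "polish_space X \<longleftrightarrow> separable_space X \<and> completely_metrizable_space X"

end

theory Submission
  imports Defs
begin

text \<open>Isometries of the hyperbolic space are restrictions of linear maps preserving the Lorentz form,
  and the topology \<open>T\<close> of pointwise convergence is the strong topology on these maps. Let \<open>S\<close> be a
  separable Hausdorff group topology.

  \<open>S\<close> is coarser than \<open>T\<close> (automatic continuity, along the lines of Tsankov's argument for the
  unitary group): it suffices that for every symmetric set \<open>W\<close>, countably many translates of which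
  cover the group, a bounded power of \<open>W\<close> is a \<open>T\<close>-neighbourhood of the identity. A diagonal argument
  gives an infinite set of basis vectors on whose span \<open>W\<^sup>2\<close> realises all orthogonal maps.
  Conjugating a shift that lies in \<open>W\<^sup>2\<close> by the pigeonhole principle, a swindle puts the whole
  orthogonal group of an infinite coordinate subspace into \<open>W\<^sup>8\<close>. A permutation from an almost
  disjoint family enlarges this subspace to one of finite codimension, and a final map moving
  the finitely many remaining basis vectors apart produces an open set.

  \<open>S\<close> is finer than \<open>T\<close> (minimality): if reflections in unit spacelike vectors \<open>n\<close> with
  \<open>\<bar>B n m\<bar> = 1/2\<close> are \<open>S\<close>-close to the identity, the braid relation makes the reflection in \<open>m\<close>
  \<open>S\<close>-close to the identity, which contradicts the Hausdorff property. Applied to images under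
  group elements \<open>S\<close>-close to the identity of vectors almost orthogonal to finitely many basis
  vectors, this shows that the orbit of the base point under small \<open>S\<close>-neighbourhoods is totally
  bounded. Its only cluster point is the base point, since the point symmetries in the orbit are
  conjugate by elements \<open>S\<close>-close to the identity.\<close>

section \<open>Orthogonal families in Hilbert space\<close>

text \<open>The two halves are not independent. Automatic continuity is what places a reflection in
  a unit vector nearly orthogonal to many basis vectors inside a given
  \<open>S\<close>-neighbourhood, and minimality is built on such reflections. Separability enters
  through a countable cover by translates, exploited in two ways: among uncountably many elements
  two have their quotient in W^2, and countably many bad choices can be diagonalised against the
  translates. What distinguishes this group from an orthogonal group is that it has unbounded
  orbits. In the first half the index \<open>0\<close> is therefore treated as one of the finitely
  many exceptional indices, with a boost in place of a rotation; in the second half the orbit of a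
  vector has to be bounded before any compactness argument can start. The value \<open>1/2\<close>
  is the cosine of pi/3: reflections at this angle generate the symmetric group on three letters, in
  which each is conjugate to the other by a product of the two. The exponents 8, 12, 40, 124, 168
  merely count factors; what matters is that they do not depend on W.\<close>

lemma norm_sum_orthogonal:
  fixes n :: "nat \<Rightarrow> 'a::real_inner"
  assumes "\<And>i j. i \<noteq> j \<Longrightarrow> n i \<bullet> n j = 0" "finite A"
  shows "(norm (\<Sum>i\<in>A. c i *\<^sub>R n i))\<^sup>2 = (\<Sum>i\<in>A. (c i)\<^sup>2 * (norm (n i))\<^sup>2)"
proof -
  have "pairwise (\<lambda>i j. orthogonal (c i *\<^sub>R n i) (c j *\<^sub>R n j)) A"
    using assms(1) by (auto simp: pairwise_def orthogonal_def)
  from norm_sum_Pythagorean[OF assms(2) this] show ?thesis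
    by (simp add: power_mult_distrib)
qed

definition ortho_family :: "(nat \<Rightarrow> 'a::real_inner) \<Rightarrow> bool" where
  "ortho_family n \<longleftrightarrow> (\<forall>i j. i \<noteq> j \<longrightarrow> n i \<bullet> n j = 0) \<and> (\<forall>i. n i = 0 \<or> norm (n i) = 1)"

lemma ortho_familyD: "ortho_family n \<Longrightarrow> i \<noteq> j \<Longrightarrow> n i \<bullet> n j = 0"
  by (auto simp: ortho_family_def)

lemma ortho_family_norm: "ortho_family n \<Longrightarrow> norm (n i) \<le> 1"
  unfolding ortho_family_def by (metis norm_zero order.refl zero_le_one)

lemma ortho_family_coeff: "ortho_family n \<Longrightarrow> (x \<bullet> n i) * (norm (n i))\<^sup>2 = x \<bullet> n i"
  unfolding ortho_family_def by (metis inner_zero_right mult_zero_left mult.right_neutral power_one)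

lemma ortho_family_summable:
  fixes n :: "nat \<Rightarrow> 'a::{real_inner, complete_space}"
  assumes n: "ortho_family n" and c: "summable (\<lambda>i. (c i)\<^sup>2)"
  shows "summable (\<lambda>i. c i *\<^sub>R n i)"
proof -
  let ?S = "\<lambda>m. \<Sum>i<m. c i *\<^sub>R n i" and ?R = "\<lambda>m. \<Sum>i<m. (c i)\<^sup>2"
  have est: "(norm (?S m - ?S k))\<^sup>2 \<le> \<bar>?R m - ?R k\<bar>" if "k \<le> m" for k m
  proof -
    have "?S m - ?S k = (\<Sum>i\<in>{k..<m}. c i *\<^sub>R n i)"
      using that by (simp add: sum_diff_nat_ivl lessThan_atLeast0)
    then have "(norm (?S m - ?S k))\<^sup>2 = (\<Sum>i\<in>{k..<m}. (c i)\<^sup>2 * (norm (n i))\<^sup>2)"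
      using norm_sum_orthogonal[of n] ortho_familyD[OF n] by simp
    also have "\<dots> \<le> (\<Sum>i\<in>{k..<m}. (c i)\<^sup>2 * 1)"
      by (intro sum_mono mult_left_mono) (use ortho_family_norm[OF n] in \<open>auto simp: abs_square_le_1\<close>)
    also have "\<dots> = ?R m - ?R k"
      using that by (simp add: sum_diff_nat_ivl lessThan_atLeast0)
    finally show ?thesis by linarith
  qed
  have "Cauchy ?R"
    using c by (simp add: summable_iff_convergent convergent_Cauchy)
  have "Cauchy ?S"
  proof (rule metric_CauchyI)
    fix r :: real assume "r > 0"
    then have "r\<^sup>2 > 0" by simp
    then obtain M where M: "\<And>m k. m \<ge> M \<Longrightarrow> k \<ge> M \<Longrightarrow> dist (?R m) (?R k) < r\<^sup>2"
      using \<open>Cauchy ?R\<close> by (metis metric_CauchyD)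
    have *: "dist (?S m) (?S k) < r" if "m \<ge> M" "k \<ge> M" "k \<le> m" for m k
    proof -
      have "(norm (?S m - ?S k))\<^sup>2 < r\<^sup>2"
        using est[OF that(3)] M[OF that(1,2)] by (simp add: dist_real_def)
      then show ?thesis using \<open>r > 0\<close>
        by (simp add: dist_norm power_less_imp_less_base)
    qed
    show "\<exists>M. \<forall>m\<ge>M. \<forall>k\<ge>M. dist (?S m) (?S k) < r"
      using * by (metis dist_commute nle_le)
  qed
  then show ?thesis
    by (simp add: summable_iff_convergent Cauchy_convergent)
qed

lemma bessel:
  fixes x :: "'a::real_inner"
  assumes n: "ortho_family n"
  shows "(\<Sum>i<m. (x \<bullet> n i)\<^sup>2) \<le> (norm x)\<^sup>2"
proof -
  let ?p = "\<Sum>i<m. (x \<bullet> n i) *\<^sub>R n i"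
  have "x \<bullet> ?p = (\<Sum>i<m. (x \<bullet> n i)\<^sup>2)"
    by (simp add: inner_sum_right power2_eq_square)
  moreover have "(norm ?p)\<^sup>2 = (\<Sum>i<m. (x \<bullet> n i) * ((x \<bullet> n i) * (norm (n i))\<^sup>2))"
    using norm_sum_orthogonal[of n "{..<m}" "\<lambda>i. x \<bullet> n i"] ortho_familyD[OF n]
    by (simp add: power2_eq_square mult_ac)
  then have "(norm ?p)\<^sup>2 = (\<Sum>i<m. (x \<bullet> n i)\<^sup>2)"
    unfolding ortho_family_coeff[OF n] by (simp add: power2_eq_square)
  moreover have "0 \<le> (norm (x - ?p))\<^sup>2" by simp
  ultimately show ?thesis
    by (simp add: power2_norm_eq_inner inner_diff_left inner_diff_right inner_commute)
qed

lemma bessel_summable: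
  fixes x :: "'a::real_inner"
  assumes "ortho_family n"
  shows "summable (\<lambda>i. (x \<bullet> n i)\<^sup>2)"
  using bounded_imp_summable[of "\<lambda>i. (x \<bullet> n i)\<^sup>2" "(norm x)\<^sup>2"] bessel[OF assms, of x "Suc _"]
  by (simp add: lessThan_Suc_atMost)

definition ortho_proj :: "(nat \<Rightarrow> 'a::real_inner) \<Rightarrow> 'a \<Rightarrow> 'a" where
  "ortho_proj n x = (\<Sum>i. (x \<bullet> n i) *\<^sub>R n i)"

lemma ortho_proj_sums:
  fixes n :: "nat \<Rightarrow> 'a::{real_inner, complete_space}"
  assumes "ortho_family n"
  shows "(\<lambda>i. (x \<bullet> n i) *\<^sub>R n i) sums ortho_proj n x"
  unfolding ortho_proj_def
  by (intro summable_sums ortho_family_summable[OF assms] bessel_summable[OF assms])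

lemma ortho_proj_inner:
  fixes n :: "nat \<Rightarrow> 'a::{real_inner, complete_space}"
  assumes "ortho_family n"
  shows "ortho_proj n x \<bullet> n k = x \<bullet> n k"
proof -
  have "(\<lambda>i. ((x \<bullet> n i) *\<^sub>R n i) \<bullet> n k) sums (ortho_proj n x \<bullet> n k)"
    using bounded_linear.sums[OF bounded_linear_inner_left ortho_proj_sums[OF assms]] .
  moreover have "(\<lambda>i. ((x \<bullet> n i) *\<^sub>R n i) \<bullet> n k) sums (\<Sum>i\<in>{k}. ((x \<bullet> n i) *\<^sub>R n i) \<bullet> n k)"
    by (rule sums_finite) (use ortho_familyD[OF assms] in auto)
  moreover have "(\<Sum>i\<in>{k}. ((x \<bullet> n i) *\<^sub>R n i) \<bullet> n k) = x \<bullet> n k"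
    using ortho_family_coeff[OF assms] by (simp add: power2_norm_eq_inner)
  ultimately show ?thesis using sums_unique2 by metis
qed

lemma ortho_proj_inner_sums:
  fixes n :: "nat \<Rightarrow> 'a::{real_inner, complete_space}"
  assumes "ortho_family n"
  shows "(\<lambda>i. (x \<bullet> n i) * (y \<bullet> n i)) sums (ortho_proj n x \<bullet> y)"
  using bounded_linear.sums[OF bounded_linear_inner_left[of y] ortho_proj_sums[OF assms, of x]]
  by (simp add: inner_commute)

lemma ortho_proj_sym:
  fixes n :: "nat \<Rightarrow> 'a::{real_inner, complete_space}"
  assumes "ortho_family n"
  shows "ortho_proj n x \<bullet> y = x \<bullet> ortho_proj n y"
  using ortho_proj_inner_sums[OF assms, of x y] ortho_proj_inner_sums[OF assms, of y x]
  by (metis (no_types, lifting) inner_commute mult.commute sums_cong sums_unique2)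

lemma ortho_proj_idem:
  fixes n :: "nat \<Rightarrow> 'a::{real_inner, complete_space}"
  assumes "ortho_family n"
  shows "ortho_proj n (ortho_proj n x) = ortho_proj n x"
  using ortho_proj_inner[OF assms, of x] unfolding ortho_proj_def by presburger

lemma ortho_proj_linear:
  fixes n :: "nat \<Rightarrow> 'a::{real_inner, complete_space}"
  assumes "ortho_family n"
  shows "linear (ortho_proj n)"
proof (rule linearI)
  fix x y :: 'a and c :: real
  have "(\<lambda>i. ((x + y) \<bullet> n i) *\<^sub>R n i) sums (ortho_proj n x + ortho_proj n y)"
    using sums_add[OF ortho_proj_sums[OF assms, of x] ortho_proj_sums[OF assms, of y]]
    by (simp add: inner_add_left scaleR_left_distrib)
  then show "ortho_proj n (x + y) = ortho_proj n x + ortho_proj n y"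
    using ortho_proj_sums[OF assms, of "x+y"] sums_unique2 by blast
  have "(\<lambda>i. ((c *\<^sub>R x) \<bullet> n i) *\<^sub>R n i) sums (c *\<^sub>R ortho_proj n x)"
    using sums_scaleR_right[OF ortho_proj_sums[OF assms, of x], of c] by simp
  then show "ortho_proj n (c *\<^sub>R x) = c *\<^sub>R ortho_proj n x"
    using ortho_proj_sums[OF assms, of "c *\<^sub>R x"] sums_unique2 by blast
qed

lemma ortho_proj_0: "(\<And>i. x \<bullet> n i = 0) \<Longrightarrow> ortho_proj n x = 0"
  by (simp add: ortho_proj_def)

lemma inner_sgn_scaleR: "(w \<bullet> sgn w) *\<^sub>R sgn w = (w :: 'a::real_inner)"
proof (cases "w = 0")
  case False
  then have "w \<bullet> sgn w = norm w"
    by (simp add: sgn_div_norm dot_square_norm power2_eq_square)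
  then show ?thesis using False by (simp add: sgn_div_norm)
qed simp

text \<open>The planes spanned by \<open>v k\<close> and \<open>v' k\<close> are mutually orthogonal, so the reflections exchanging
  \<open>v k\<close> with \<open>v' k\<close> can be performed simultaneously.\<close>

lemma simultaneous_reflection:
  fixes v v' :: "nat \<Rightarrow> 'a::{real_inner, complete_space}"
  assumes nrm: "\<And>k. norm (v k) = norm (v' k)"
    and orth: "\<And>j k. j \<noteq> k \<Longrightarrow> v j \<bullet> v k = 0" "\<And>j k. j \<noteq> k \<Longrightarrow> v j \<bullet> v' k = 0"
      "\<And>j k. j \<noteq> k \<Longrightarrow> v' j \<bullet> v' k = 0"
  obtains u where "linear u" "\<And>x. u (u x) = x" "\<And>x y. u x \<bullet> u y = x \<bullet> y" "\<And>k. u (v k) = v' k"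
    "\<And>x. (\<And>k. x \<bullet> v k = x \<bullet> v' k) \<Longrightarrow> u x = x"
proof -
  define n where "n k = sgn (v k - v' k)" for k
  define P where "P = ortho_proj n"
  define u where "u x = x - 2 *\<^sub>R P x" for x
  have n: "ortho_family n"
    unfolding ortho_family_def n_def
    by (auto simp: norm_sgn) (auto simp: sgn_div_norm inner_diff_left inner_diff_right orth
       inner_commute[of "v' _" "v _"])
  have Psym: "P x \<bullet> y = x \<bullet> P y" and Pid: "P (P x) = P x" for x y
    using ortho_proj_sym[OF n] ortho_proj_idem[OF n] by (auto simp: P_def)
  have Pl: "linear P" using ortho_proj_linear[OF n] by (simp add: P_def)
  have l: "linear u"
    unfolding u_def using Pl
    by (intro linear_compose_sub linear_compose_scale_right linear_ident)
  have uu: "u (u x) = x" for x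
    by (simp add: u_def linear_diff[OF Pl] linear_scale[OF Pl] linear_add[OF Pl] Pid scaleR_2)
  have ui: "u x \<bullet> u y = x \<bullet> y" for x y
  proof -
    have "P x \<bullet> P y = x \<bullet> P y" using Psym[of x "P y"] Pid by simp
    then show ?thesis using Psym[of x y]
      by (simp add: u_def inner_diff_left inner_diff_right)
  qed
  have fixu: "u x = x" if "\<And>k. x \<bullet> v k = x \<bullet> v' k" for x
  proof -
    have "P x = 0" unfolding P_def
      by (rule ortho_proj_0) (simp add: n_def sgn_div_norm inner_diff_right that)
    then show ?thesis by (simp add: u_def)
  qed
  \<comment> \<open>\<open>u\<close> fixes \<open>v k + v' k\<close>, which is orthogonal to every
    difference because the norms agree, and negates \<open>v k - v' k\<close>; adding up gives twice
    \<open>v' k\<close>.\<close>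
  have uv: "u (v k) = v' k" for k
  proof -
    have "u (v k + v' k) = v k + v' k"
    proof (rule fixu)
      fix j
      show "(v k + v' k) \<bullet> v j = (v k + v' k) \<bullet> v' j"
      proof (cases "j = k")
        case True
        then show ?thesis using nrm[of k]
          by (simp add: inner_add_left norm_eq inner_commute[of "v k" "v' k"])
      next
        case False
        then show ?thesis using orth[of k j] orth[of j k]
          by (simp add: inner_add_left inner_commute[of "v' k" "v j"])
      qed
    qed
    moreover have "u (v k - v' k) = - (v k - v' k)"
    proof -
      have inn: "(v k - v' k) \<bullet> n i = 0" if "i \<noteq> k" for i
        using orth[of i k] orth[of k i] that
        by (simp add: n_def sgn_div_norm inner_diff_left inner_diff_right inner_commute)
      have "(\<lambda>i. ((v k - v' k) \<bullet> n i) *\<^sub>R n i) sums (\<Sum>i\<in>{k}. ((v k - v' k) \<bullet> n i) *\<^sub>R n i)"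
        by (rule sums_finite) (use inn in auto)
      moreover have "(\<Sum>i\<in>{k}. ((v k - v' k) \<bullet> n i) *\<^sub>R n i) = v k - v' k"
        unfolding n_def by (simp add: inner_sgn_scaleR)
      ultimately have "P (v k - v' k) = v k - v' k"
        unfolding P_def using ortho_proj_sums[OF n] sums_unique2 by metis
      then show ?thesis by (simp add: u_def scaleR_2)
    qed
    ultimately have "u (v k + v' k) + u (v k - v' k) = 2 *\<^sub>R v' k" by (simp add: scaleR_2)
    then have "u (2 *\<^sub>R v k) = 2 *\<^sub>R v' k"
      by (simp add: linear_add[OF l, symmetric] scaleR_2)
    then show ?thesis by (simp add: linear_scale[OF l])
  qed
  show ?thesis by (rule that[OF l uu ui uv fixu])
qed

section \<open>The Lorentz form and its isometries\<close>

unbundle no m_inv_syntax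

locale hyp =
  fixes e :: "nat \<Rightarrow> 'a::{real_inner, complete_space}"
  assumes basis: "hilbert_basis e"
begin

lemma e_inner: "e i \<bullet> e j = (if i = j then 1 else 0)"
  using basis by (simp add: hilbert_basis_def)

lemma e_norm [simp]: "norm (e i) = 1"
  by (simp add: norm_eq_sqrt_inner e_inner)

lemma e_ortho: "ortho_family e"
  by (simp add: ortho_family_def e_inner)

lemma e_complete:
  assumes "\<And>i. x \<bullet> e i = 0"
  shows "x = 0"
proof -
  have "closed {y. x \<bullet> y = 0}"
    by (intro closed_Collect_eq continuous_intros)
  moreover have "span (range e) \<subseteq> {y. x \<bullet> y = 0}"
    by (rule span_minimal) (auto simp: assms subspace_def inner_add_right)
  ultimately have "closure (span (range e)) \<subseteq> {y. x \<bullet> y = 0}"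
    by (simp add: closure_minimal)
  then have "x \<in> {y. x \<bullet> y = 0}"
    using basis unfolding hilbert_basis_def by (metis UNIV_I subsetD)
  then show ?thesis by simp
qed

lemma expand: "(\<lambda>i. (x \<bullet> e i) *\<^sub>R e i) sums x"
proof -
  have "x - ortho_proj e x = 0"
    by (rule e_complete) (simp add: inner_diff_left ortho_proj_inner[OF e_ortho])
  then show ?thesis using ortho_proj_sums[OF e_ortho, of x] by simp
qed

lemma parseval: "(\<lambda>i. (x \<bullet> e i) * (y \<bullet> e i)) sums (x \<bullet> y)"
  using bounded_linear.sums[OF bounded_linear_inner_left[of y] expand[of x]]
  by (simp add: inner_commute)

lemma e_eqI: "(\<And>i. x \<bullet> e i = y \<bullet> e i) \<Longrightarrow> x = y"
  using e_complete[of "x - y"] by (simp add: inner_diff_left)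

text \<open>Parseval turns the infinite sum in \<open>lorentz_Q\<close> into
  \<open>x \<bullet> x\<close> minus the square of the 0-th coordinate. In this closed form
  bilinearity and continuity are immediate.\<close>

definition B :: "'a \<Rightarrow> 'a \<Rightarrow> real" where
  "B x y = 2 * (x \<bullet> e 0) * (y \<bullet> e 0) - x \<bullet> y"

lemma lorentz_Q_eq: "lorentz_Q e x = B x x"
proof -
  define f where "f i = (if i = 0 then 0 else (x \<bullet> e i)\<^sup>2)" for i :: nat
  have "(\<lambda>i. (x \<bullet> e i)\<^sup>2) sums (x \<bullet> x)"
    using parseval[of x x] by (simp add: power2_eq_square)
  from sums_diff[OF this sums_single[of 0 "\<lambda>i. (x \<bullet> e i)\<^sup>2"]]
  have "f sums (x \<bullet> x - (x \<bullet> e 0)\<^sup>2)"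
    by (rule sums_cong[THEN iffD1, rotated]) (auto simp: f_def)
  then have "(f has_sum (x \<bullet> x - (x \<bullet> e 0)\<^sup>2)) UNIV"
    by (intro sums_nonneg_imp_has_sum) (auto simp: f_def)
  moreover have "(f has_sum s) UNIV \<longleftrightarrow> ((\<lambda>i. (x \<bullet> e i)\<^sup>2) has_sum s) {1..}" for s
    by (rule has_sum_cong_neutral) (auto simp: f_def)
  ultimately have "(\<Sum>\<^sub>\<infinity>i\<in>{1..}. (x \<bullet> e i)\<^sup>2) = x \<bullet> x - (x \<bullet> e 0)\<^sup>2"
    by (auto dest: infsumI)
  then show ?thesis by (simp add: lorentz_Q_def B_def power2_eq_square)
qed

lemma B_sym: "B x y = B y x" by (simp add: B_def inner_commute)

lemma B_add_left: "B (x + y) z = B x z + B y z"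
  and B_add_right: "B z (x + y) = B z x + B z y"
  and B_diff_left: "B (x - y) z = B x z - B y z"
  and B_diff_right: "B z (x - y) = B z x - B z y"
  and B_minus_left: "B (- x) z = - B x z"
  and B_minus_right: "B z (- x) = - B z x"
  and B_scale_left: "B (c *\<^sub>R x) z = c * B x z"
  and B_scale_right: "B z (c *\<^sub>R x) = c * B z x"
  and B_zero_left: "B 0 z = 0"
  and B_zero_right: "B z 0 = 0"
  by (simp_all add: B_def inner_add_left inner_add_right inner_diff_left inner_diff_right algebra_simps)

lemmas B_simps = B_add_left B_add_right B_diff_left B_diff_right B_minus_left B_minus_right
  B_scale_left B_scale_right B_zero_left B_zero_right

lemma lorentz_form_eq: "lorentz_form e x y = B x y"
  by (simp add: lorentz_form_def lorentz_Q_eq B_simps B_sym)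

lemma B_e0: "B x (e 0) = x \<bullet> e 0" by (simp add: B_def e_inner)

lemma B_e: "i \<noteq> 0 \<Longrightarrow> B x (e i) = - (x \<bullet> e i)" by (simp add: B_def e_inner)

lemma B_ee: "B (e i) (e j) = (if i = j then if i = 0 then 1 else - 1 else 0)"
  by (cases "j = 0") (auto simp: B_e0 B_e e_inner)

lemma B_eqI: "(\<And>i. B x (e i) = B y (e i)) \<Longrightarrow> x = y"
  by (rule e_eqI) (metis B_e0 B_e neg_equal_iff_equal)

lemma B_eqI': "(\<And>z. B x z = B y z) \<Longrightarrow> x = y"
  by (rule B_eqI)

lemma abs_inner_e: "\<bar>x \<bullet> e i\<bar> \<le> norm x"
  using Cauchy_Schwarz_ineq2[of x "e i"] by simp

lemma B_bound: "\<bar>B x y\<bar> \<le> 3 * norm x * norm y"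
proof -
  have "\<bar>B x y\<bar> \<le> 2 * (\<bar>x \<bullet> e 0\<bar> * \<bar>y \<bullet> e 0\<bar>) + \<bar>x \<bullet> y\<bar>"
    using abs_triangle_ineq4[of "2 * (x \<bullet> e 0) * (y \<bullet> e 0)" "x \<bullet> y"] by (simp add: B_def abs_mult)
  moreover have "\<bar>x \<bullet> e 0\<bar> * \<bar>y \<bullet> e 0\<bar> \<le> norm x * norm y"
    by (intro mult_mono abs_inner_e) auto
  ultimately show ?thesis using Cauchy_Schwarz_ineq2[of x y] by linarith
qed

lemma B_bounded_linear: "bounded_linear (\<lambda>x. B x y)"
  by (rule bounded_linear_intro[where K = "3 * norm y"])
     (use B_bound[of _ y] in \<open>auto simp: B_simps mult_ac\<close>)

text \<open>On a level set of the form the norm thus depends on the timelike coordinate alone; the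
  norm bounds for isometries come from here.\<close>

lemma norm2_eq: "(norm x)\<^sup>2 = 2 * (x \<bullet> e 0)\<^sup>2 - B x x"
  by (simp add: B_def power2_norm_eq_inner) (simp add: power2_eq_square)

lemma bounded_linear_eqI:
  assumes "bounded_linear f" "bounded_linear g" "\<And>i. f (e i) = g (e i)"
  shows "f x = g x"
proof -
  have "(\<lambda>i. f ((x \<bullet> e i) *\<^sub>R e i)) sums f x" "(\<lambda>i. g ((x \<bullet> e i) *\<^sub>R e i)) sums g x"
    using bounded_linear.sums[OF assms(1) expand] bounded_linear.sums[OF assms(2) expand] by auto
  then show ?thesis
    by (simp add: assms(3) linear_scale bounded_linear.linear[OF assms(1)]
        bounded_linear.linear[OF assms(2)] sums_unique2)
qed

abbreviation "Hs \<equiv> hyperbolic_space e"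

lemma Hs_iff: "x \<in> Hs \<longleftrightarrow> B x x = 1 \<and> x \<bullet> e 0 > 0"
  by (simp add: hyperbolic_space_def lorentz_Q_eq)

lemma e0_Hs: "e 0 \<in> Hs" by (simp add: Hs_iff B_ee e_inner)

lemma Hs_norm: "x \<in> Hs \<Longrightarrow> (norm x)\<^sup>2 = 2 * (x \<bullet> e 0)\<^sup>2 - 1"
  by (simp add: Hs_iff norm2_eq)

lemma Hs_ge1: assumes "x \<in> Hs" shows "x \<bullet> e 0 \<ge> 1"
proof -
  have "(x \<bullet> e 0)\<^sup>2 \<le> (norm x)\<^sup>2" using abs_inner_e[of x 0] by (metis abs_le_square_iff abs_norm_cancel)
  then have "1 \<le> (x \<bullet> e 0)\<^sup>2" using Hs_norm[OF assms] by simp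
  then show ?thesis using assms by (intro power2_le_imp_le[of 1]) (auto simp: Hs_iff)
qed

lemma form_decomp: "B x y = (x \<bullet> e 0) * (y \<bullet> e 0) - (x - (x \<bullet> e 0) *\<^sub>R e 0) \<bullet> (y - (y \<bullet> e 0) *\<^sub>R e 0)"
  by (simp add: B_def inner_diff_left inner_diff_right e_inner inner_commute[of "e 0"])

lemma perp_norm2: "(norm (x - (x \<bullet> e 0) *\<^sub>R e 0))\<^sup>2 = (x \<bullet> e 0)\<^sup>2 - B x x"
  using form_decomp[of x x] by (simp add: power2_norm_eq_inner) (simp add: power2_eq_square)

lemma Hs_form_bounds:
  assumes "x \<in> Hs" "y \<in> Hs"
  shows "B x y \<le> (x \<bullet> e 0) * (y \<bullet> e 0) + sqrt ((x \<bullet> e 0)\<^sup>2 - 1) * sqrt ((y \<bullet> e 0)\<^sup>2 - 1)"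
    and "B x y \<ge> (x \<bullet> e 0) * (y \<bullet> e 0) - sqrt ((x \<bullet> e 0)\<^sup>2 - 1) * sqrt ((y \<bullet> e 0)\<^sup>2 - 1)"
proof -
  have n: "norm (z - (z \<bullet> e 0) *\<^sub>R e 0) = sqrt ((z \<bullet> e 0)\<^sup>2 - 1)" if "z \<in> Hs" for z
    using perp_norm2[of z] that by (metis Hs_iff norm_ge_zero real_sqrt_unique)
  have "\<bar>(x - (x \<bullet> e 0) *\<^sub>R e 0) \<bullet> (y - (y \<bullet> e 0) *\<^sub>R e 0)\<bar>
      \<le> sqrt ((x \<bullet> e 0)\<^sup>2 - 1) * sqrt ((y \<bullet> e 0)\<^sup>2 - 1)"
    using Cauchy_Schwarz_ineq2 n assms by metis
  then show "B x y \<le> (x \<bullet> e 0) * (y \<bullet> e 0) + sqrt ((x \<bullet> e 0)\<^sup>2 - 1) * sqrt ((y \<bullet> e 0)\<^sup>2 - 1)"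
    "B x y \<ge> (x \<bullet> e 0) * (y \<bullet> e 0) - sqrt ((x \<bullet> e 0)\<^sup>2 - 1) * sqrt ((y \<bullet> e 0)\<^sup>2 - 1)"
    unfolding form_decomp[of x y] by linarith+
qed

lemma B_ge_1:
  assumes "x \<in> Hs" "y \<in> Hs"
  shows "B x y \<ge> 1"
proof -
  let ?a = "x \<bullet> e 0" and ?b = "y \<bullet> e 0"
  have a: "?a \<ge> 1" "?b \<ge> 1" using assms Hs_ge1 by auto
  \<comment> \<open>The two sides differ by \<open>(?a - ?b)\<^sup>2\<close>.\<close>
  have "(?a\<^sup>2 - 1) * (?b\<^sup>2 - 1) \<le> (?a * ?b - 1)\<^sup>2"
    using zero_le_power2[of "?a - ?b"] by (simp add: power2_eq_square algebra_simps)
  moreover have "1 \<le> ?a * ?b" using mult_mono[OF a] a by simp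
  ultimately have "sqrt ((?a\<^sup>2 - 1) * (?b\<^sup>2 - 1)) \<le> ?a * ?b - 1"
    by (intro real_le_lsqrt) auto
  then show ?thesis using Hs_form_bounds(2)[OF assms] by (simp add: real_sqrt_mult)
qed

text \<open>The sign condition excludes maps that exchange the two sheets of the hyperboloid.
  Boundedness is a consequence of the invariance of the form, see \<open>Lam_bound\<close>.\<close>

definition Lam :: "('a \<Rightarrow> 'a) set" where
  "Lam = {g. linear g \<and> bij g \<and> (\<forall>x y. B (g x) (g y) = B x y) \<and> g (e 0) \<bullet> e 0 > 0}"

lemma Lam_linear: "g \<in> Lam \<Longrightarrow> linear g" and Lam_bij: "g \<in> Lam \<Longrightarrow> bij g"
  and Lam_B: "g \<in> Lam \<Longrightarrow> B (g x) (g y) = B x y"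
  by (auto simp: Lam_def)

lemma Lam_inv_f: "g \<in> Lam \<Longrightarrow> inv g (g x) = x"
  and Lam_f_inv: "g \<in> Lam \<Longrightarrow> g (inv g x) = x"
  by (meson Lam_bij bij_def inv_f_f surj_f_inv_f)+

lemma Lam_adj: "g \<in> Lam \<Longrightarrow> B (g x) y = B x (inv g y)"
  by (metis Lam_B Lam_f_inv)

lemma Lam_e0_Hs: "g \<in> Lam \<Longrightarrow> g (e 0) \<in> Hs"
  by (auto simp: Lam_def Hs_iff B_ee)

text \<open>If \<open>g x\<close> were on the lower sheet, \<open>- g x\<close> and
  \<open>g (e 0)\<close> would be points of \<open>Hs\<close> with form \<open>- B x (e 0)\<close>,
  which is at most \<open>-1\<close>, contrary to \<open>B_ge_1\<close>.\<close>

lemma Lam_Hs: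
  assumes g: "g \<in> Lam" and x: "x \<in> Hs"
  shows "g x \<in> Hs"
proof -
  have 1: "B (g x) (g x) = 1" using x by (simp add: Lam_B[OF g] Hs_iff)
  have "(g x \<bullet> e 0)\<^sup>2 \<ge> 1"
    using perp_norm2[of "g x"] 1 by (metis diff_ge_0_iff_ge zero_le_power2)
  then have "g x \<bullet> e 0 \<noteq> 0" by auto
  moreover have "\<not> g x \<bullet> e 0 < 0"
  proof
    assume "g x \<bullet> e 0 < 0"
    then have "- g x \<in> Hs" using 1 by (simp add: Hs_iff B_simps)
    from B_ge_1[OF this Lam_e0_Hs[OF g]] have "- B x (e 0) \<ge> 1"
      by (simp add: B_simps Lam_B[OF g])
    then show False using B_ge_1[OF x e0_Hs] by simp
  qed
  ultimately show ?thesis using 1 by (simp add: Hs_iff)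
qed

lemma Lam_id: "id \<in> Lam"
  by (auto simp: Lam_def e_inner linear_id)

lemma Lam_comp: assumes "f \<in> Lam" "g \<in> Lam" shows "f \<circ> g \<in> Lam"
proof -
  have "f (g (e 0)) \<in> Hs" using assms Lam_Hs Lam_e0_Hs by blast
  then show ?thesis using assms by (auto simp: Lam_def linear_compose bij_comp Hs_iff)
qed

lemma Lam_inv: assumes g: "g \<in> Lam" shows "inv g \<in> Lam"
proof -
  have l: "linear (inv g)"
  proof (rule linearI)
    show "inv g (x + y) = inv g x + inv g y" for x y
      by (metis Lam_f_inv[OF g] Lam_inv_f[OF g] linear_add[OF Lam_linear[OF g]])
    show "inv g (c *\<^sub>R x) = c *\<^sub>R inv g x" for c x
      by (metis Lam_f_inv[OF g] Lam_inv_f[OF g] linear_scale[OF Lam_linear[OF g]])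
  qed
  have "B (inv g (e 0)) (e 0) = B (e 0) (g (e 0))"
    using Lam_adj[OF g] by (simp add: B_sym)
  then have "inv g (e 0) \<bullet> e 0 > 0"
    using B_ge_1[OF e0_Hs Lam_e0_Hs[OF g]] by (simp add: B_e0)
  moreover have "B (inv g x) (inv g y) = B x y" for x y
    by (metis Lam_B[OF g] Lam_f_inv[OF g])
  ultimately show ?thesis using l bij_imp_bij_inv[OF Lam_bij[OF g]] by (auto simp: Lam_def)
qed

lemma Lam_inv_inv: "g \<in> Lam \<Longrightarrow> inv (inv g) = g"
  by (simp add: Lam_bij inv_inv_eq)

lemma Lam_inv_comp: "f \<in> Lam \<Longrightarrow> g \<in> Lam \<Longrightarrow> inv (f \<circ> g) = inv g \<circ> inv f"
  by (simp add: Lam_bij o_inv_distrib)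

lemma Lam_norm_inv: assumes g: "g \<in> Lam" shows "norm (inv g (e 0)) = norm (g (e 0))"
proof -
  have "inv g (e 0) \<bullet> e 0 = g (e 0) \<bullet> e 0"
    by (metis B_e0 B_sym Lam_adj[OF g])
  then have "(norm (inv g (e 0)))\<^sup>2 = (norm (g (e 0)))\<^sup>2"
    using Hs_norm[OF Lam_e0_Hs[OF g]] Hs_norm[OF Lam_e0_Hs[OF Lam_inv[OF g]]] by simp
  then show ?thesis by (simp add: power2_eq_iff_nonneg)
qed

text \<open>\<open>z\<close> stands for the preimage of \<open>e 0\<close>: the 0-th coordinate of
  \<open>g x\<close> is then \<open>B x z\<close>, and \<open>norm2_eq\<close> recovers the norm
  from it.\<close>

lemma form_map_norm:
  assumes "B (g x) (g x) = B x x" "B (g x) (e 0) = B x z"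
  shows "norm (g x) \<le> 5 * (norm z + 1) * norm x"
proof -
  have "(norm (g x))\<^sup>2 = 2 * (B x z)\<^sup>2 - B x x" using assms by (simp add: norm2_eq B_e0)
  also have "\<dots> \<le> 2 * (3 * norm x * norm z)\<^sup>2 + 3 * norm x * norm x"
  proof -
    have "(B x z)\<^sup>2 \<le> (3 * norm x * norm z)\<^sup>2"
      using B_bound[of x z] by (metis abs_le_square_iff abs_of_nonneg abs_ge_zero order_trans)
    then show ?thesis using B_bound[of x x] by linarith
  qed
  also have "\<dots> \<le> (5 * (norm z + 1) * norm x)\<^sup>2"
  proof -
    have "18 * (norm z)\<^sup>2 + 3 \<le> 25 * (norm z + 1)\<^sup>2" by (simp add: power2_eq_square algebra_simps)
    then have "(18 * (norm z)\<^sup>2 + 3) * (norm x)\<^sup>2 \<le> (25 * (norm z + 1)\<^sup>2) * (norm x)\<^sup>2"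
      by (rule mult_right_mono) simp
    then show ?thesis by (simp add: power2_eq_square algebra_simps)
  qed
  finally show ?thesis by (rule power2_le_imp_le) simp
qed

text \<open>The bound involves \<open>g\<close> only through the image of the base point, so maps
  keeping \<open>g (e 0)\<close> bounded are equicontinuous.\<close>

lemma Lam_bound: "g \<in> Lam \<Longrightarrow> norm (g x) \<le> 5 * (norm (g (e 0)) + 1) * norm x"
  using form_map_norm[of g x "inv g (e 0)"] Lam_B Lam_adj Lam_norm_inv by metis

lemma Lam_bounded_linear: "g \<in> Lam \<Longrightarrow> bounded_linear g"
  by (rule bounded_linear_intro[where K = "5 * (norm (g (e 0)) + 1)"])
     (use Lam_bound[of g] in \<open>auto simp: linear_add linear_scale Lam_linear mult_ac\<close>)

lemma Lam_eqI: "f \<in> Lam \<Longrightarrow> g \<in> Lam \<Longrightarrow> (\<And>i. f (e i) = g (e i)) \<Longrightarrow> f = g"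
  by (rule ext) (rule bounded_linear_eqI, auto intro: Lam_bounded_linear)

section \<open>Reflections, point symmetries and transitivity on the hyperboloid\<close>

definition refl :: "'a \<Rightarrow> 'a \<Rightarrow> 'a" where
  "refl v x = x - (2 * B x v / B v v) *\<^sub>R v"

lemma refl_refl: "B v v \<noteq> 0 \<Longrightarrow> refl v (refl v x) = x"
proof -
  assume "B v v \<noteq> 0"
  then have "B (refl v x) v = - B x v" by (simp add: refl_def B_simps)
  then show ?thesis unfolding refl_def[of v "refl v x"] by (simp add: refl_def)
qed

lemma refl_linear: "linear (refl v)"
  by (rule linearI) (simp_all add: refl_def B_simps scaleR_right_diff_distrib
      distrib_left add_divide_distrib scaleR_left_distrib)

lemma refl_B: "B v v \<noteq> 0 \<Longrightarrow> B (refl v x) (refl v y) = B x y"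
proof -
  assume b: "B v v \<noteq> 0"
  define s t where "s = 2 * B x v / B v v" and "t = 2 * B y v / B v v"
  have "s * B y v = t * B x v" "s * B v v = 2 * B x v" using b by (auto simp: s_def t_def)
  then have "B (x - s *\<^sub>R v) (y - t *\<^sub>R v) = B x y"
    by (simp add: B_simps B_sym[of v y] right_diff_distrib)
  then show ?thesis by (simp add: refl_def s_def t_def)
qed

lemma refl_Lam:
  assumes "B v v < 0"
  shows "refl v \<in> Lam"
proof -
  have "bij (refl v)" using refl_refl[of v] assms by (intro o_bij[of "refl v"]) auto
  moreover have "refl v (e 0) \<bullet> e 0 > 0"
  proof -
    have "refl v (e 0) \<bullet> e 0 = 1 - 2 * (v \<bullet> e 0)\<^sup>2 / B v v"
      by (simp add: refl_def B_sym[of "e 0" v] B_e0 inner_diff_left e_inner power2_eq_square)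
    moreover have "(v \<bullet> e 0)\<^sup>2 / B v v \<le> 0" using assms by (simp add: divide_nonneg_neg)
    ultimately show ?thesis by simp
  qed
  ultimately show ?thesis using assms refl_linear refl_B by (auto simp: Lam_def)
qed

lemma refl_inv: "B v v < 0 \<Longrightarrow> inv (refl v) = refl v"
  by (rule inv_unique_comp) (auto simp: refl_refl)

lemma refl_swap: "B x x = B y y \<Longrightarrow> B (x - y) (x - y) \<noteq> 0 \<Longrightarrow> refl (x - y) x = y"
proof -
  assume a: "B x x = B y y" "B (x - y) (x - y) \<noteq> 0"
  then have "2 * B x (x - y) = B (x - y) (x - y)" by (simp add: B_simps B_sym)
  then show "refl (x - y) x = y" using a by (simp add: refl_def)
qed

lemma refl_conj: "g \<in> Lam \<Longrightarrow> g (refl v (inv g x)) = refl (g v) x"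
  by (simp add: refl_def linear_diff linear_scale Lam_linear Lam_f_inv Lam_B)
     (metis Lam_B Lam_f_inv)

text \<open>\<open>x - y\<close> is a null vector, so its norm is governed by the difference of the
  0-th coordinates; Cauchy-Schwarz for the spatial parts forces these coordinates to agree.\<close>

lemma Hs_eqI: assumes "x \<in> Hs" "y \<in> Hs" "B x y = 1" shows "x = y"
proof -
  let ?a = "x \<bullet> e 0" and ?b = "y \<bullet> e 0"
  have 1: "B (x - y) (x - y) = 0" using assms by (simp add: B_simps Hs_iff B_sym)
  have "(norm (x - y))\<^sup>2 = 2 * (?a - ?b)\<^sup>2" using norm2_eq[of "x - y"] 1 by (simp add: inner_diff_left)
  define p where "p = x - ?a *\<^sub>R e 0"
  define q where "q = y - ?b *\<^sub>R e 0"
  have p: "(norm p)\<^sup>2 = ?a\<^sup>2 - 1" "(norm q)\<^sup>2 = ?b\<^sup>2 - 1" "p \<bullet> q = ?a * ?b - 1"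
    using perp_norm2[of x] perp_norm2[of y] form_decomp[of x y] assms by (auto simp: p_def q_def Hs_iff)
  have "(p \<bullet> q)\<^sup>2 \<le> (norm p)\<^sup>2 * (norm q)\<^sup>2"
    using Cauchy_Schwarz_ineq[of p q] by (simp add: power2_norm_eq_inner)
  then have "(?a * ?b - 1)\<^sup>2 \<le> (?a\<^sup>2 - 1) * (?b\<^sup>2 - 1)" by (simp add: p)
  then have "(?a - ?b)\<^sup>2 \<le> 0" by (simp add: power2_eq_square algebra_simps)
  then have "?a = ?b" by simp
  then show ?thesis using \<open>(norm (x - y))\<^sup>2 = 2 * (?a - ?b)\<^sup>2\<close> by simp
qed

text \<open>For distinct points \<open>x - y\<close> has negative square, and the reflection in it
  exchanges them. Being an involution, it transports statements in both directions.\<close>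

lemma Hs_trans:
  assumes x: "x \<in> Hs" and y: "y \<in> Hs"
  obtains r where "r \<in> Lam" "r x = y" "r y = x" "\<And>z. r (r z) = z" "inv r = r"
proof (cases "x = y")
  case True
  show ?thesis by (rule that[of id]) (auto simp: Lam_id True)
next
  case False
  then have "B x y > 1" using Hs_eqI[OF x y] B_ge_1[OF x y] by fastforce
  then have n: "B (x - y) (x - y) < 0" using x y by (simp add: B_simps Hs_iff B_sym)
  have 1: "refl (x - y) x = y" by (rule refl_swap) (use x y n in \<open>auto simp: Hs_iff\<close>)
  then have 2: "refl (x - y) y = x" using refl_refl[of "x - y" x] n by simp
  show ?thesis
    by (rule that[OF refl_Lam[OF n] 1 2]) (use n in \<open>auto simp: refl_refl refl_inv\<close>)
qed

text \<open>The geodesic symmetry at a point \<open>y\<close> of \<open>Hs\<close>: it fixes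
  \<open>y\<close> and is \<open>-1\<close> on the form-complement of \<open>y\<close>.\<close>

definition sig :: "'a \<Rightarrow> 'a \<Rightarrow> 'a" where "sig y x = (2 * B x y) *\<^sub>R y - x"

lemma sig_sig: "y \<in> Hs \<Longrightarrow> sig y (sig y x) = x"
  by (simp add: sig_def B_simps Hs_iff)

lemma sig_Lam: assumes y: "y \<in> Hs" shows "sig y \<in> Lam"
proof -
  have "linear (sig y)" by (rule linearI) (simp_all add: sig_def B_simps algebra_simps)
  moreover have "bij (sig y)" using sig_sig[OF y] by (intro o_bij[of "sig y"]) auto
  moreover have "B (sig y x) (sig y z) = B x z" for x z
    using y by (simp add: sig_def B_simps Hs_iff B_sym[of y z])
  moreover have "sig y (e 0) \<bullet> e 0 > 0"
  proof -
    have "sig y (e 0) \<bullet> e 0 = 2 * (y \<bullet> e 0)\<^sup>2 - 1"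
      by (simp add: sig_def B_sym[of "e 0" y] B_e0 inner_diff_left e_inner power2_eq_square)
    then show ?thesis using Hs_ge1[OF y] by (smt (verit) one_le_power)
  qed
  ultimately show ?thesis by (auto simp: Lam_def)
qed

lemma sig_conj: "g \<in> Lam \<Longrightarrow> g (sig y (inv g x)) = sig (g y) x"
  by (simp add: sig_def linear_diff linear_scale Lam_linear Lam_f_inv)
     (metis Lam_B Lam_f_inv)

lemma isometry_Lam:
  assumes "linear u" "bij u" "\<And>x y. u x \<bullet> u y = x \<bullet> y" "u (e 0) = e 0"
  shows "u \<in> Lam"
proof -
  have "u x \<bullet> e 0 = x \<bullet> e 0" for x using assms(3)[of x "e 0"] assms(4) by simp
  then show ?thesis using assms by (auto simp: Lam_def B_def e_inner)
qed

text \<open>Once \<open>Hs_trans\<close> has moved \<open>c 0\<close> to \<open>e 0\<close>, form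
  and inner product determine each other, so the moved family is orthonormal and the map is an
  orthonormal series. Surjectivity stays conditional because \<open>coordinates_image\<close> needs
  the map for families not yet known to be complete.\<close>

lemma form_map_exists:
  assumes c: "\<And>i j. B (c i) (c j) = B (e i) (e j)" and c0: "c 0 \<in> Hs"
  obtains g where "bounded_linear g" "\<And>x y. B (g x) (g y) = B x y" "\<And>i. g (e i) = c i"
    "(\<And>x. (\<And>i. B x (c i) = 0) \<Longrightarrow> x = 0) \<Longrightarrow> g \<in> Lam"
proof -
  obtain r where r: "r \<in> Lam" "r (c 0) = e 0" "\<And>z. r (r z) = z" "inv r = r"
    using Hs_trans[OF c0 e0_Hs] by metis
  define b where "b i = r (c i)" for i
  have bB: "B (b i) (b j) = B (e i) (e j)" for i j by (simp add: b_def Lam_B[OF r(1)] c)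
  have b0: "b 0 = e 0" by (simp add: b_def r)
  have b0': "b i \<bullet> e 0 = e i \<bullet> e 0" for i using bB[of i 0] by (simp add: b0 B_e0)
  have bi: "b i \<bullet> b j = e i \<bullet> e j" for i j using bB[of i j] by (simp add: B_def b0')
  have bo: "ortho_family b"
    by (simp add: ortho_family_def bi e_inner norm_eq_sqrt_inner)
  define W where "W x = (\<Sum>i. (x \<bullet> e i) *\<^sub>R b i)" for x
  have Ws: "(\<lambda>i. (x \<bullet> e i) *\<^sub>R b i) sums W x" for x
    unfolding W_def by (intro summable_sums ortho_family_summable[OF bo] bessel_summable[OF e_ortho])
  have Wl: "linear W"
  proof (rule linearI)
    show "W (x + y) = W x + W y" for x y
      using sums_add[OF Ws[of x] Ws[of y]] Ws[of "x + y"]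
      by (simp add: inner_add_left scaleR_left_distrib sums_unique2)
    show "W (k *\<^sub>R x) = k *\<^sub>R W x" for k x
      using sums_scaleR_right[OF Ws[of x], of k] Ws[of "k *\<^sub>R x"] by (simp add: sums_unique2)
  qed
  have Wb: "W x \<bullet> b k = x \<bullet> e k" for x k
  proof -
    have "(\<lambda>i. ((x \<bullet> e i) *\<^sub>R b i) \<bullet> b k) sums (W x \<bullet> b k)"
      using bounded_linear.sums[OF bounded_linear_inner_left Ws] .
    moreover have "(\<lambda>i. ((x \<bullet> e i) *\<^sub>R b i) \<bullet> b k) sums (\<Sum>i\<in>{k}. ((x \<bullet> e i) *\<^sub>R b i) \<bullet> b k)"
      by (rule sums_finite) (auto simp: bi e_inner)
    ultimately show ?thesis by (simp add: bi e_inner sums_unique2)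
  qed
  have Wi: "W x \<bullet> W y = x \<bullet> y" for x y
  proof -
    have "(\<lambda>i. ((x \<bullet> e i) *\<^sub>R b i) \<bullet> W y) sums (W x \<bullet> W y)"
      using bounded_linear.sums[OF bounded_linear_inner_left Ws] .
    then have "(\<lambda>i. (x \<bullet> e i) * (y \<bullet> e i)) sums (W x \<bullet> W y)"
      by (simp add: Wb inner_commute[of "b _"])
    then show ?thesis using parseval sums_unique2 by blast
  qed
  have WB: "B (W x) (W y) = B x y" for x y
    using Wb[of _ 0] by (simp add: B_def Wi b0)
  have We: "W (e k) = b k" for k
  proof -
    have "(\<lambda>i. (e k \<bullet> e i) *\<^sub>R b i) sums (\<Sum>i\<in>{k}. (e k \<bullet> e i) *\<^sub>R b i)"
      by (rule sums_finite) (auto simp: e_inner)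
    then show ?thesis using Ws[of "e k"] by (simp add: e_inner sums_unique2)
  qed
  define g where "g = r \<circ> W"
  have "norm (W x) = norm x" for x by (simp add: norm_eq_sqrt_inner Wi)
  then have "bounded_linear W"
    by (intro bounded_linear_intro[where K = 1]) (auto simp: linear_add[OF Wl] linear_scale[OF Wl])
  then have gbl: "bounded_linear g"
    unfolding g_def comp_def by (rule bounded_linear_compose[OF Lam_bounded_linear[OF r(1)]])
  then have gl: "linear g" by (rule bounded_linear.linear)
  have gB: "B (g x) (g y) = B x y" for x y by (simp add: g_def Lam_B[OF r(1)] WB)
  have ge: "g (e i) = c i" for i by (simp add: g_def We b_def r)
  show ?thesis
  proof (rule that[OF gbl gB ge])
    assume comp: "\<And>x. (\<And>i. B x (c i) = 0) \<Longrightarrow> x = 0"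
    have "inj g"
      by (rule injI, rule B_eqI') (metis gB)
    moreover have "surj g"
    proof (rule surjI)
      fix y0
      define y where "y = r y0"
      define x where "x = (\<Sum>i. (y \<bullet> b i) *\<^sub>R e i)"
      have xs: "(\<lambda>i. (y \<bullet> b i) *\<^sub>R e i) sums x"
        unfolding x_def by (intro summable_sums ortho_family_summable[OF e_ortho] bessel_summable[OF bo])
      have xe: "x \<bullet> e k = y \<bullet> b k" for k
      proof -
        have "(\<lambda>i. ((y \<bullet> b i) *\<^sub>R e i) \<bullet> e k) sums (x \<bullet> e k)"
          using bounded_linear.sums[OF bounded_linear_inner_left xs] .
        moreover have "(\<lambda>i. ((y \<bullet> b i) *\<^sub>R e i) \<bullet> e k) sums (\<Sum>i\<in>{k}. ((y \<bullet> b i) *\<^sub>R e i) \<bullet> e k)"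
          by (rule sums_finite) (auto simp: e_inner)
        ultimately show ?thesis by (simp add: e_inner sums_unique2)
      qed
      have "r (y - W x) = 0"
      proof (rule comp)
        fix i
        have "B (r (y - W x)) (c i) = B (y - W x) (b i)"
          using Lam_adj[OF r(1)] r(4) by (simp add: b_def)
        also have "\<dots> = 0"
          using Wb[of x 0] xe[of 0] by (simp add: B_def inner_diff_left Wb xe b0)
        finally show "B (r (y - W x)) (c i) = 0" .
      qed
      then have "y - W x = 0" by (metis r(3) linear_0 Lam_linear[OF r(1)])
      then show "g ((\<lambda>y0. (\<Sum>i. (r y0 \<bullet> b i) *\<^sub>R e i)) y0) = y0"
        using r(3) by (simp add: g_def x_def y_def)
    qed
    ultimately show "g \<in> Lam"
      using gl gB c0 ge by (auto simp: Lam_def bij_def Hs_iff)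
  qed
qed

end

section \<open>Pointwise stabilisers of basis vectors\<close>

lemma infinite_nat_split:
  assumes "infinite (I :: nat set)"
  obtains I1 I2 where "infinite I1" "infinite I2" "I1 \<subseteq> I" "I2 \<subseteq> I" "I1 \<inter> I2 = {}"
proof -
  obtain f :: "nat \<Rightarrow> nat" where f: "inj f" "range f \<subseteq> I"
    using infinite_countable_subset[OF assms] by blast
  have 1: "infinite (range (\<lambda>n. f (2 * n)))" "infinite (range (\<lambda>n. f (Suc (2 * n))))"
    by (auto intro!: range_inj_infinite injI dest!: injD[OF f(1)])
  have "range (\<lambda>n. f (2 * n)) \<inter> range (\<lambda>n. f (Suc (2 * n))) = {}"
    by (auto dest!: injD[OF f(1)]) presburger
  then show ?thesis using that 1 f(2) by blast
qed

context hyp begin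

definition coord :: "nat set \<Rightarrow> 'a set" where
  "coord A = {x. \<forall>i. i \<notin> A \<longrightarrow> x \<bullet> e i = 0}"

text \<open>For \<open>0 \<notin> A\<close> the vector \<open>e 0\<close> is fixed, hence form and
  inner product are both preserved, and this is the orthogonal group of \<open>coord A\<close>,
  extended by the identity.\<close>

definition Orth :: "nat set \<Rightarrow> ('a \<Rightarrow> 'a) set" where
  "Orth A = {g \<in> Lam. \<forall>i. i \<notin> A \<longrightarrow> g (e i) = e i}"

lemma coord_add: "x \<in> coord A \<Longrightarrow> y \<in> coord A \<Longrightarrow> x + y \<in> coord A"
  and coord_diff: "x \<in> coord A \<Longrightarrow> y \<in> coord A \<Longrightarrow> x - y \<in> coord A"
  and coord_scale: "x \<in> coord A \<Longrightarrow> c *\<^sub>R x \<in> coord A"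
  and coord_zero: "0 \<in> coord A"
  by (auto simp: coord_def inner_add_left inner_diff_left)

lemma coord_sum: "(\<And>i. i \<in> I \<Longrightarrow> f i \<in> coord A) \<Longrightarrow> (\<Sum>i\<in>I. f i) \<in> coord A"
  by (induction I rule: infinite_finite_induct) (auto intro: coord_add coord_zero)

lemma coord_e: "i \<in> A \<Longrightarrow> e i \<in> coord A"
  by (auto simp: coord_def e_inner)

lemma coord_mono: "A \<subseteq> A' \<Longrightarrow> coord A \<subseteq> coord A'"
  by (auto simp: coord_def)

lemma coord_orth: assumes "x \<in> coord A" "y \<in> coord A'" "A \<inter> A' = {}" shows "x \<bullet> y = 0"
proof -
  have "(\<lambda>i. (x \<bullet> e i) * (y \<bullet> e i)) = (\<lambda>i. 0)"
    using assms by (fastforce simp: coord_def)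
  then show ?thesis using parseval[of x y] sums_unique2[OF _ sums_zero] by metis
qed

lemma coord_B: "0 \<notin> A \<Longrightarrow> x \<in> coord A \<Longrightarrow> B x y = - (x \<bullet> y)"
  by (simp add: coord_def B_def)

lemma coord_B_neg: "0 \<notin> A \<Longrightarrow> x \<in> coord A \<Longrightarrow> x \<noteq> 0 \<Longrightarrow> B x x < 0"
  by (simp add: coord_B)

lemma coord_map_eq:
  assumes "bounded_linear g" "bounded_linear h" "\<And>i. i \<in> A \<Longrightarrow> g (e i) = h (e i)" "x \<in> coord A"
  shows "g x = h x"
proof -
  have "(\<lambda>i. g ((x \<bullet> e i) *\<^sub>R e i)) sums g x" "(\<lambda>i. h ((x \<bullet> e i) *\<^sub>R e i)) sums h x"
    using bounded_linear.sums[OF assms(1) expand] bounded_linear.sums[OF assms(2) expand] by auto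
  moreover have "g ((x \<bullet> e i) *\<^sub>R e i) = h ((x \<bullet> e i) *\<^sub>R e i)" for i
    using assms(3)[of i] assms(4)
    by (cases "i \<in> A") (auto simp: coord_def linear_scale bounded_linear.linear[OF assms(1)]
        bounded_linear.linear[OF assms(2)] linear_0)
  ultimately show ?thesis by (simp add: sums_unique2)
qed

lemma coord_fix: "g \<in> Lam \<Longrightarrow> (\<And>i. i \<in> A \<Longrightarrow> g (e i) = e i) \<Longrightarrow> x \<in> coord A \<Longrightarrow> g x = x"
  using coord_map_eq[of g "\<lambda>x. x" A x] Lam_bounded_linear bounded_linear_ident by metis

lemma Orth_Lam: "g \<in> Orth A \<Longrightarrow> g \<in> Lam" by (simp add: Orth_def)

lemma Orth_fix_e: "g \<in> Orth A \<Longrightarrow> i \<notin> A \<Longrightarrow> g (e i) = e i" by (simp add: Orth_def)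

lemma Orth_id: "id \<in> Orth A" by (simp add: Orth_def Lam_id)

lemma Orth_mono: "A \<subseteq> A' \<Longrightarrow> Orth A \<subseteq> Orth A'" by (auto simp: Orth_def)

lemma Orth_comp: "f \<in> Orth A \<Longrightarrow> g \<in> Orth A \<Longrightarrow> f \<circ> g \<in> Orth A" by (auto simp: Orth_def Lam_comp)

lemma Orth_inv: "g \<in> Orth A \<Longrightarrow> inv g \<in> Orth A"
  unfolding Orth_def using Lam_inv Lam_inv_f by (smt (verit, best) mem_Collect_eq)

lemma Orth_fix: "g \<in> Orth A \<Longrightarrow> x \<in> coord (- A) \<Longrightarrow> g x = x"
  by (rule coord_fix[of g "- A"]) (auto simp: Orth_def)

lemma Orth_inner: assumes "0 \<notin> A" "g \<in> Orth A" shows "g x \<bullet> g y = x \<bullet> y"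
proof -
  have g: "g \<in> Lam" "g (e 0) = e 0" using assms by (auto simp: Orth_def)
  have "g z \<bullet> e 0 = z \<bullet> e 0" for z using Lam_B[OF g(1), of z "e 0"] g(2) by (simp add: B_e0)
  then show ?thesis using Lam_B[OF g(1), of x y] by (simp add: B_def)
qed

lemma Orth_adj: "0 \<notin> A \<Longrightarrow> g \<in> Orth A \<Longrightarrow> g x \<bullet> y = x \<bullet> inv g y"
  by (metis Orth_inner Lam_f_inv Orth_Lam)

lemma Orth_coord: assumes "0 \<notin> A" "g \<in> Orth A" "x \<in> coord A" shows "g x \<in> coord A"
  unfolding coord_def
proof safe
  fix i assume i: "i \<notin> A"
  then have "g x \<bullet> e i = g x \<bullet> g (e i)" using assms by (simp add: Orth_fix_e)
  then show "g x \<bullet> e i = 0" using assms i by (simp add: Orth_inner) (simp add: coord_def)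
qed

lemma refl_Orth:
  assumes "0 \<notin> A" "v \<in> coord A" "v \<noteq> 0"
  shows "refl v \<in> Orth A"
proof -
  have "B (e i) v = 0" if "i \<notin> A" for i
    using that assms(2) coord_B[OF assms(1,2), of "e i"] by (simp add: B_sym coord_def)
  then show ?thesis
    using refl_Lam coord_B_neg[OF assms] by (auto simp: Orth_def refl_def)
qed

lemma isometry_Orth:
  assumes "0 \<notin> A" "linear u" "\<And>x. u (u x) = x" "\<And>x y. u x \<bullet> u y = x \<bullet> y"
    "\<And>i. i \<notin> A \<Longrightarrow> u (e i) = e i"
  shows "u \<in> Orth A"
proof -
  have "bij u" using assms(3) by (intro o_bij[of u]) auto
  then have "u \<in> Lam" using assms by (intro isometry_Lam) auto
  then show ?thesis using assms by (simp add: Orth_def)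
qed

lemma simultaneous_reflection_Orth:
  fixes v v' :: "nat \<Rightarrow> 'a"
  assumes "0 \<notin> A" "\<And>k. v k \<in> coord A" "\<And>k. v' k \<in> coord A" "\<And>k. norm (v k) = norm (v' k)"
    "\<And>j k. j \<noteq> k \<Longrightarrow> v j \<bullet> v k = 0" "\<And>j k. j \<noteq> k \<Longrightarrow> v j \<bullet> v' k = 0"
    "\<And>j k. j \<noteq> k \<Longrightarrow> v' j \<bullet> v' k = 0"
  obtains u where "u \<in> Orth A" "\<And>k. u (v k) = v' k"
    "\<And>x. (\<And>k. x \<bullet> v k = x \<bullet> v' k) \<Longrightarrow> u x = x"
proof -
  obtain u where u: "linear u" "\<And>x. u (u x) = x" "\<And>x y. u x \<bullet> u y = x \<bullet> y" "\<And>k. u (v k) = v' k"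
    "\<And>x. (\<And>k. x \<bullet> v k = x \<bullet> v' k) \<Longrightarrow> u x = x"
    using simultaneous_reflection[of v v'] assms(4-7) by blast
  have "u \<in> Orth A"
    by (rule isometry_Orth[OF assms(1) u(1-3)], rule u(5))
       (use assms(2,3) in \<open>auto simp: coord_def inner_commute[of "e _"]\<close>)
  then show ?thesis using that u by blast
qed

lemma Lam_exists:
  assumes c: "\<And>i j. B (c i) (c j) = B (e i) (e j)" and c0: "c 0 \<in> Hs"
    and comp: "\<And>x. (\<And>i. B x (c i) = 0) \<Longrightarrow> x = 0"
  obtains g where "g \<in> Lam" "\<And>i. g (e i) = c i"
proof (rule form_map_exists[OF c c0])
  fix g
  assume g: "\<And>i. g (e i) = c i" and "(\<And>x. (\<And>i. B x (c i) = 0) \<Longrightarrow> x = 0) \<Longrightarrow> g \<in> Lam"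
  from this(2)[OF comp] show thesis using g by (rule that)
qed

lemma perm_exists:
  assumes "bij \<pi>" "\<pi> 0 = 0"
  obtains g where "g \<in> Lam" "\<And>i. g (e i) = e (\<pi> i)"
proof -
  have inj: "\<pi> i = \<pi> j \<longleftrightarrow> i = j" for i j using assms(1) by (auto simp: bij_def inj_eq)
  have "\<pi> i = 0 \<longleftrightarrow> i = 0" for i using inj[of i 0] assms(2) by simp
  then have BB: "B (e (\<pi> i)) (e (\<pi> j)) = B (e i) (e j)" for i j by (simp add: B_ee inj)
  have comp: "x = 0" if "\<And>i. B x (e (\<pi> i)) = 0" for x
  proof (rule B_eqI)
    fix i
    obtain j where "i = \<pi> j" using assms(1) by (metis bij_pointE)
    then show "B x (e i) = B 0 (e i)" using that by (simp add: B_simps)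
  qed
  have "e (\<pi> 0) \<in> Hs" by (simp add: assms e0_Hs)
  from Lam_exists[of "\<lambda>i. e (\<pi> i)", OF BB this comp]
  obtain g where "g \<in> Lam" "\<And>i. g (e i) = e (\<pi> i)" by blast
  then show ?thesis by (rule that)
qed

text \<open>Disjoint blocks are orthogonal, so the images of the basis vectors again form an
  orthonormal family. This lets one group element realise infinitely many independent
  choices.\<close>

lemma direct_sum_exists:
  fixes A :: "nat \<Rightarrow> nat set"
  assumes A0: "\<And>j. 0 \<notin> A j" and disj: "\<And>j k. j \<noteq> k \<Longrightarrow> A j \<inter> A k = {}" and g: "\<And>j. g j \<in> Orth (A j)"
  obtains h where "h \<in> Orth (\<Union>j. A j)" "\<And>j i. i \<in> A j \<Longrightarrow> h (e i) = g j (e i)"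
proof -
  define c where "c i = (if i \<in> (\<Union>j. A j) then g (THE j. i \<in> A j) (e i) else e i)" for i
  have cA: "c i = g j (e i)" if "i \<in> A j" for i j
  proof -
    have "(THE j. i \<in> A j) = j" using that disj by blast
    then show ?thesis using that by (auto simp: c_def)
  qed
  have cn: "c i = e i" if "\<And>j. i \<notin> A j" for i using that by (simp add: c_def)
  have csub: "c i \<in> coord (A j)" if "i \<in> A j" for i j
    using cA[OF that] Orth_coord[OF A0 g coord_e[OF that]] by simp
  have c0: "c 0 = e 0" using A0 by (simp add: cn)
  have cc: "c i \<bullet> c j = e i \<bullet> e j" for i j
  proof (cases "\<exists>k. i \<in> A k")
    case True
    then obtain k where k: "i \<in> A k" by blast
    show ?thesis
    proof (cases "j \<in> A k")
      case True
      then show ?thesis using k cA Orth_inner[OF A0 g] by simp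
    next
      case False
      then have ij: "i \<noteq> j" using k by auto
      have "c j \<in> coord (- A k)"
      proof (cases "\<exists>l. j \<in> A l")
        case True
        then obtain l where l: "j \<in> A l" by blast
        then have "A l \<subseteq> - A k" using disj[of l k] False by auto
        then show ?thesis using csub[OF l] coord_mono by blast
      next
        case F2: False
        then show ?thesis using False by (simp add: cn coord_e)
      qed
      then have "c i \<bullet> c j = 0" using coord_orth[OF csub[OF k]] by blast
      then show ?thesis using ij by (simp add: e_inner)
    qed
  next
    case F: False
    show ?thesis
    proof (cases "\<exists>k. j \<in> A k")
      case True
      then obtain k where k: "j \<in> A k" by blast
      have "c i \<in> coord (- A k)" using F by (simp add: cn coord_e)
      then have "c i \<bullet> c j = 0" using coord_orth[OF _ csub[OF k]] by blast
      then show ?thesis using F k by (auto simp: e_inner)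
    next
      case False
      then show ?thesis using F by (simp add: cn)
    qed
  qed
  have BB: "B (c i) (c j) = B (e i) (e j)" for i j
    using cc[of _ 0] cc by (simp add: B_def c0)
  have comp: "x = 0" if x: "\<And>i. B x (c i) = 0" for x
  proof (rule e_eqI)
    have xc: "x \<bullet> c i = 0" for i
      using x[of i] x[of 0] by (simp add: B_def c0 e_inner)
    fix i
    show "x \<bullet> e i = 0 \<bullet> e i"
    proof (cases "\<exists>k. i \<in> A k")
      case True
      then obtain k where k: "i \<in> A k" by blast
      \<comment> \<open>Pulled back by \<open>g k\<close>, the vector has no component in the block,
        so \<open>g k\<close> fixes it, and \<open>x\<close> itself has no component there.\<close>
      define y where "y = inv (g k) x"
      have gk: "g k \<in> Lam" using g Orth_Lam by blast
      have xy: "x = g k y" by (simp add: y_def Lam_f_inv[OF gk])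
      have "y \<bullet> e j = 0" if "j \<in> A k" for j
        using xc[of j] cA[OF that] Orth_inner[OF A0 g, of k y "e j"] by (simp add: xy)
      then have "y \<in> coord (- A k)" by (simp add: coord_def)
      then have "g k y = y" using Orth_fix[OF g] by blast
      then show ?thesis using \<open>y \<in> coord (- A k)\<close> k by (simp add: xy coord_def)
    next
      case False
      then show ?thesis using xc[of i] by (simp add: cn)
    qed
  qed
  have "c 0 \<in> Hs" by (simp add: c0 e0_Hs)
  from Lam_exists[OF BB this comp] obtain h where h: "h \<in> Lam" "\<And>i. h (e i) = c i" by blast
  have "h \<in> Orth (\<Union>j. A j)" using h cn by (auto simp: Orth_def)
  then show ?thesis using that h cA by simp
qed

text \<open>Induction on \<open>Y\<close>: two solutions supported on disjoint infinite parts of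
  \<open>I\<close> are independent, and a combination of them cancels the pairing with the new
  vector.\<close>

lemma orth_vector_exists:
  assumes "infinite I" "finite Y"
  obtains u where "u \<in> coord I" "norm u = 1" "\<And>y. y \<in> Y \<Longrightarrow> u \<bullet> y = 0"
proof -
  have "\<exists>u. u \<in> coord I \<and> u \<noteq> 0 \<and> (\<forall>y\<in>Y. u \<bullet> y = 0)"
    using assms(2,1)
  proof (induction Y arbitrary: I)
    case empty
    then obtain i where "i \<in> I" using infinite_imp_nonempty by blast
    then show ?case using coord_e[of i I] e_norm[of i] norm_zero by (metis empty_iff zero_neq_one)
  next
    case (insert y Y)
    obtain I1 I2 where I: "infinite I1" "infinite I2" "I1 \<subseteq> I" "I2 \<subseteq> I" "I1 \<inter> I2 = {}"
      using infinite_nat_split[OF insert.prems] by metis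
    obtain u1 u2 where u1: "u1 \<in> coord I1" "u1 \<noteq> 0" "\<forall>y\<in>Y. u1 \<bullet> y = 0"
      and u2: "u2 \<in> coord I2" "u2 \<noteq> 0" "\<forall>y\<in>Y. u2 \<bullet> y = 0"
      using insert.IH I by metis
    have s: "u1 \<in> coord I" "u2 \<in> coord I" using u1 u2 I coord_mono by blast+
    show ?case
    proof (cases "u1 \<bullet> y = 0")
      case True
      then show ?thesis using u1 s by auto
    next
      case False
      define w where "w = (u2 \<bullet> y) *\<^sub>R u1 - (u1 \<bullet> y) *\<^sub>R u2"
      have "u2 \<bullet> w = - (u1 \<bullet> y) * (u2 \<bullet> u2)"
        using coord_orth[OF u1(1) u2(1) I(5)] by (simp add: w_def inner_diff_right inner_commute)
      then have "w \<noteq> 0" using False u2(2) by auto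
      moreover have "w \<in> coord I" unfolding w_def by (intro coord_diff coord_scale s)
      moreover have "\<forall>z\<in>insert y Y. w \<bullet> z = 0"
        using u1 u2 by (auto simp: w_def inner_diff_left)
      ultimately show ?thesis by blast
    qed
  qed
  then obtain u where u: "u \<in> coord I" "u \<noteq> 0" "\<forall>y\<in>Y. u \<bullet> y = 0" by blast
  show ?thesis
    by (rule that[of "(1 / norm u) *\<^sub>R u"]) (use u in \<open>auto intro: coord_scale\<close>)
qed

end

section \<open>Sets with countably many covering translates\<close>

primrec pw :: "('b \<Rightarrow> 'b) set \<Rightarrow> nat \<Rightarrow> ('b \<Rightarrow> 'b) set" where
  "pw W 0 = {id}"
| "pw W (Suc n) = {a \<circ> b | a b. a \<in> W \<and> b \<in> pw W n}"

lemma pw_add: "a \<in> pw W m \<Longrightarrow> b \<in> pw W n \<Longrightarrow> a \<circ> b \<in> pw W (m + n)"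
proof (induction m arbitrary: a)
  case (Suc m)
  then obtain c d where "a = c \<circ> d" "c \<in> W" "d \<in> pw W m" by auto
  moreover have "d \<circ> b \<in> pw W (m + n)"
    using Suc.IH Suc.prems(2) calculation(3) by blast
  ultimately have "a \<circ> b = c \<circ> (d \<circ> b)" "d \<circ> b \<in> pw W (m + n)" "c \<in> W"
    by (auto simp: comp_assoc)
  then show ?case unfolding add_Suc pw.simps by blast
qed simp

lemma pw_one: "pw W (Suc 0) = W" by auto

lemma pw_mono_base: "V \<subseteq> W \<Longrightarrow> pw V n \<subseteq> pw W n"
  by (induction n) auto

lemma pw_mono: assumes "id \<in> W" "m \<le> n" shows "pw W m \<subseteq> pw W n"
proof -
  have "pw W m \<subseteq> pw W (m + k)" for k
  proof (induction k)
    case (Suc k)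
    have "pw W (m + k) \<subseteq> pw W (Suc (m + k))"
    proof
      fix a assume "a \<in> pw W (m + k)"
      then show "a \<in> pw W (Suc (m + k))"
        using assms(1) unfolding pw.simps by (metis (mono_tags, lifting) id_comp mem_Collect_eq)
    qed
    then show ?case using Suc by auto
  qed simp
  then show ?thesis using assms(2) by (metis le_add_diff_inverse)
qed

text \<open>These properties are all that is kept of a symmetric identity neighbourhood in a
  separable group once the topology is forgotten.\<close>

locale syndetic = hyp e for e :: "nat \<Rightarrow> 'a::{real_inner, complete_space}" +
  fixes W :: "('a \<Rightarrow> 'a) set"
  assumes W_Lam: "W \<subseteq> Lam" and W_id: "id \<in> W" and W_inv: "\<And>w. w \<in> W \<Longrightarrow> inv w \<in> W"
    and W_cover: "\<exists>k :: nat \<Rightarrow> 'a \<Rightarrow> 'a. range k \<subseteq> Lam \<and> (\<forall>g\<in>Lam. \<exists>n. \<exists>w\<in>W. g = k n \<circ> w)"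
begin

lemma pw_Lam: "a \<in> pw W n \<Longrightarrow> a \<in> Lam"
  using W_Lam by (induction n arbitrary: a) (auto simp: Lam_id intro!: Lam_comp)

lemma pw_inv: "a \<in> pw W n \<Longrightarrow> inv a \<in> pw W n"
proof (induction n arbitrary: a)
  case (Suc n)
  then obtain b c where bc: "a = b \<circ> c" "b \<in> W" "c \<in> pw W n" by auto
  then have "inv a = inv c \<circ> inv b" using Lam_inv_comp W_Lam pw_Lam by blast
  moreover have "inv c \<circ> inv b \<in> pw W (n + Suc 0)"
    using pw_add Suc.IH bc W_inv pw_one by blast
  ultimately show ?case by (simp del: pw.simps o_apply comp_apply)
qed simp

lemma pw_comp: "a \<in> pw W m \<Longrightarrow> b \<in> pw W n \<Longrightarrow> m + n = k \<Longrightarrow> a \<circ> b \<in> pw W k"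
  using pw_add by blast

text \<open>Two of the elements lie in the same translate \<open>k n\<close> of \<open>W\<close>,
  and \<open>k n\<close> cancels in their quotient.\<close>

lemma pigeonhole:
  fixes f :: "'i \<Rightarrow> 'a \<Rightarrow> 'a"
  assumes "uncountable (UNIV :: 'i set)" "\<And>i. f i \<in> Lam"
  obtains i j where "i \<noteq> j" "inv (f i) \<circ> f j \<in> pw W 2"
proof -
  obtain k :: "nat \<Rightarrow> 'a \<Rightarrow> 'a" where k: "range k \<subseteq> Lam" "\<And>g. g \<in> Lam \<Longrightarrow> \<exists>n. \<exists>w\<in>W. g = k n \<circ> w"
    using W_cover by blast
  have "\<forall>i. \<exists>n. \<exists>w. w \<in> W \<and> f i = k n \<circ> w" using k(2) assms(2) by blast
  then obtain n w where nw: "\<And>i. w i \<in> W \<and> f i = k (n i) \<circ> w i" by metis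
  have "\<not> inj n" using assms(1) by (metis countableI)
  then obtain i j where ij: "i \<noteq> j" "n i = n j" by (auto simp: inj_on_def)
  have kL: "k (n i) \<in> Lam" "w i \<in> Lam" "w j \<in> Lam" using k(1) nw W_Lam by auto
  have "inv (f i) \<circ> f j = inv (w i) \<circ> inv (k (n i)) \<circ> (k (n i) \<circ> w j)"
    using nw ij(2) Lam_inv_comp kL by metis
  also have "\<dots> = inv (w i) \<circ> w j"
    using Lam_inv_f[OF kL(1)] by (auto simp: fun_eq_iff)
  finally show ?thesis
    using that[OF ij(1)] pw_comp[of "inv (w i)" "Suc 0" "w j" "Suc 0" 2] nw W_inv pw_one by simp
qed

text \<open>A diagonal argument: if no \<open>j\<close> worked, the direct sum of the bad isometries would not be
  covered by the countably many translates of \<open>W\<close>.\<close>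

lemma full_block:
  fixes A :: "nat \<Rightarrow> nat set"
  assumes A0: "\<And>j. 0 \<notin> A j" and disj: "\<And>j k. j \<noteq> k \<Longrightarrow> A j \<inter> A k = {}"
  obtains j where "\<And>g. g \<in> Orth (A j) \<Longrightarrow> \<exists>w\<in>pw W 2. \<forall>i\<in>A j. w (e i) = g (e i)"
proof -
  obtain k :: "nat \<Rightarrow> 'a \<Rightarrow> 'a" where k: "range k \<subseteq> Lam" "\<And>g. g \<in> Lam \<Longrightarrow> \<exists>n. \<exists>w\<in>W. g = k n \<circ> w"
    using W_cover by blast
  have "\<exists>j. \<forall>g\<in>Orth (A j). \<exists>w\<in>W. \<forall>i\<in>A j. k j (w (e i)) = g (e i)"
  proof (rule ccontr)
    assume "\<not> ?thesis"
    then have "\<forall>j. \<exists>g. g \<in> Orth (A j) \<and> (\<forall>w\<in>W. \<exists>i\<in>A j. k j (w (e i)) \<noteq> g (e i))" by blast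
    then obtain g where g: "\<And>j. g j \<in> Orth (A j)"
      "\<And>j w. w \<in> W \<Longrightarrow> \<exists>i\<in>A j. k j (w (e i)) \<noteq> g j (e i)" by metis
    obtain h where h: "h \<in> Orth (\<Union>j. A j)" "\<And>j i. i \<in> A j \<Longrightarrow> h (e i) = g j (e i)"
      using direct_sum_exists[of A g] A0 disj g(1) by blast
    obtain j w where "w \<in> W" "h = k j \<circ> w" using k(2) h(1) Orth_Lam by blast
    then show False using g(2)[of w j] h(2)[of _ j] by auto
  qed
  then obtain j where j: "\<And>g. g \<in> Orth (A j) \<Longrightarrow> \<exists>w\<in>W. \<forall>i\<in>A j. k j (w (e i)) = g (e i)" by blast
  \<comment> \<open>The unknown \<open>k j\<close> is removed by comparison with the identity:
    \<open>k j \<circ> v\<close> is trivial on the block, so \<open>inv v \<circ> w\<close> acts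
    there as \<open>g\<close>.\<close>
  obtain v where v: "v \<in> W" "\<forall>i\<in>A j. k j (v (e i)) = e i" using j[OF Orth_id] by auto
  have kv: "k j \<circ> v \<in> Lam" using k(1) v(1) W_Lam Lam_comp by blast
  show ?thesis
  proof (rule that[of j])
    fix g assume g: "g \<in> Orth (A j)"
    then obtain w where w: "w \<in> W" "\<forall>i\<in>A j. k j (w (e i)) = g (e i)" using j by blast
    have "inv v (w (e i)) = g (e i)" if i: "i \<in> A j" for i
    proof -
      have "(k j \<circ> v) (g (e i)) = g (e i)"
        by (rule coord_fix[OF kv, of "A j"]) (use v(2) Orth_coord[OF A0 g coord_e[OF i]] in auto)
      then have "k j (v (g (e i))) = k j (w (e i))" using w(2) i by simp
      then have "v (g (e i)) = w (e i)" using k(1) Lam_inv_f by (metis range_subsetD)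
      then show ?thesis using v(1) W_Lam Lam_inv_f by (metis subsetD)
    qed
    moreover have "inv v \<circ> w \<in> pw W 2"
      using pw_comp[of "inv v" "Suc 0" w "Suc 0" 2] v w W_inv pw_one by simp
    ultimately show "\<exists>w\<in>pw W 2. \<forall>i\<in>A j. w (e i) = g (e i)" by (intro bexI[of _ "inv v \<circ> w"]) auto
  qed
qed

end

context hyp begin

text \<open>\<open>w\<close> agrees with \<open>d\<close> on \<open>coord A\<close>, hence preserves
  both this space and its complement, and \<open>s\<close> is trivial on the complement. So the
  partial control given by \<open>full_block\<close> is enough when conjugating elements of the
  block.\<close>

lemma conj_eq_of_agree:
  assumes A0: "0 \<notin> A" and s: "s \<in> Orth A" and d: "d \<in> Orth A" and w: "w \<in> Lam"
    and agree: "\<And>i. i \<in> A \<Longrightarrow> w (e i) = d (e i)"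
  shows "w \<circ> s \<circ> inv w = d \<circ> s \<circ> inv d"
proof (rule Lam_eqI)
  have dL: "d \<in> Lam" "s \<in> Lam" using d s Orth_Lam by auto
  show "w \<circ> s \<circ> inv w \<in> Lam" "d \<circ> s \<circ> inv d \<in> Lam"
    using w dL Lam_comp Lam_inv by blast+
  have wd: "w x = d x" if "x \<in> coord A" for x
    using coord_map_eq[of w d A] agree that Lam_bounded_linear w dL by blast
  fix i
  show "(w \<circ> s \<circ> inv w) (e i) = (d \<circ> s \<circ> inv d) (e i)"
  proof (cases "i \<in> A")
    case True
    have 1: "inv d (e i) \<in> coord A" using Orth_coord[OF A0 Orth_inv[OF d] coord_e[OF True]] .
    then have "w (inv d (e i)) = e i" using wd Lam_f_inv dL by simp
    then have "inv w (e i) = inv d (e i)" using Lam_inv_f[OF w] by metis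
    then show ?thesis using Orth_coord[OF A0 s 1] wd by simp
  next
    case False
    then have d1: "inv d (e i) = e i" "s (e i) = e i" "d (e i) = e i"
      using Orth_inv[OF d] s d by (auto simp: Orth_def)
    have "inv w (e i) \<bullet> e j = 0" if j: "j \<in> A" for j
    proof -
      have "B (inv w (e i)) (e j) = B (e i) (w (e j))"
        using Lam_adj[OF w] by (simp add: B_sym)
      also have "\<dots> = B (e i) (d (e j))" using agree j by simp
      also have "\<dots> = - (d (e j) \<bullet> e i)"
        using coord_B[OF A0 Orth_coord[OF A0 d coord_e[of j]], of "e i"] j by (simp add: B_sym)
      also have "\<dots> = 0" using Orth_coord[OF A0 d coord_e[of j]] j False by (simp add: coord_def)
      finally show ?thesis using j A0 B_e by (metis neg_equal_0_iff_equal)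
    qed
    then have "inv w (e i) \<in> coord (- A)" by (simp add: coord_def)
    then have "s (inv w (e i)) = inv w (e i)" using Orth_fix[OF s] by blast
    then show ?thesis by (simp add: d1 Lam_f_inv[OF w])
  qed
qed

end

lemma uncountable_bool_seq: "uncountable (UNIV :: (nat \<Rightarrow> bool) set)"
proof
  assume "countable (UNIV :: (nat \<Rightarrow> bool) set)"
  then obtain f :: "nat \<Rightarrow> nat \<Rightarrow> bool" where "range f = UNIV"
    unfolding countable_def using uncountable_def[of "UNIV :: (nat \<Rightarrow> bool) set"]
    by (metis UNIV_not_empty \<open>countable UNIV\<close>)
  then obtain n where "f n = (\<lambda>i. \<not> f i i)" by (metis UNIV_I imageE)
  then show False by (metis)
qed

section \<open>The swindle and the exchange of blocks\<close>

context hyp begin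

lemma perm_Orth:
  assumes "bij \<pi>" "\<And>x. x \<notin> A \<Longrightarrow> \<pi> x = x" "0 \<notin> A"
  obtains g where "g \<in> Orth A" "\<And>i. g (e i) = e (\<pi> i)"
proof -
  obtain g where "g \<in> Lam" "\<And>i. g (e i) = e (\<pi> i)"
    using perm_exists[OF assms(1)] assms(2,3) by blast
  then show ?thesis using that assms by (auto simp: Orth_def)
qed

text \<open>The swindle: with \<open>D\<close> acting as \<open>g\<close> on each of the copies \<open>C 0, C 1, \<dots>\<close>, the shifted
  operator cancels \<open>D\<close> on all copies but the first.\<close>

lemma shift_commutator:
  fixes C :: "int \<Rightarrow> nat set"
  assumes S: "S \<in> Lam" "bij \<sigma>" "\<And>x. S (e x) = e (\<sigma> x)"
    and C: "\<And>m. 0 \<notin> C m" "\<And>m n. m \<noteq> n \<Longrightarrow> C m \<inter> C n = {}"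
    and \<sigma>: "\<And>m x. \<sigma> x \<in> C (m + 1) \<longleftrightarrow> x \<in> C m"
    and g: "g \<in> Orth (C 0)"
  obtains D where "D \<in> Orth (\<Union>m. C m)" "g = D \<circ> S \<circ> inv D \<circ> inv S"
proof -
  have SL: "S ^^ n \<in> Lam" for n
    by (induction n) (simp_all only: funpow.simps Lam_id Lam_comp S)
  have Se: "(S ^^ n) (e x) = e ((\<sigma> ^^ n) x)" for n x
    by (induction n) (auto simp: S)
  have \<sigma>n: "(\<sigma> ^^ n) x \<in> C (m + int n) \<longleftrightarrow> x \<in> C m" for n x m
  proof (induction n)
    case (Suc n)
    have "m + int (Suc n) = (m + int n) + 1" by simp
    then show ?case using Suc \<sigma>[of "(\<sigma> ^^ n) x" "m + int n"] by (simp add: ac_simps)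
  qed simp
  have bij\<sigma>: "bij (\<sigma> ^^ n)" for n using S(2) by (rule bij_betw_funpow)
  have gL: "g \<in> Lam" using g Orth_Lam by blast
  define G where "G n = S ^^ n \<circ> g \<circ> inv (S ^^ n)" for n
  have GO: "G n \<in> Orth (C (int n))" for n
    unfolding Orth_def
  proof (intro CollectI conjI allI impI)
    show "G n \<in> Lam" unfolding G_def using SL gL Lam_comp Lam_inv by blast
    fix x assume x: "x \<notin> C (int n)"
    obtain y where y: "x = (\<sigma> ^^ n) y" using bij\<sigma> by (metis bij_pointE)
    then have "y \<notin> C 0" using \<sigma>n[of n y 0] x by simp
    moreover have "inv (S ^^ n) (e x) = e y" using Se[of n y] y Lam_inv_f[OF SL] by metis
    ultimately show "G n (e x) = e x" using g Se y by (simp add: G_def Orth_def)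
  qed
  \<comment> \<open>Only copies of nonnegative index carry \<open>D\<close>. Its conjugate by the
    shift lives on the copies of positive index, so the quotient is \<open>g\<close> on the copy
    \<open>0\<close>.\<close>
  obtain D where D: "D \<in> Orth (\<Union>n. C (int n))" "\<And>n x. x \<in> C (int n) \<Longrightarrow> D (e x) = G n (e x)"
    using direct_sum_exists[of "\<lambda>n. C (int n)" G] C GO by auto
  have DL: "D \<in> Lam" using D Orth_Lam by blast
  have "D \<circ> S = g \<circ> S \<circ> D"
  proof (rule Lam_eqI)
    show "D \<circ> S \<in> Lam" "g \<circ> S \<circ> D \<in> Lam" using DL gL S Lam_comp by blast+
    fix x
    show "(D \<circ> S) (e x) = (g \<circ> S \<circ> D) (e x)"
    proof (cases "\<exists>n. x \<in> C (int n)")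
      case True
      then obtain n where n: "x \<in> C (int n)" by blast
      then have x': "\<sigma> x \<in> C (int (Suc n))" using \<sigma>[of x "int n"] by (simp add: add.commute)
      have inv: "inv (S ^^ Suc n) = inv (S ^^ n) \<circ> inv S"
        using Lam_inv_comp[OF S(1) SL] by simp
      have "D (S (e x)) = G (Suc n) (S (e x))" using D(2)[OF x'] by (simp add: S)
      also have "\<dots> = S (G n (e x))"
        unfolding G_def inv by (simp add: Lam_inv_f[OF S(1)])
      finally have 1: "D (S (e x)) = S (D (e x))" using D(2)[OF n] by simp
      have "D (S (e x)) \<in> coord (C (int (Suc n)))"
        using D(2)[OF x'] Orth_coord[OF C(1) GO coord_e[OF x']] by (simp add: S)
      moreover have "C (int (Suc n)) \<subseteq> - C 0" using C(2)[of "int (Suc n)" 0] by auto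
      ultimately have "g (D (S (e x))) = D (S (e x))"
        using Orth_fix[OF g] coord_mono by blast
      then show ?thesis using 1 by simp
    next
      case False
      then have De: "D (e x) = e x" using D(1) by (auto simp: Orth_def)
      \<comment> \<open>Either \<open>\<sigma> x\<close> has just entered the copy \<open>0\<close>
        from the copy \<open>-1\<close>, or it lies outside all copies that carry \<open>D\<close>
        and both maps are trivial.\<close>
      have "D (e (\<sigma> x)) = g (e (\<sigma> x))"
      proof (cases "\<sigma> x \<in> C 0")
        case True
        then show ?thesis using D(2)[of "\<sigma> x" 0] by (simp add: G_def)
      next
        case F: False
        have "\<sigma> x \<notin> C (int n)" for n
        proof (cases n)
          case (Suc k)
          then show ?thesis using False \<sigma>[of x "int k"] by (auto simp: add.commute)
        qed (use F in simp)
        then show ?thesis using D(1) g F by (auto simp: Orth_def)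
      qed
      then show ?thesis by (simp add: De S)
    qed
  qed
  then have "g = D \<circ> S \<circ> inv D \<circ> inv S"
    by (auto simp: fun_eq_iff Lam_f_inv[OF S(1)] Lam_f_inv[OF DL])
  moreover have "D \<in> Orth (\<Union>m. C m)" using D(1) Orth_mono[of "\<Union>n. C (int n)" "\<Union>m. C m"] by blast
  ultimately show ?thesis using that by blast
qed

definition proj :: "nat set \<Rightarrow> 'a \<Rightarrow> 'a" where
  "proj A = ortho_proj (\<lambda>i. if i \<in> A then e i else 0)"

lemma proj_inner_e: "proj A x \<bullet> e i = (if i \<in> A then x \<bullet> e i else 0)"
proof -
  let ?n = "\<lambda>i. if i \<in> A then e i else 0"
  have o: "ortho_family ?n" by (auto simp: ortho_family_def e_inner)
  have "(\<lambda>k. (x \<bullet> ?n k) * (e i \<bullet> ?n k)) sums (proj A x \<bullet> e i)"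
    unfolding proj_def by (rule ortho_proj_inner_sums[OF o])
  moreover have "(\<lambda>k. (x \<bullet> ?n k) * (e i \<bullet> ?n k)) sums (\<Sum>k\<in>{i}. (x \<bullet> ?n k) * (e i \<bullet> ?n k))"
    by (rule sums_finite) (auto simp: e_inner)
  ultimately show ?thesis by (auto simp: e_inner dest: sums_unique2)
qed

lemma proj_coord: "proj A x \<in> coord A"
  by (simp add: coord_def proj_inner_e)

lemma proj_compl: "x - proj A x \<in> coord (- A)"
  by (simp add: coord_def proj_inner_e inner_diff_left)

text \<open>Vectors \<open>x k\<close> in the span of \<open>E'\<close> are chosen so sparsely that simultaneous reflections fixing
  the complements of \<open>C\<close> and \<open>E' \<union> D'\<close> carry all \<open>g (x k)\<close> back to \<open>x k\<close>, first rotating the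
  components outside \<open>E'\<close> into \<open>D'\<close>.\<close>

lemma exchange:
  assumes inf: "infinite E'" "infinite D'"
    and sets: "D' \<subseteq> C" "C \<inter> E' = {}" "0 \<notin> C" "0 \<notin> E'"
    and g: "g \<in> Orth (C \<union> E')"
  obtains a b c d where "a \<in> Orth C" "b \<in> Orth (E' \<union> D')" "c \<in> Orth C" "d \<in> Orth (E' \<union> D')"
    "g = a \<circ> b \<circ> c \<circ> d"
proof -
  have O0: "0 \<notin> C \<union> E'" "0 \<notin> E' \<union> D'" using sets by auto
  have ED: "E' \<inter> D' = {}" "E' \<inter> C = {}" using sets by auto
  have gadj: "g x \<bullet> y = x \<bullet> inv g y" for x y using Orth_adj[OF O0(1) g] .
  \<comment> \<open>A pair is a vector \<open>x k\<close> with an auxiliary unit vector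
    \<open>d k\<close>. Conditions with \<open>inv g\<close> are really about
    \<open>g (x k)\<close>, moved to the other side so that each choice has to satisfy only finitely
    many linear conditions. They make the vectors \<open>x\<close>, the two components of
    \<open>g (x k)\<close> and the vectors \<open>d\<close> orthogonal for different
    indices.\<close>
  define P where "P f k r \<longleftrightarrow> fst r \<in> coord E' \<and> norm (fst r) = 1 \<and> snd r \<in> coord D' \<and> norm (snd r) = 1
     \<and> snd r \<bullet> g (fst r) = 0
     \<and> (\<forall>j<k. fst r \<bullet> fst (f j) = 0 \<and> fst r \<bullet> inv g (snd (f j)) = 0
          \<and> fst r \<bullet> inv g (proj E' (g (fst (f j)))) = 0 \<and> fst r \<bullet> proj E' (g (fst (f j))) = 0
          \<and> fst r \<bullet> inv g (fst (f j)) = 0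
          \<and> snd r \<bullet> snd (f j) = 0 \<and> snd r \<bullet> g (fst (f j)) = 0)"
    for f :: "nat \<Rightarrow> 'a \<times> 'a" and k :: nat and r :: "'a \<times> 'a"
  have "\<exists>f. \<forall>k. P f k (f k)"
  proof (rule dependent_wellorder_choice)
    show "P f k r = P h k r" if "\<And>j. j < k \<Longrightarrow> f j = h j" for r f h k
      using that by (simp add: P_def)
    fix k :: nat and f :: "nat \<Rightarrow> 'a \<times> 'a"
    define Y where "Y = (\<lambda>j. fst (f j)) ` {..<k} \<union> (\<lambda>j. inv g (snd (f j))) ` {..<k}
       \<union> (\<lambda>j. inv g (proj E' (g (fst (f j))))) ` {..<k} \<union> (\<lambda>j. proj E' (g (fst (f j)))) ` {..<k}
       \<union> (\<lambda>j. inv g (fst (f j))) ` {..<k}"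
    have "finite Y" by (simp add: Y_def)
    then obtain x where x: "x \<in> coord E'" "norm x = 1" "\<And>y. y \<in> Y \<Longrightarrow> x \<bullet> y = 0"
      using orth_vector_exists[OF inf(1)] by metis
    define Z where "Z = (\<lambda>j. snd (f j)) ` {..<k} \<union> insert (g x) ((\<lambda>j. g (fst (f j))) ` {..<k})"
    have "finite Z" by (simp add: Z_def)
    then obtain d where d: "d \<in> coord D'" "norm d = 1" "\<And>y. y \<in> Z \<Longrightarrow> d \<bullet> y = 0"
      using orth_vector_exists[OF inf(2)] by metis
    have "P f k (x, d)" using x d by (simp add: P_def Y_def Z_def)
    then show "\<exists>r. P f k r" by blast
  qed
  then obtain f where f: "\<And>k. P f k (f k)" by blast
  define x d y a b where "x k = fst (f k)" and "d k = snd (f k)" and "y k = g (x k)"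
    and "a k = proj E' (y k)" and "b k = y k - a k" for k
  have xE: "x k \<in> coord E'" and xn: "norm (x k) = 1" and dD: "d k \<in> coord D'" and dn: "norm (d k) = 1"
    and dy: "d k \<bullet> y k = 0" for k
    using f[of k] by (auto simp: P_def x_def d_def y_def)
  have lt: "x k \<bullet> x j = 0" "y k \<bullet> d j = 0" "y k \<bullet> a j = 0" "x k \<bullet> a j = 0" "y k \<bullet> x j = 0"
    "d k \<bullet> d j = 0" "d k \<bullet> y j = 0" if "j < k" for j k
    using f[of k] that by (auto simp: P_def x_def d_def y_def a_def gadj)
  have aE: "a k \<in> coord E'" for k by (simp add: a_def proj_coord)
  have yCE: "y k \<in> coord (C \<union> E')" for k
    using Orth_coord[OF O0(1) g] xE coord_mono[of E' "C \<union> E'"] by (auto simp: y_def)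
  have bC: "b k \<in> coord C" for k
    using yCE[of k] proj_compl[of "y k" E'] aE[of k]
    by (auto simp: b_def a_def coord_def proj_inner_e inner_diff_left)
  have dC: "d k \<in> coord C" for k using dD coord_mono[OF sets(1)] by blast
  have E_C: "u \<bullet> v = 0" "v \<bullet> u = 0" if "u \<in> coord E'" "v \<in> coord C" for u v
    using coord_orth[OF that ED(2)] by (auto simp: inner_commute)
  have xx: "x j \<bullet> x k = 0" if "j \<noteq> k" for j k
    using that lt(1)[of j k] lt(1)[of k j] by (cases j k rule: linorder_cases) (auto simp: inner_commute)
  have dd: "d j \<bullet> d k = 0" if "j \<noteq> k" for j k
    using that lt(6)[of j k] lt(6)[of k j] by (cases j k rule: linorder_cases) (auto simp: inner_commute)
  have yd: "y j \<bullet> d k = 0" for j k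
    using lt(2)[of k j] lt(7)[of j k] dy[of k] by (cases j k rule: linorder_cases) (auto simp: inner_commute)
  have bd: "b j \<bullet> d k = 0" for j k
    using yd[of j k] E_C(1)[OF aE dC, of j k] by (simp add: b_def inner_diff_left)
  have ya: "y j \<bullet> a k = a j \<bullet> a k" for j k
    using E_C(2)[OF aE[of k] bC[of j]] by (simp add: b_def inner_diff_left)
  have aa: "a j \<bullet> a k = 0" if "j \<noteq> k" for j k
    using that lt(3)[of j k] lt(3)[of k j] ya[of j k] ya[of k j]
    by (cases j k rule: linorder_cases) (auto simp: inner_commute)
  have yab: "y k = a k + b k" for k by (simp add: b_def)
  have yy: "y j \<bullet> y k = x j \<bullet> x k" for j k by (simp add: y_def Orth_inner[OF O0(1) g])
  have yyab: "y j \<bullet> y k = a j \<bullet> a k + b j \<bullet> b k" for j k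
    using E_C[OF aE bC] by (simp add: yab inner_add_left inner_add_right)
  have bb: "b j \<bullet> b k = 0" if "j \<noteq> k" for j k
    using yyab[of j k] yy[of j k] xx[OF that] aa[OF that] by simp
  have yx: "y j \<bullet> x k = a j \<bullet> x k" for j k
    using E_C(2)[OF xE[of k] bC[of j]] by (simp add: yab inner_add_left)
  have xa: "x j \<bullet> a k = 0" if "j \<noteq> k" for j k
    using that lt(4)[of k j] lt(5)[of j k] yx[of k j]
    by (cases j k rule: linorder_cases) (auto simp: inner_commute)
  \<comment> \<open>This is \<open>g (x k)\<close> with its component in \<open>C\<close> turned to
    the direction \<open>d k\<close> at equal length; it lies in
    \<open>coord (E' \<union> D')\<close>, where it can be moved to \<open>x k\<close>.\<close>
  define z where "z k = a k + norm (b k) *\<^sub>R d k" for k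
  obtain u1 where u1: "u1 \<in> Orth C" "\<And>k. u1 (b k) = norm (b k) *\<^sub>R d k"
    "\<And>v. (\<And>k. v \<bullet> b k = v \<bullet> (norm (b k) *\<^sub>R d k)) \<Longrightarrow> u1 v = v"
    using simultaneous_reflection_Orth[of C b "\<lambda>k. norm (b k) *\<^sub>R d k", OF sets(3) bC coord_scale[OF dC]]
      bb bd dd dn by (auto simp: inner_commute)
  have u1L: "linear u1" using u1(1) Orth_Lam Lam_linear by blast
  have u1y: "u1 (y k) = z k" for k
    using u1(3)[of "a k"] E_C(1)[OF aE bC] E_C(1)[OF aE dC]
    by (simp add: yab linear_add[OF u1L] u1(2) z_def)
  have zED: "z k \<in> coord (E' \<union> D')" for k
    using aE[of k] dD[of k] coord_mono[of E' "E' \<union> D'"] coord_mono[of D' "E' \<union> D'"]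
    by (auto simp: z_def intro!: coord_add coord_scale)
  have xED: "x k \<in> coord (E' \<union> D')" for k using xE coord_mono[of E' "E' \<union> D'"] by blast
  have dED: "d k \<in> coord (E' \<union> D')" for k using dD coord_mono[of D' "E' \<union> D'"] by blast
  have zz: "z j \<bullet> z k = a j \<bullet> a k + norm (b j) * norm (b k) * (d j \<bullet> d k)" for j k
    using E_C[OF aE dC] by (simp add: z_def inner_add_left inner_add_right)
  have zn: "norm (z k) = norm (x k)" for k
  proof -
    have "z k \<bullet> z k = x k \<bullet> x k"
      using yyab[of k k] yy[of k k] dn[of k] zz[of k k] by (simp add: dot_square_norm power2_eq_square)
    then show ?thesis by (simp add: norm_eq_sqrt_inner)
  qed
  have zx: "z j \<bullet> x k = 0" if "j \<noteq> k" for j k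
    using xa[of k j] that E_C(2)[OF xE[of k] dC[of j]]
    by (simp add: z_def inner_add_right inner_commute[of _ "x k"])
  obtain u2 where u2: "u2 \<in> Orth (E' \<union> D')" "\<And>k. u2 (z k) = x k"
  proof (rule simultaneous_reflection_Orth[of "E' \<union> D'" z x, OF O0(2) zED xED zn])
    show "z j \<bullet> z k = 0" if "j \<noteq> k" for j k using zz[of j k] aa[OF that] dd[OF that] by simp
  qed (use zx xx in blast)+
  obtain \<epsilon> :: "nat \<Rightarrow> nat" where \<epsilon>: "bij_betw \<epsilon> UNIV E'"
    using bij_enumerate[OF inf(1)] by blast
  have \<epsilon>E: "\<epsilon> k \<in> E'" for k using \<epsilon> by (auto simp: bij_betw_def)
  have \<epsilon>i: "\<epsilon> j = \<epsilon> k \<longleftrightarrow> j = k" for j k using \<epsilon> by (auto simp: bij_betw_def inj_on_def)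
  have eE: "e (\<epsilon> k) \<in> coord E'" for k by (rule coord_e[OF \<epsilon>E])
  have eED: "e (\<epsilon> k) \<in> coord (E' \<union> D')" for k by (rule coord_e) (simp add: \<epsilon>E)
  \<comment> \<open>\<open>q \<circ> p\<close> is to carry \<open>e (\<epsilon> k)\<close> to
    \<open>x k\<close>. A single simultaneous reflection is impossible, since both families live in
    \<open>coord E'\<close> and need not be orthogonal across indices; the detour through
    \<open>d k\<close> avoids this.\<close>
  obtain p where p: "p \<in> Orth (E' \<union> D')" "\<And>k. p (e (\<epsilon> k)) = d k"
  proof (rule simultaneous_reflection_Orth[of "E' \<union> D'" "\<lambda>k. e (\<epsilon> k)" d, OF O0(2) eED dED])
    show "norm (e (\<epsilon> k)) = norm (d k)" for k by (simp add: dn)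
    show "e (\<epsilon> j) \<bullet> e (\<epsilon> k) = 0" if "j \<noteq> k" for j k using that by (simp add: e_inner \<epsilon>i)
  qed (use dd E_C(1)[OF eE dC] in blast)+
  obtain q where q: "q \<in> Orth (E' \<union> D')" "\<And>k. q (d k) = x k"
  proof (rule simultaneous_reflection_Orth[of "E' \<union> D'" d x, OF O0(2) dED xED])
    show "norm (d k) = norm (x k)" for k by (simp add: dn xn)
  qed (use dd xx E_C(2)[OF xE dC] in blast)+
  have L: "u1 \<in> Lam" "u2 \<in> Lam" "p \<in> Lam" "q \<in> Lam" "g \<in> Lam"
    using u1 u2 p q g Orth_Lam by auto
  \<comment> \<open>Along \<open>c\<close> the vector \<open>e (\<epsilon> k)\<close> becomes
    \<open>x k\<close>, \<open>g (x k)\<close>, \<open>z k\<close>, \<open>x k\<close> and finally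
    \<open>e (\<epsilon> k)\<close> again, so what is left of \<open>g\<close> acts only on
    \<open>C\<close>.\<close>
  define c where "c = inv p \<circ> inv q \<circ> u2 \<circ> u1 \<circ> g \<circ> q \<circ> p"
  have "c \<in> Orth C"
    unfolding Orth_def
  proof (intro CollectI conjI allI impI)
    show "c \<in> Lam" unfolding c_def using L Lam_inv Lam_comp by simp
    fix i assume i: "i \<notin> C"
    show "c (e i) = e i"
    proof (cases "i \<in> E'")
      case True
      then obtain k where k: "i = \<epsilon> k" using \<epsilon> by (auto simp: bij_betw_def)
      have "c (e i) = inv p (inv q (x k))"
        using u1y[of k] by (simp add: c_def k p(2) q(2) y_def u2(2))
      also have "\<dots> = e i" using Lam_inv_f L p(2) q(2) k by metis
      finally show ?thesis .
    next
      case False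
      then have i: "i \<notin> E' \<union> D'" "i \<notin> C \<union> E'" "i \<notin> C" using i sets by auto
      have "p (e i) = e i" "q (e i) = e i" "g (e i) = e i" "u1 (e i) = e i" "u2 (e i) = e i"
        "inv q (e i) = e i" "inv p (e i) = e i"
        using p q g u1 u2 i Orth_inv Orth_fix_e by blast+
      then show ?thesis by (simp add: c_def)
    qed
  qed
  moreover have "g = inv u1 \<circ> (inv u2 \<circ> q \<circ> p) \<circ> c \<circ> (inv p \<circ> inv q)"
    by (rule ext) (simp add: c_def Lam_f_inv[OF L(3)] Lam_f_inv[OF L(4)] Lam_inv_f[OF L(1)] Lam_inv_f[OF L(2)])
  moreover have "inv u1 \<in> Orth C" "inv u2 \<circ> q \<circ> p \<in> Orth (E' \<union> D')" "inv p \<circ> inv q \<in> Orth (E' \<union> D')"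
    by (intro Orth_comp Orth_inv u1(1) u2(1) p(1) q(1))+
  ultimately show ?thesis using that[of "inv u1" "inv u2 \<circ> q \<circ> p" c "inv p \<circ> inv q"] by simp
qed

end

text \<open>Block \<open>j\<close> is indexed by triples: the row (a position in a binary sequence),
  the place of a copy along the integers, and the index inside that copy. \<open>Suc\<close> keeps
  \<open>0\<close> free.\<close>

definition beta :: "nat \<Rightarrow> nat \<times> int \<times> nat \<Rightarrow> nat" where
  "beta j t = Suc (prod_encode (j, prod_encode (fst t, prod_encode (int_encode (fst (snd t)), snd (snd t)))))"

lemma beta_eq_iff: "beta j t = beta k s \<longleftrightarrow> j = k \<and> t = s"
  by (auto simp: beta_def prod_eq_iff dest: injD[OF inj_int_encode])

context syndetic begin

text \<open>Each binary sequence prescribes which rows of a full block are shifted by one place; the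
  pigeonhole principle leaves an element \<open>S\<close> of W^2 that shifts some row
  \<open>i0\<close> exactly once. The swindle writes \<open>g\<close> as
  \<open>D \<circ> S \<circ> inv D \<circ> inv S\<close>, and replacing \<open>D\<close> by an
  element of W^2 that agrees with it on the block gives four factors from W^2.\<close>

lemma block_in_pw:
  obtains C where "infinite C" "infinite (- C)" "0 \<notin> C" "Orth C \<subseteq> pw W 8"
proof -
  have b0: "0 \<notin> range (beta j)" for j by (auto simp: beta_def)
  have bdisj: "range (beta j) \<inter> range (beta k) = {}" if "j \<noteq> k" for j k
    using that by (auto simp: beta_eq_iff)
  obtain j where j: "\<And>g. g \<in> Orth (range (beta j)) \<Longrightarrow> \<exists>w\<in>pw W 2. \<forall>i\<in>range (beta j). w (e i) = g (e i)"
    using full_block[of "\<lambda>j. range (beta j)"] b0 bdisj by blast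
  define b where "b = beta j"
  have binj: "inj b" by (auto simp: b_def inj_def beta_eq_iff)
  have b_iff: "b t = b s \<longleftrightarrow> t = s" for t s by (simp add: b_def beta_eq_iff)
  have b0: "0 \<notin> range b" by (auto simp: b_def beta_def)
  define sh :: "(nat \<Rightarrow> int) \<Rightarrow> nat \<times> int \<times> nat \<Rightarrow> nat \<times> int \<times> nat" where
    "sh \<delta> t = (fst t, fst (snd t) + \<delta> (fst t), snd (snd t))" for \<delta> t
  define pm where "pm \<delta> x = (if x \<in> range b then b (sh \<delta> (inv b x)) else x)" for \<delta> x
  have pmb: "pm \<delta> (b t) = b (sh \<delta> t)" for \<delta> t using binj by (simp add: pm_def)
  have pmn: "pm \<delta> x = x" if "x \<notin> range b" for \<delta> x using that by (simp add: pm_def)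
  have pm_add: "pm \<delta> (pm \<delta>' x) = pm (\<lambda>i. \<delta> i + \<delta>' i) x" for \<delta> \<delta>' x
    by (cases "x \<in> range b") (auto simp: pmb pmn sh_def add_ac)
  have pm0: "pm (\<lambda>i. 0) x = x" for x
    by (cases "x \<in> range b") (auto simp: pmb pmn sh_def)
  have bijpm: "bij (pm \<delta>)" for \<delta>
    by (rule o_bij[of "pm (\<lambda>i. - \<delta> i)"]) (auto simp: fun_eq_iff pm_add pm0)
  have "\<exists>g. g \<in> Orth (range b) \<and> (\<forall>i. g (e i) = e (pm \<delta> i))" for \<delta>
    using perm_Orth[OF bijpm[of \<delta>] _ b0] pmn by metis
  then obtain T where T: "\<And>\<delta>. T \<delta> \<in> Orth (range b)" "\<And>\<delta> i. T \<delta> (e i) = e (pm \<delta> i)" by metis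
  have TL: "T \<delta> \<in> Lam" for \<delta> using T Orth_Lam by blast
  have Tinv: "inv (T \<delta>) (e i) = e (pm (\<lambda>i. - \<delta> i) i)" for \<delta> i
    using Lam_inv_f[OF TL, of \<delta> "e (pm (\<lambda>i. - \<delta> i) i)"] by (simp add: T pm_add pm0)
  obtain a a' :: "nat \<Rightarrow> bool" where a: "a \<noteq> a'"
    "inv (T (\<lambda>i. of_bool (a i))) \<circ> T (\<lambda>i. of_bool (a' i)) \<in> pw W 2"
    using pigeonhole[OF uncountable_bool_seq, of "\<lambda>a. T (\<lambda>i. of_bool (a i))"] TL by blast
  obtain i0 where i0: "a i0 \<noteq> a' i0" using a(1) by auto
  define S' where "S' = inv (T (\<lambda>i. of_bool (a i))) \<circ> T (\<lambda>i. of_bool (a' i))"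
  define \<delta>' :: "nat \<Rightarrow> int" where "\<delta>' i = of_bool (a' i) - of_bool (a i)" for i
  have S'O: "S' \<in> Orth (range b)" unfolding S'_def by (intro Orth_comp Orth_inv T)
  have S'e: "S' (e i) = e (pm \<delta>' i)" for i
    by (simp add: S'_def T Tinv pm_add) (simp add: \<delta>'_def[abs_def])
  \<comment> \<open>The sequences differ at \<open>i0\<close>, so this row moves by \<open>1\<close>
    or \<open>-1\<close>; in the second case the inverse is taken.\<close>
  obtain S \<delta> where S: "S \<in> Orth (range b)" "S \<in> pw W 2" "\<And>i. S (e i) = e (pm \<delta> i)" "\<delta> i0 = 1"
  proof (cases "a' i0")
    case True
    then show ?thesis using that[of S' \<delta>'] S'O S'e a(2) i0 by (simp add: S'_def \<delta>'_def)
  next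
    case False
    have "inv S' (e i) = e (pm (\<lambda>i. - \<delta>' i) i)" for i
      using Lam_inv_f[OF Orth_Lam[OF S'O], of "e (pm (\<lambda>i. - \<delta>' i) i)"] by (simp add: S'e pm_add pm0)
    then show ?thesis
      using that[of "inv S'" "\<lambda>i. - \<delta>' i"] Orth_inv[OF S'O] pw_inv[OF a(2)] False i0
      by (simp add: S'_def \<delta>'_def)
  qed
  define C where "C m = range (\<lambda>l. b (i0, m, l))" for m
  have Cb: "C m \<subseteq> range b" for m by (auto simp: C_def)
  have shC: "pm \<delta> x \<in> C (m + 1) \<longleftrightarrow> x \<in> C m" for m x
  proof (cases "x \<in> range b")
    case True
    then obtain i n l where x: "x = b (i, n, l)" by auto
    show ?thesis using S(4) by (auto simp: x pmb sh_def C_def b_iff image_iff)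
  next
    case False
    then show ?thesis using Cb[of m] Cb[of "m + 1"] by (auto simp: pmn)
  qed
  have "Orth (C 0) \<subseteq> pw W 8"
  proof
    fix g assume g: "g \<in> Orth (C 0)"
    have C0: "0 \<notin> C m" for m using b0 Cb by blast
    have Cd: "C m \<inter> C n = {}" if "m \<noteq> n" for m n using that by (auto simp: C_def b_iff)
    obtain D where D: "D \<in> Orth (\<Union>m. C m)" "g = D \<circ> S \<circ> inv D \<circ> inv S"
      using shift_commutator[OF Orth_Lam[OF S(1)] bijpm S(3) C0 Cd shC g] by blast
    have DO: "D \<in> Orth (range b)" using D(1) Orth_mono[of "\<Union>m. C m" "range b"] Cb by blast
    obtain w where w: "w \<in> pw W 2" "\<forall>i\<in>range b. w (e i) = D (e i)"
      using j[OF DO[unfolded b_def]] unfolding b_def by blast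
    have "w \<circ> S \<circ> inv w = D \<circ> S \<circ> inv D"
      by (rule conj_eq_of_agree[OF b0 S(1) DO pw_Lam[OF w(1)]]) (use w in auto)
    then have "g = ((w \<circ> S) \<circ> inv w) \<circ> inv S" using D(2) by (simp add: comp_assoc)
    moreover have "w \<circ> S \<in> pw W 4" using pw_comp[OF w(1) S(2)] by simp
    then have "w \<circ> S \<circ> inv w \<in> pw W 6" using pw_comp[OF _ pw_inv[OF w(1)]] by simp
    then have "w \<circ> S \<circ> inv w \<circ> inv S \<in> pw W 8" using pw_comp[OF _ pw_inv[OF S(2)]] by simp
    ultimately show "g \<in> pw W 8" by simp
  qed
  moreover have "infinite (C 0)" unfolding C_def by (rule range_inj_infinite) (auto simp: inj_def b_iff)
  moreover have "infinite (C 1)" unfolding C_def by (rule range_inj_infinite) (auto simp: inj_def b_iff)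
  \<comment> \<open>The neighbouring copy \<open>C 1\<close> is left free.\<close>
  then have "infinite (- C 0)"
    by (rule infinite_super[rotated]) (auto simp: C_def b_iff)
  moreover have "0 \<notin> C 0" using b0 Cb by blast
  ultimately show ?thesis using that by blast
qed

end

text \<open>The codes of the finite initial segments of binary sequences form an almost disjoint family of sets
  of odd numbers.\<close>

definition branch_code :: "(nat \<Rightarrow> bool) \<Rightarrow> nat \<Rightarrow> nat" where
  "branch_code a n = Suc (2 * prod_encode (n, set_encode {i. i < n \<and> a i}))"

lemma branch_code_inj: "branch_code a m = branch_code b n \<Longrightarrow> m = n"
  by (simp add: branch_code_def)

lemma branch_code_almost_disjoint:
  assumes "a \<noteq> b"
  shows "finite (range (branch_code a) \<inter> range (branch_code b))"
proof -
  obtain k where k: "a k \<noteq> b k" using assms by auto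
  have "range (branch_code a) \<inter> range (branch_code b) \<subseteq> branch_code a ` {..k}"
  proof
    fix x assume "x \<in> range (branch_code a) \<inter> range (branch_code b)"
    then obtain m n where x: "x = branch_code b n" and eq: "branch_code a m = branch_code b n" by auto
    from eq have "m = n" by (rule branch_code_inj)
    then have "{i. i < n \<and> a i} = {i. i < n \<and> b i}"
      using eq set_encode_eq[of "{i. i < n \<and> a i}" "{i. i < n \<and> b i}"] by (simp add: branch_code_def)
    then have "n \<le> k" using k by (metis (mono_tags, lifting) linorder_not_less mem_Collect_eq)
    then show "x \<in> branch_code a ` {..k}" using \<open>m = n\<close> eq x by (metis atMost_iff imageI)
  qed
  then show ?thesis by (rule finite_subset) simp
qed

context syndetic begin

text \<open>The index set \<open>E\<close> of the basis vectors not yet reached is mapped by the permutation \<open>\<rho>\<close> to a set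
  meeting \<open>E\<close> only finitely often.\<close>

lemma cofinite_block_in_pw:
  obtains J where "finite J" "0 \<in> J" "Orth (- J) \<subseteq> pw W 40"
proof -
  obtain C where C: "infinite C" "infinite (- C)" "0 \<notin> C" "Orth C \<subseteq> pw W 8"
    by (rule block_in_pw)
  define E where "E = - insert 0 C"
  have Einf: "infinite E"
  proof
    assume "finite E"
    then have "finite (insert 0 E)" by simp
    moreover have "- C \<subseteq> insert 0 E" by (auto simp: E_def)
    ultimately show False using C(2) finite_subset by blast
  qed
  have CE: "C = - insert 0 E" using C(3) by (auto simp: E_def)
  have E0: "0 \<notin> E" by (simp add: E_def)
  let ?B = "\<lambda>a. range (branch_code a)"
  have Binf: "infinite (?B a)" for a
    by (rule range_inj_infinite) (auto simp: inj_def dest: branch_code_inj)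
  have B0: "0 \<notin> ?B a" for a by (auto simp: branch_code_def)
  have even_notB: "2 * n \<notin> ?B a" for n a
    by (auto simp: branch_code_def) presburger
  have evinf: "infinite (range (\<lambda>n. 2 * Suc n))"
    by (rule range_inj_infinite) (auto simp: inj_def)
  have Bcinf: "infinite (- insert 0 (?B a))" for a
  proof (rule infinite_super[OF _ evinf])
    show "range (\<lambda>n. 2 * Suc n) \<subseteq> - insert 0 (?B a)" using even_notB[of _ a] by fastforce
  qed
  \<comment> \<open>Each branch gives a permutation carrying \<open>E\<close> onto its set of codes,
    which is possible because both sets and their complements are infinite.\<close>
  have "\<exists>\<pi>. bij \<pi> \<and> \<pi> 0 = 0 \<and> \<pi> ` E = ?B a" for a
  proof -
    obtain f h where f: "bij_betw f E (?B a)" and h: "bij_betw h C (- insert 0 (?B a))"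
    proof -
      have "\<exists>f. bij_betw f X Y" if "infinite X" "infinite Y" for X Y :: "nat set"
        using bij_enumerate[OF that(1)] bij_enumerate[OF that(2)]
        by (meson bij_betw_inv_into bij_betw_trans)
      then show ?thesis using that Einf Binf C(1) Bcinf by meson
    qed
    define \<pi> where "\<pi> x = (if x \<in> E then f x else if x \<in> C then h x else 0)" for x
    have 1: "bij_betw \<pi> E (?B a)"
      using f by (rule bij_betw_cong[THEN iffD1, rotated]) (simp add: \<pi>_def)
    have 2: "bij_betw \<pi> C (- insert 0 (?B a))"
      using h by (rule bij_betw_cong[THEN iffD1, rotated]) (auto simp: \<pi>_def E_def)
    have 3: "bij_betw \<pi> {0} {0}" using C(3) E0 by (auto simp: \<pi>_def bij_betw_def)
    have "bij_betw \<pi> (E \<union> C) (?B a \<union> - insert 0 (?B a))"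
      by (rule bij_betw_combine[OF 1 2]) auto
    then have "bij_betw \<pi> ((E \<union> C) \<union> {0}) ((?B a \<union> - insert 0 (?B a)) \<union> {0})"
      by (rule bij_betw_combine[OF _ 3]) (use B0 in auto)
    moreover have "(E \<union> C) \<union> {0} = UNIV" "(?B a \<union> - insert 0 (?B a)) \<union> {0} = UNIV"
      by (auto simp: E_def)
    ultimately have "bij \<pi>" by simp
    moreover have "\<pi> 0 = 0" using C(3) E0 by (simp add: \<pi>_def)
    moreover have "\<pi> ` E = ?B a" using 1 by (simp add: bij_betw_def)
    ultimately show ?thesis by blast
  qed
  then obtain \<pi> where \<pi>: "\<And>a. bij (\<pi> a)" "\<And>a. \<pi> a 0 = 0" "\<And>a. \<pi> a ` E = ?B a" by metis
  have "\<exists>g. g \<in> Lam \<and> (\<forall>i. g (e i) = e (\<pi> a i))" for a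
    using perm_exists[OF \<pi>(1,2)] by metis
  then obtain P where P: "\<And>a. P a \<in> Lam" "\<And>a i. P a (e i) = e (\<pi> a i)" by metis
  obtain a b where ab: "a \<noteq> b" "inv (P a) \<circ> P b \<in> pw W 2"
    using pigeonhole[OF uncountable_bool_seq, of P] P(1) by blast
  define w where "w = inv (P a) \<circ> P b"
  define \<rho> where "\<rho> = inv (\<pi> a) \<circ> \<pi> b"
  have a\<rho>: "\<pi> a (\<rho> x) = \<pi> b x" for x
    by (simp add: \<rho>_def surj_f_inv_f[OF bij_is_surj[OF \<pi>(1)]])
  have \<rho>: "bij \<rho>" unfolding \<rho>_def using \<pi>(1) by (intro bij_comp bij_imp_bij_inv)
  have \<rho>0: "\<rho> 0 = 0" using a\<rho>[of 0] \<pi> by (metis bij_pointE)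
  have \<rho>i: "\<rho> x = \<rho> y \<longleftrightarrow> x = y" for x y using \<rho> by (auto simp: bij_def inj_eq)
  have w: "w \<in> pw W 2" using ab by (simp add: w_def)
  have wL: "w \<in> Lam" using w pw_Lam by blast
  have we: "w (e i) = e (\<rho> i)" for i
    using Lam_inv_f[OF P(1), of a "e (\<rho> i)"] by (simp add: w_def P a\<rho>)
  have \<pi>aE: "\<pi> a x \<in> ?B a \<longleftrightarrow> x \<in> E" for a x
    using \<pi>(3)[of a] \<pi>(1)[of a] by (metis bij_is_inj inj_image_mem_iff)
  have finE: "finite (E \<inter> \<rho> ` E)"
  proof -
    have "\<pi> a ` (E \<inter> \<rho> ` E) \<subseteq> ?B a \<inter> ?B b"
      using \<pi>aE[of a] \<pi>aE[of b] a\<rho> by auto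
    then have "finite (\<pi> a ` (E \<inter> \<rho> ` E))"
      using branch_code_almost_disjoint[OF ab(1)] finite_subset by blast
    then show ?thesis using \<pi>(1)[of a] by (meson bij_is_inj finite_imageD inj_on_subset subset_UNIV)
  qed
  define J where "J = insert 0 (E \<inter> \<rho> ` E)"
  define D' where "D' = - insert 0 (E \<union> \<rho> ` E)"
  define E' where "E' = E - \<rho> ` E"
  have E'inf: "infinite E'" unfolding E'_def using Einf finE by (metis Diff_Diff_Int finite_Diff2)
  have D'inf: "infinite D'"
  proof (rule infinite_super)
    show "infinite (range (\<lambda>n. inv (\<pi> a) (2 * Suc n)))"
      by (rule range_inj_infinite)
         (use \<pi>(1)[of a] in \<open>auto simp: inj_def dest!: injD[OF bij_is_inj[OF bij_imp_bij_inv]]\<close>)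
    show "range (\<lambda>n. inv (\<pi> a) (2 * Suc n)) \<subseteq> D'"
    proof safe
      fix n
      let ?x = "inv (\<pi> a) (2 * Suc n)"
      have x: "\<pi> a ?x = 2 * Suc n" using \<pi>(1)[of a] by (simp add: bij_is_surj surj_f_inv_f)
      have "?x \<noteq> 0"
      proof
        assume "?x = 0"
        then have "\<pi> a ?x = 0" using \<pi>(2) by simp
        then show False using x by simp
      qed
      moreover have "?x \<notin> E" using \<pi>aE[of a ?x] x even_notB[of "Suc n" a] by simp
      moreover have "?x \<notin> \<rho> ` E"
      proof
        assume "?x \<in> \<rho> ` E"
        then obtain y where "y \<in> E" "?x = \<rho> y" by blast
        then have "2 * Suc n \<in> ?B b" using \<pi>aE[of b y] a\<rho>[of y] x by simp
        then show False using even_notB by blast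
      qed
      ultimately show "?x \<in> D'" by (simp add: D'_def)
    qed
  qed
  have sets: "D' \<subseteq> C" "C \<inter> E' = {}" "0 \<notin> E'" "C \<union> E' = - J" "E' \<union> D' = - insert 0 (\<rho> ` E)"
    using E0 C(3) \<rho>0 \<rho>i by (auto simp: D'_def E'_def J_def CE)
  have img: "\<rho> i \<in> E' \<union> D' \<longleftrightarrow> i \<in> C" for i
    unfolding sets(5) CE using \<rho>i \<rho>0 by (metis Compl_iff image_iff insert_iff)
  \<comment> \<open>\<open>\<rho>\<close> maps \<open>C\<close> onto \<open>E' \<union> D'\<close>,
    so conjugation by \<open>w\<close> turns \<open>Orth C\<close> into the group of this set, at a
    cost of \<open>2 + 8 + 2\<close> factors.\<close>
  have B: "k \<in> pw W 12" if k: "k \<in> Orth (E' \<union> D')" for k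
  proof -
    define m where "m = inv w \<circ> k \<circ> w"
    have kL: "k \<in> Lam" using k Orth_Lam by blast
    have "m \<in> Orth C"
      unfolding Orth_def
    proof (intro CollectI conjI allI impI)
      show "m \<in> Lam" unfolding m_def using kL wL Lam_comp Lam_inv by simp
      fix i assume "i \<notin> C"
      then have "k (e (\<rho> i)) = e (\<rho> i)" using k img[of i] Orth_fix_e by blast
      then show "m (e i) = e i" using Lam_inv_f[OF wL, of "e i"] by (simp add: m_def we)
    qed
    then have m: "m \<in> pw W 8" using C(4) by blast
    have "k = w \<circ> m \<circ> inv w" by (simp add: fun_eq_iff m_def Lam_f_inv[OF wL])
    moreover have "w \<circ> m \<circ> inv w \<in> pw W 12"
      by (rule pw_comp[OF pw_comp[OF w m refl] pw_inv[OF w]]) simp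
    ultimately show ?thesis by simp
  qed
  have "Orth (- J) \<subseteq> pw W 40"
  proof
    fix g assume "g \<in> Orth (- J)"
    then have "g \<in> Orth (C \<union> E')" by (simp add: sets)
    then obtain p q r s where "p \<in> Orth C" "q \<in> Orth (E' \<union> D')" "r \<in> Orth C" "s \<in> Orth (E' \<union> D')"
      and g: "g = p \<circ> q \<circ> r \<circ> s"
      using exchange[OF E'inf D'inf sets(1,2) C(3) sets(3)] by metis
    then have "p \<in> pw W 8" "q \<in> pw W 12" "r \<in> pw W 8" "s \<in> pw W 12" using C(4) B by auto
    \<comment> \<open>The four factors of the exchange cost \<open>8 + 12 + 8 + 12\<close>.\<close>
    then show "g \<in> pw W 40" unfolding g
      by (intro pw_comp[where m = 28 and n = 12] pw_comp[where m = 20 and n = 8]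
          pw_comp[where m = 8 and n = 12]) auto
  qed
  moreover have "finite J" "0 \<in> J" using finE by (auto simp: J_def)
  ultimately show ?thesis using that by blast
qed

end

section \<open>Gram matrices, boosts and rotations\<close>

context hyp begin

text \<open>Witt extension by induction: after the earlier vectors are in place, the reflection in
  \<open>k (x l) - y l\<close> moves the new one correctly and fixes each earlier
  \<open>y i\<close>, because both vectors of the difference have the same inner product with
  it.\<close>

lemma gram_transitive:
  assumes "finite I" "0 \<notin> A" "\<And>i. i \<in> I \<Longrightarrow> x i \<in> coord A" "\<And>i. i \<in> I \<Longrightarrow> y i \<in> coord A"
    "\<And>i j. i \<in> I \<Longrightarrow> j \<in> I \<Longrightarrow> x i \<bullet> x j = y i \<bullet> y j"
  shows "\<exists>k\<in>Orth A. \<forall>i\<in>I. k (x i) = y i"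
  using assms
proof (induction I)
  case empty
  then show ?case using Orth_id by blast
next
  case (insert l I)
  then obtain k where k: "k \<in> Orth A" "\<forall>i\<in>I. k (x i) = y i" by auto
  define v where "v = k (x l) - y l"
  have vA: "v \<in> coord A" unfolding v_def using insert.prems k Orth_coord coord_diff by simp
  have kl: "k (x l) \<bullet> y i = y l \<bullet> y i" if "i \<in> I" for i
    using Orth_inner[OF insert.prems(1) k(1), of "x l" "x i"] k(2) that insert.prems(4)[of l i] by simp
  have ll: "k (x l) \<bullet> k (x l) = y l \<bullet> y l"
    using Orth_inner[OF insert.prems(1) k(1)] insert.prems(4)[of l l] by simp
  show ?case
  proof (cases "v = 0")
    case True
    then show ?thesis using k by (auto simp: v_def)
  next
    case False
    have "refl v \<circ> k \<in> Orth A" using refl_Orth[OF insert.prems(1) vA False] k Orth_comp by blast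
    moreover have "refl v (k (x i)) = y i" if i: "i \<in> I" for i
    proof -
      have "B (y i) v = - (v \<bullet> y i)" using coord_B[OF insert.prems(1) vA] B_sym by metis
      then have "B (y i) v = 0" using kl[OF i] by (simp add: v_def inner_diff_left)
      then show ?thesis using k(2) i by (simp add: refl_def)
    qed
    moreover have "refl v (k (x l)) = y l"
      unfolding v_def
    proof (rule refl_swap)
      show "B (k (x l)) (k (x l)) = B (y l) (y l)"
        using ll insert.prems k Orth_coord by (simp add: coord_B)
      show "B (k (x l) - y l) (k (x l) - y l) \<noteq> 0"
        using coord_B_neg[OF insert.prems(1) vA False] by (simp add: v_def)
    qed
    ultimately show ?thesis by (intro bexI[of _ "refl v \<circ> k"]) auto
  qed
qed

text \<open>Diagonal dominance makes \<open>1 - c c\<^sup>T\<close> the Gram matrix of explicit vectors: each unordered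
  pair of indices gets its own basis vector, carrying the corresponding off-diagonal entry.\<close>

lemma compression_exists:
  fixes c :: "nat \<Rightarrow> nat \<Rightarrow> real"
  assumes J: "finite J" "0 \<in> J" and \<iota>: "inj_on \<iota> J" "\<iota> ` J \<inter> J = {}"
    and c: "\<And>i j. i \<in> J \<Longrightarrow> j \<in> J \<Longrightarrow> \<bar>c i j\<bar> \<le> 1 / card J"
  obtains k where "k \<in> Orth (- J)" "\<And>i j. i \<in> J \<Longrightarrow> j \<in> J \<Longrightarrow> k (e (\<iota> i)) \<bullet> e (\<iota> j) = c i j"
proof -
  define N where "N = real (card J)"
  have N: "N > 0" using J by (auto simp: N_def card_gt_0_iff)
  have "finite (J \<union> \<iota> ` J)" using J by simp
  then have "infinite (- (J \<union> \<iota> ` J))" by (simp only: Compl_eq_Diff_UNIV) (rule Diff_infinite_finite, auto)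
  then obtain f :: "nat \<Rightarrow> nat" where f: "inj f" "range f \<subseteq> - (J \<union> \<iota> ` J)"
    using infinite_countable_subset by blast
  \<comment> \<open>A fresh index for every unordered pair, outside \<open>J\<close> and its image
    under \<open>\<iota>\<close>; the minimum and maximum make it symmetric.\<close>
  define \<theta> where "\<theta> i j = f (prod_encode (min i j, max i j))" for i j
  have \<theta>eq: "\<theta> i j = \<theta> k l \<longleftrightarrow> (i = k \<and> j = l) \<or> (i = l \<and> j = k)" for i j k l
    using f(1) by (auto simp: \<theta>_def inj_eq min_def max_def split: if_splits)
  have \<theta>n: "\<theta> i j \<notin> J" "\<theta> i j \<notin> \<iota> ` J" for i j using f(2) by (auto simp: \<theta>_def)
  \<comment> \<open>The Gram matrix that remains for the parts \<open>u i\<close> once the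
    prescribed coefficients \<open>c\<close> are used up.\<close>
  define h where "h i j = (if i = j then 1 else 0) - (\<Sum>l\<in>J. c i l * c j l)" for i j
  have hsym: "h i j = h j i" for i j by (simp add: h_def mult.commute)
  have cc: "\<bar>\<Sum>l\<in>J. c i l * c j l\<bar> \<le> 1 / N" if "i \<in> J" "j \<in> J" for i j
  proof -
    have "\<bar>\<Sum>l\<in>J. c i l * c j l\<bar> \<le> (\<Sum>l\<in>J. \<bar>c i l * c j l\<bar>)" by (rule sum_abs)
    also have "\<dots> \<le> (\<Sum>l\<in>J. (1 / N) * (1 / N))"
      unfolding abs_mult using c that N by (intro sum_mono mult_mono) (auto simp: N_def)
    also have "\<dots> = 1 / N" using N by (simp add: N_def)
    finally show ?thesis .
  qed
  \<comment> \<open>Entries of \<open>c\<close> of size at most \<open>1 / N\<close> make the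
    entries of the product at most \<open>1 / N\<close>, so the off-diagonal row sum
    \<open>(N - 1) / N\<close> just meets the diagonal bound \<open>1 - 1 / N\<close>.\<close>
  have dom: "(\<Sum>j\<in>J - {i}. \<bar>h i j\<bar>) \<le> h i i" if i: "i \<in> J" for i
  proof -
    have "(\<Sum>j\<in>J - {i}. \<bar>h i j\<bar>) \<le> (\<Sum>j\<in>J - {i}. 1 / N)"
      by (rule sum_mono) (use cc i in \<open>auto simp: h_def\<close>)
    also have "\<dots> = (N - 1) / N"
      using J i N by (simp add: N_def of_nat_diff Suc_le_eq card_gt_0_iff)
    also have "\<dots> = 1 - 1 / N" using N by (simp add: field_simps)
    also have "\<dots> \<le> h i i" using cc[OF i i] by (simp add: h_def)
    finally show ?thesis .
  qed
  \<comment> \<open>\<open>u i\<close> and \<open>u k\<close> share only the basis vector of the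
    pair, so their product is \<open>a i k * a k i\<close>; the sign goes to the entry above the
    diagonal, and the diagonal entry takes up the slack from dominance.\<close>
  define a where "a i j = (if i = j then sqrt (h i i - (\<Sum>l\<in>J - {i}. \<bar>h i l\<bar>))
     else if i < j then sgn (h i j) * sqrt \<bar>h i j\<bar> else sqrt \<bar>h i j\<bar>)" for i j
  have aa: "a i j * a j i = h i j" if "i \<noteq> j" for i j
  proof -
    have "sgn (h i j) * \<bar>h i j\<bar> = h i j" by (rule sgn_mult_abs)
    then show ?thesis using that hsym[of i j]
      by (cases i j rule: linorder_cases) (auto simp: a_def mult.assoc mult.left_commute)
  qed
  have a2: "(\<Sum>j\<in>J. (a i j)\<^sup>2) = h i i" if i: "i \<in> J" for i
  proof -
    have "(\<Sum>j\<in>J. (a i j)\<^sup>2) = (a i i)\<^sup>2 + (\<Sum>j\<in>J - {i}. (a i j)\<^sup>2)"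
      by (rule sum.remove[OF J(1) i])
    also have "(\<Sum>j\<in>J - {i}. (a i j)\<^sup>2) = (\<Sum>j\<in>J - {i}. \<bar>h i j\<bar>)"
      by (rule sum.cong) (auto simp: a_def power_mult_distrib sgn_if)
    also have "(a i i)\<^sup>2 = h i i - (\<Sum>l\<in>J - {i}. \<bar>h i l\<bar>)" using dom[OF i] by (simp add: a_def)
    finally show ?thesis by simp
  qed
  define u where "u i = (\<Sum>j\<in>J. a i j *\<^sub>R e (\<theta> i j))" for i
  have uu: "u i \<bullet> u k = h i k" if i: "i \<in> J" and k: "k \<in> J" for i k
  proof -
    have "u i \<bullet> u k = (\<Sum>l\<in>J. \<Sum>j\<in>J. a k l * (a i j * (if \<theta> i j = \<theta> k l then 1 else 0)))"
      by (simp add: u_def inner_sum_left inner_sum_right e_inner sum_distrib_left)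
    also have "\<dots> = h i k"
    proof (cases "i = k")
      case True
      then have "(\<Sum>l\<in>J. \<Sum>j\<in>J. a k l * (a i j * (if \<theta> i j = \<theta> k l then 1 else 0)))
          = (\<Sum>l\<in>J. \<Sum>j\<in>J. if j = l then a i l * a i j else 0)"
        by (intro sum.cong refl) (auto simp: \<theta>eq)
      then show ?thesis using J True a2[OF i] by (simp add: power2_eq_square)
    next
      case False
      then have "(\<Sum>l\<in>J. \<Sum>j\<in>J. a k l * (a i j * (if \<theta> i j = \<theta> k l then 1 else 0)))
          = (\<Sum>l\<in>J. \<Sum>j\<in>J. if j = k then (if l = i then a k l * a i j else 0) else 0)"
        by (intro sum.cong refl) (auto simp: \<theta>eq)
      also have "\<dots> = a i k * a k i" using J i k by (simp add: mult.commute)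
      finally show ?thesis using aa False by simp
    qed
    finally show ?thesis .
  qed
  have u\<iota>: "u i \<bullet> e (\<iota> j) = 0" "e (\<iota> j) \<bullet> u i = 0" if "j \<in> J" for i j
  proof -
    have "\<theta> i l \<noteq> \<iota> j" "\<iota> j \<noteq> \<theta> i l" for l using \<theta>n(2)[of i l] that by (metis imageI)+
    then show "u i \<bullet> e (\<iota> j) = 0" "e (\<iota> j) \<bullet> u i = 0"
      by (simp_all add: u_def inner_sum_left inner_sum_right e_inner)
  qed
  define y where "y i = (\<Sum>l\<in>J. c i l *\<^sub>R e (\<iota> l)) + u i" for i
  have \<iota>\<iota>: "e (\<iota> i) \<bullet> e (\<iota> j) = (if i = j then 1 else 0)" if "i \<in> J" "j \<in> J" for i j
    using \<iota>(1) that by (auto simp: e_inner inj_on_eq_iff)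
  have y\<iota>: "y i \<bullet> e (\<iota> j) = c i j" if "j \<in> J" for i j
  proof -
    have "(\<Sum>l\<in>J. c i l * (e (\<iota> l) \<bullet> e (\<iota> j))) = (\<Sum>l\<in>J. if l = j then c i l else 0)"
      by (rule sum.cong) (use that in \<open>auto simp: \<iota>\<iota>\<close>)
    then show ?thesis using that J by (simp add: y_def inner_add_left inner_sum_left u\<iota>)
  qed
  have yu: "y i \<bullet> u k = u i \<bullet> u k" for i k
  proof -
    have "(\<Sum>l\<in>J. c i l * (e (\<iota> l) \<bullet> u k)) = 0" by (rule sum.neutral) (simp add: u\<iota>)
    then show ?thesis by (simp add: y_def inner_add_left inner_sum_left)
  qed
  have yy: "y i \<bullet> y k = e (\<iota> i) \<bullet> e (\<iota> k)" if "i \<in> J" "k \<in> J" for i k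
  proof -
    have "y i \<bullet> y k = (\<Sum>l\<in>J. c k l * (y i \<bullet> e (\<iota> l))) + y i \<bullet> u k"
      by (simp add: y_def[of k] inner_add_right inner_sum_right)
    also have "(\<Sum>l\<in>J. c k l * (y i \<bullet> e (\<iota> l))) = (\<Sum>l\<in>J. c i l * c k l)"
      by (rule sum.cong) (auto simp: y\<iota>)
    finally show ?thesis using that by (simp add: yu uu \<iota>\<iota> h_def)
  qed
  have yJ: "y i \<in> coord (- J)" for i
    unfolding y_def u_def using \<iota>(2) \<theta>n
    by (intro coord_add coord_sum coord_scale coord_e) auto
  have eJ: "e (\<iota> i) \<in> coord (- J)" if "i \<in> J" for i using \<iota>(2) that by (intro coord_e) auto
  obtain k where "k \<in> Orth (- J)" "\<forall>i\<in>J. k (e (\<iota> i)) = y i"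
    using gram_transitive[of J "- J" "\<lambda>i. e (\<iota> i)" y] J eJ yJ yy by auto
  then show ?thesis using that y\<iota> by auto
qed

text \<open>\<open>C * C - \<sigma> * S * S\<close> is both the determinant of the plane map and,
  for \<open>\<sigma>\<close> equal to \<open>1\<close> or \<open>-1\<close>, the left side of the
  hyperbolic or trigonometric identity, so boosts and rotations share one proof.\<close>

lemma plane_map_exists:
  assumes "i \<noteq> k" "k \<noteq> 0" and CS: "C * C - \<sigma> * S * S = 1" and \<sigma>: "\<sigma> = (if i = 0 then 1 else - 1)"
    and C: "i = 0 \<longrightarrow> C > 0"
  obtains g where "g \<in> Lam" "g (e i) = C *\<^sub>R e i + S *\<^sub>R e k" "g (e k) = (\<sigma> * S) *\<^sub>R e i + C *\<^sub>R e k"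
    "\<And>j. j \<noteq> i \<Longrightarrow> j \<noteq> k \<Longrightarrow> g (e j) = e j"
proof -
  define c where "c = e(i := C *\<^sub>R e i + S *\<^sub>R e k, k := (\<sigma> * S) *\<^sub>R e i + C *\<^sub>R e k)"
  have BB: "B (c a) (c b) = B (e a) (e b)" for a b
    using assms by (auto simp: c_def B_simps B_ee algebra_simps)
  have c0: "c 0 \<in> Hs"
    using BB[of 0 0] C assms(1,2) by (auto simp: Hs_iff B_ee c_def inner_add_left e_inner)
  have comp: "x = 0" if x: "\<And>j. B x (c j) = 0" for x
  proof (rule B_eqI)
    fix j
    have 1: "C * B x (e i) + S * B x (e k) = 0" "\<sigma> * S * B x (e i) + C * B x (e k) = 0"
      using x[of i] x[of k] assms(1) by (auto simp: c_def B_simps)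
    have "B x (e i) = (C * C - \<sigma> * S * S) * B x (e i)" using CS by simp
    also have "\<dots> = C * (C * B x (e i) + S * B x (e k)) - S * (\<sigma> * S * B x (e i) + C * B x (e k))"
      by (simp add: algebra_simps)
    finally have i: "B x (e i) = 0" using 1 by simp
    have "B x (e k) = (C * C - \<sigma> * S * S) * B x (e k)" using CS by simp
    also have "\<dots> = C * (\<sigma> * S * B x (e i) + C * B x (e k)) - \<sigma> * S * (C * B x (e i) + S * B x (e k))"
      by (simp add: algebra_simps)
    finally have k: "B x (e k) = 0" using 1 by simp
    show "B x (e j) = B 0 (e j)" using x[of j] i k by (auto simp: c_def B_simps split: if_splits)
  qed
  obtain g where "g \<in> Lam" "\<And>j. g (e j) = c j" using Lam_exists[OF BB c0 comp] by blast
  then show ?thesis using that assms(1) by (simp add: c_def)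
qed

text \<open>The parameters of a boost for the timelike index \<open>0\<close> and of a rotation for the others.\<close>

definition cs :: "nat \<Rightarrow> real \<Rightarrow> real" where "cs i t = (if i = 0 then cosh t else cos t)"
definition sn :: "nat \<Rightarrow> real \<Rightarrow> real" where "sn i t = (if i = 0 then sinh t else sin t)"
definition sg :: "nat \<Rightarrow> real" where "sg i = (if i = 0 then 1 else - 1)"

text \<open>One parameter \<open>t\<close> for all planes: the addition theorems then turn a
  quotient of two such maps into another one, up to its values on the vectors
  \<open>e i\<close>.\<close>

lemma multi_rotation_exists:
  assumes J: "finite J" and \<iota>: "inj_on \<iota> J" "\<iota> ` J \<inter> J = {}" "0 \<notin> \<iota> ` J"
  shows "\<exists>g\<in>Lam. (\<forall>i\<in>J. g (e i) = cs i t *\<^sub>R e i + sn i t *\<^sub>R e (\<iota> i)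
      \<and> g (e (\<iota> i)) = (sg i * sn i t) *\<^sub>R e i + cs i t *\<^sub>R e (\<iota> i))
      \<and> (\<forall>j. j \<notin> J \<union> \<iota> ` J \<longrightarrow> g (e j) = e j)"
  using assms
proof (induction J)
  case empty
  then show ?case using Lam_id by (intro bexI[of _ id]) auto
next
  case (insert l J)
  have "inj_on \<iota> J" "\<iota> ` J \<inter> J = {}" "0 \<notin> \<iota> ` J" using insert.prems by auto
  then obtain g where g: "g \<in> Lam" "\<And>i. i \<in> J \<Longrightarrow> g (e i) = cs i t *\<^sub>R e i + sn i t *\<^sub>R e (\<iota> i)"
    "\<And>i. i \<in> J \<Longrightarrow> g (e (\<iota> i)) = (sg i * sn i t) *\<^sub>R e i + cs i t *\<^sub>R e (\<iota> i)"
    "\<And>j. j \<notin> J \<union> \<iota> ` J \<Longrightarrow> g (e j) = e j"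
    using insert.IH by blast
  have l: "l \<noteq> \<iota> l" "\<iota> l \<noteq> 0" "\<iota> l \<notin> J" "l \<notin> \<iota> ` J" "\<iota> l \<notin> \<iota> ` J" using insert.prems insert.hyps by auto
  have "cs l t * cs l t - sg l * sn l t * sn l t = 1"
    using cosh_square_eq[of t] sin_cos_squared_add[of t]
    by (auto simp: cs_def sn_def sg_def power2_eq_square)
  then obtain h where h: "h \<in> Lam" "h (e l) = cs l t *\<^sub>R e l + sn l t *\<^sub>R e (\<iota> l)"
    "h (e (\<iota> l)) = (sg l * sn l t) *\<^sub>R e l + cs l t *\<^sub>R e (\<iota> l)"
    "\<And>j. j \<noteq> l \<Longrightarrow> j \<noteq> \<iota> l \<Longrightarrow> h (e j) = e j"
    using plane_map_exists[OF l(1,2), of "cs l t" "sg l" "sn l t"]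
    by (auto simp: sg_def cs_def cosh_real_pos)
  have hl: "linear h" using h Lam_linear by blast
  have hJ: "h (e i) = e i" "h (e (\<iota> i)) = e (\<iota> i)" if "i \<in> J" for i
  proof -
    have "i \<noteq> l" "i \<noteq> \<iota> l" "\<iota> i \<noteq> l" "\<iota> i \<noteq> \<iota> l"
      using that l insert.hyps(2) by (metis imageI)+
    then show "h (e i) = e i" "h (e (\<iota> i)) = e (\<iota> i)" using h(4) by auto
  qed
  have gl: "g (e l) = e l" "g (e (\<iota> l)) = e (\<iota> l)" using g(4) l insert.hyps(2) by auto
  show ?case
  proof (intro bexI[of _ "h \<circ> g"] conjI ballI allI impI)
    fix i assume i: "i \<in> insert l J"
    show "(h \<circ> g) (e i) = cs i t *\<^sub>R e i + sn i t *\<^sub>R e (\<iota> i)"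
      using i g(2) gl h hJ by (auto simp: linear_add[OF hl] linear_scale[OF hl])
    show "(h \<circ> g) (e (\<iota> i)) = (sg i * sn i t) *\<^sub>R e i + cs i t *\<^sub>R e (\<iota> i)"
      using i g(3) gl h hJ by (auto simp: linear_add[OF hl] linear_scale[OF hl])
  next
    fix j assume "j \<notin> insert l J \<union> \<iota> ` insert l J"
    then show "(h \<circ> g) (e j) = e j" using g(4) h(4) by auto
  qed (use g h Lam_comp in blast)
qed

end

section \<open>From finite codimension to an open set\<close>

context syndetic begin

text \<open>The pigeonhole principle is applied to an uncountable set of parameters. Taking them as
  arctangents keeps the difference \<open>t\<close> below \<open>pi\<close> in absolute value, so
  that \<open>sin t\<close>, and likewise \<open>sinh t\<close>, is nonzero for distinct
  parameters.\<close>

lemma plane_mixing_in_pw: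
  assumes J: "finite J" and \<iota>: "inj_on \<iota> J" "\<iota> ` J \<inter> J = {}" "0 \<notin> \<iota> ` J"
  obtains w t where "w \<in> pw W 2" "\<And>i. sn i t \<noteq> 0"
    "\<And>i. i \<in> J \<Longrightarrow> w (e i) = cs i t *\<^sub>R e i + sn i t *\<^sub>R e (\<iota> i)"
proof -
  obtain R where R: "\<And>t. R t \<in> Lam"
    "\<And>t i. i \<in> J \<Longrightarrow> R t (e i) = cs i t *\<^sub>R e i + sn i t *\<^sub>R e (\<iota> i)"
    "\<And>t i. i \<in> J \<Longrightarrow> R t (e (\<iota> i)) = (sg i * sn i t) *\<^sub>R e i + cs i t *\<^sub>R e (\<iota> i)"
    using multi_rotation_exists[OF assms] by metis
  obtain x y :: real where xy: "x \<noteq> y" "inv (R (arctan x)) \<circ> R (arctan y) \<in> pw W 2"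
    using pigeonhole[OF uncountable_UNIV_real, of "\<lambda>x. R (arctan x)"] R(1) by blast
  define s t where "s = arctan x" and "t = arctan y - arctan x"
  have lin: "linear (R s)" using R(1) Lam_linear by blast
  have w: "inv (R s) (R (s + t) (e i)) = cs i t *\<^sub>R e i + sn i t *\<^sub>R e (\<iota> i)" if i: "i \<in> J" for i
  proof -
    have cs: "cs i (s + t) = cs i s * cs i t + sg i * sn i s * sn i t"
      "sn i (s + t) = sn i s * cs i t + cs i s * sn i t"
      by (auto simp: cs_def sn_def sg_def cosh_add sinh_add cos_add sin_add)
    have "R s (cs i t *\<^sub>R e i + sn i t *\<^sub>R e (\<iota> i)) = R (s + t) (e i)"
      by (simp add: linear_add[OF lin] linear_scale[OF lin] R(2)[OF i] R(3)[OF i] cs algebra_simps)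
    then show ?thesis using Lam_inv_f[OF R(1)] by metis
  qed
  have t: "t \<noteq> 0" "\<bar>t\<bar> < pi"
    using xy(1) arctan_bounded[of x] arctan_bounded[of y] by (auto simp: t_def arctan_eq_iff)
  have "sin t \<noteq> 0"
  proof (cases "t > 0")
    case True
    then show ?thesis using t sin_gt_zero[of t] by auto
  next
    case False
    then show ?thesis using t sin_gt_zero[of "- t"] by auto
  qed
  then have "sn i t \<noteq> 0" for i using t by (auto simp: sn_def)
  moreover have "inv (R s) \<circ> R (s + t) \<in> pw W 2" using xy(2) by (simp add: s_def t_def)
  ultimately show ?thesis using that[of "inv (R s) \<circ> R (s + t)" t] w by simp
qed

text \<open>Conjugating the stabiliser of finitely many basis vectors by a map \<open>w\<close> mixing them with fresh
  ones, \<open>w\<^sup>-\<^sup>1 k w\<close> has a prescribable block on these basis vectors, so the double cosets of such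
  elements fill an open set.\<close>

lemma nbhd_in_pw:
  obtains F \<epsilon> where "finite F" "\<epsilon> > 0"
    "\<And>h. h \<in> Lam \<Longrightarrow> (\<And>v. v \<in> F \<Longrightarrow> norm (h v - v) < \<epsilon>) \<Longrightarrow> h \<in> pw W 168"
proof -
  obtain J where J: "finite J" "0 \<in> J" "Orth (- J) \<subseteq> pw W 40" by (rule cofinite_block_in_pw)
  have "infinite (- J)" using J(1) by (simp only: Compl_eq_Diff_UNIV) (rule Diff_infinite_finite, auto)
  then obtain \<iota> :: "nat \<Rightarrow> nat" where "inj \<iota>" "range \<iota> \<subseteq> - J"
    using infinite_countable_subset by blast
  then have \<iota>: "inj_on \<iota> J" "\<iota> ` J \<inter> J = {}" "0 \<notin> \<iota> ` J" and \<iota>n: "\<iota> i \<notin> J" for i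
    using J(2) by (auto intro: inj_on_subset)
  have nJ: "0 \<notin> - J" using J(2) by simp
  obtain w t where w: "w \<in> pw W 2" and sn0: "\<And>i. sn i t \<noteq> 0"
    and we: "\<And>i. i \<in> J \<Longrightarrow> w (e i) = cs i t *\<^sub>R e i + sn i t *\<^sub>R e (\<iota> i)"
    using plane_mixing_in_pw[OF J(1) \<iota>] by metis
  have wL: "w \<in> Lam" using w pw_Lam by blast
  \<comment> \<open>The contribution of the fixed vectors \<open>e i\<close> to the block of a
    conjugate of \<open>k\<close>; the rest is the compression of \<open>k\<close>, scaled by
    \<open>sn\<close>.\<close>
  define M where "M i j = (if i = j then cs i t * cs i t * B (e i) (e i) else 0)" for i j
  define \<mu> where "\<mu> = Min ((\<lambda>i. \<bar>sn i t\<bar>) ` J)"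
  have \<mu>: "\<mu> > 0" unfolding \<mu>_def using J sn0 by (subst Min_gr_iff) auto
  have \<mu>le: "\<mu> \<le> \<bar>sn i t\<bar>" if "i \<in> J" for i unfolding \<mu>_def using J that by simp
  have N: "real (card J) > 0" using J by (auto simp: card_gt_0_iff)
  \<comment> \<open>Dividing a deviation of size \<open>\<eta>\<close> by two factors
    \<open>sn\<close>, each at least \<open>\<mu>\<close>, gives the bound \<open>1 / card J\<close>
    that \<open>compression_exists\<close> requires.\<close>
  define \<eta> where "\<eta> = \<mu> * \<mu> / card J"
  have \<eta>: "\<eta> > 0" using \<mu> N by (simp add: \<eta>_def)
  have block: "B ((inv w \<circ> k \<circ> w) (e i)) (e j) = M i j - sn i t * sn j t * (k (e (\<iota> i)) \<bullet> e (\<iota> j))"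
    if k: "k \<in> Orth (- J)" and ij: "i \<in> J" "j \<in> J" for k i j
  proof -
    have kL: "k \<in> Lam" using k Orth_Lam by blast
    have kl: "linear k" using kL Lam_linear by blast
    have "B ((inv w \<circ> k \<circ> w) (e i)) (e j) = B (k (w (e i))) (w (e j))"
      using Lam_adj[OF Lam_inv[OF wL]] Lam_inv_inv[OF wL] by simp
    also have "k (w (e i)) = cs i t *\<^sub>R e i + sn i t *\<^sub>R k (e (\<iota> i))"
      using Orth_fix_e[OF k, of i] ij by (simp add: we linear_add[OF kl] linear_scale[OF kl])
    finally have 1: "B ((inv w \<circ> k \<circ> w) (e i)) (e j) =
      B (cs i t *\<^sub>R e i + sn i t *\<^sub>R k (e (\<iota> i))) (cs j t *\<^sub>R e j + sn j t *\<^sub>R e (\<iota> j))"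
      by (simp add: we ij)
    have ki: "k (e (\<iota> i)) \<in> coord (- J)" by (rule Orth_coord[OF nJ k coord_e]) (simp add: \<iota>n)
    have 2: "B (k (e (\<iota> i))) (e j) = 0"
      using coord_B[OF nJ ki] ki ij by (simp add: coord_def)
    have 3: "B (k (e (\<iota> i))) (e (\<iota> j)) = - (k (e (\<iota> i)) \<bullet> e (\<iota> j))"
      by (rule coord_B[OF nJ ki])
    have "i \<noteq> \<iota> j" using \<iota>n[of j] ij by metis
    then have 4: "B (e i) (e (\<iota> j)) = 0" by (simp add: B_ee)
    have "cs i t * B (e i) (e j) * cs j t = M i j" by (auto simp: M_def B_ee)
    then show ?thesis unfolding 1
      by (simp add: B_simps 2 3 4 algebra_simps)
  qed
  \<comment> \<open>A conjugate \<open>g'\<close> with the same block as \<open>g\<close> is chosen;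
    elements of \<open>Orth (- J)\<close> on either side repair the remaining difference. This costs
    \<open>40 + 44 + 40\<close> factors.\<close>
  have Y: "g \<in> pw W 124" if g: "g \<in> Lam"
    and gM: "\<And>i j. i \<in> J \<Longrightarrow> j \<in> J \<Longrightarrow> \<bar>B (g (e i)) (e j) - M i j\<bar> \<le> \<eta>" for g
  proof -
    define c where "c i j = - (B (g (e i)) (e j) - M i j) / (sn i t * sn j t)" for i j
    have cb: "\<bar>c i j\<bar> \<le> 1 / card J" if ij: "i \<in> J" "j \<in> J" for i j
    proof -
      have s: "\<mu> * \<mu> \<le> \<bar>sn i t * sn j t\<bar>"
        unfolding abs_mult using \<mu>le ij \<mu> by (intro mult_mono) auto
      have "\<bar>c i j\<bar> = \<bar>B (g (e i)) (e j) - M i j\<bar> / \<bar>sn i t * sn j t\<bar>"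
        by (simp add: c_def abs_minus_commute)
      also have "\<dots> \<le> \<eta> / (\<mu> * \<mu>)" using gM[OF ij] s \<mu> \<eta> by (intro frac_le) auto
      also have "\<dots> = 1 / card J" using \<mu> by (simp add: \<eta>_def)
      finally show ?thesis .
    qed
    obtain k where k: "k \<in> Orth (- J)" "\<And>i j. i \<in> J \<Longrightarrow> j \<in> J \<Longrightarrow> k (e (\<iota> i)) \<bullet> e (\<iota> j) = c i j"
      using compression_exists[OF J(1,2) \<iota>(1,2), of c] cb by blast
    define g' where "g' = inv w \<circ> k \<circ> w"
    have g'L: "g' \<in> Lam" unfolding g'_def using k Orth_Lam wL Lam_comp Lam_inv by metis
    have eq: "B (g' (e i)) (e j) = B (g (e i)) (e j)" if ij: "i \<in> J" "j \<in> J" for i j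
      using block[OF k(1) ij] k(2)[OF ij] sn0 by (simp add: g'_def c_def)
    have eq': "g' (e i) \<bullet> e j = g (e i) \<bullet> e j" if ij: "i \<in> J" "j \<in> J" for i j
      using eq[OF ij] by (cases "j = 0") (auto simp: B_e0 B_e)
    have p: "proj J (g' (e i)) = proj J (g (e i))" if "i \<in> J" for i
      by (rule e_eqI) (simp add: proj_inner_e eq' that)
    \<comment> \<open>Equal blocks mean equal projections to \<open>coord J\<close>, so the
      complementary parts have the same Gram matrix and one of the families can be moved to the
      other.\<close>
    define x y where "x i = g' (e i) - proj J (g' (e i))" and "y i = g (e i) - proj J (g (e i))" for i
    have xy: "x i \<in> coord (- J)" "y i \<in> coord (- J)" for i
      by (simp_all add: x_def y_def proj_compl)
    have Bp: "B u v = B (proj J u) (proj J v) - (u - proj J u) \<bullet> (v - proj J v)" for u v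
    proof -
      let ?u = "u - proj J u" and ?v = "v - proj J v"
      have "B ?u (proj J v) = 0" "B ?v (proj J u) = 0" "B ?u ?v = - (?u \<bullet> ?v)"
        using coord_B[OF nJ proj_compl] coord_orth[OF proj_compl proj_coord] by auto
      moreover have "B u v = B (proj J u) (proj J v) + B ?u (proj J v) + B (proj J u) ?v + B ?u ?v"
        by (simp add: B_simps)
      ultimately show ?thesis by (simp add: B_sym)
    qed
    have "x i \<bullet> x j = y i \<bullet> y j" if "i \<in> J" "j \<in> J" for i j
      using Bp[of "g' (e i)" "g' (e j)"] Bp[of "g (e i)" "g (e j)"] p that
      by (simp add: Lam_B[OF g] Lam_B[OF g'L] x_def y_def)
    then obtain k' where k': "k' \<in> Orth (- J)" "\<forall>i\<in>J. k' (x i) = y i"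
      using gram_transitive[OF J(1) nJ, of x y] xy by blast
    have k'L: "k' \<in> Lam" using k' Orth_Lam by blast
    have kg: "k' (g' (e i)) = g (e i)" if i: "i \<in> J" for i
    proof -
      have "k' (proj J (g (e i))) = proj J (g (e i))"
        using Orth_fix[OF k'(1)] proj_coord by simp
      then have "k' (x i + proj J (g' (e i))) = y i + proj J (g (e i))"
        using k'(2) i p[OF i] by (simp add: linear_add[OF Lam_linear[OF k'L]])
      then show ?thesis by (simp add: x_def y_def)
    qed
    define g'' where "g'' = inv (k' \<circ> g') \<circ> g"
    have kgL: "k' \<circ> g' \<in> Lam" using k'L g'L Lam_comp by blast
    have "g'' \<in> Orth (- J)"
      unfolding Orth_def
    proof (intro CollectI conjI allI impI)
      show "g'' \<in> Lam" unfolding g''_def using kgL g Lam_inv Lam_comp by blast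
      fix i assume "i \<notin> - J"
      then show "g'' (e i) = e i" using kg[of i] Lam_inv_f[OF kgL, of "e i"] by (simp add: g''_def)
    qed
    then have pws: "k' \<in> pw W 40" "k \<in> pw W 40" "g'' \<in> pw W 40" using k k' J(3) by auto
    have "g' \<in> pw W 44" unfolding g'_def
      by (rule pw_comp[OF pw_comp[OF pw_inv[OF w] pws(2) refl] w]) simp
    then have "k' \<circ> g' \<circ> g'' \<in> pw W 124"
      by (intro pw_comp[OF pw_comp[OF pws(1) _ refl] pws(3)]) auto
    moreover have "g = k' \<circ> g' \<circ> g''"
      using Lam_f_inv[OF kgL] by (auto simp: g''_def fun_eq_iff)
    ultimately show ?thesis by simp
  qed
  \<comment> \<open>Zero compression puts the block of \<open>g0\<close> exactly at
    \<open>M\<close>, the centre of the admissible region. If \<open>h\<close> is near the identity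
    on the vectors \<open>g0 (e i)\<close>, then \<open>h \<circ> g0\<close> stays in the region,
    and removing \<open>g0\<close> adds \<open>44\<close> factors.\<close>
  obtain k0 where k0: "k0 \<in> Orth (- J)" "\<And>i j. i \<in> J \<Longrightarrow> j \<in> J \<Longrightarrow> k0 (e (\<iota> i)) \<bullet> e (\<iota> j) = 0"
    using compression_exists[OF J(1,2) \<iota>(1,2), of "\<lambda>i j. 0"] by auto
  define g0 where "g0 = inv w \<circ> k0 \<circ> w"
  have "k0 \<in> pw W 40" using k0 J(3) by blast
  then have g0: "g0 \<in> pw W 44" unfolding g0_def
    by (intro pw_comp[OF pw_comp[OF pw_inv[OF w] _ refl] w]) auto
  have g0L: "g0 \<in> Lam" using g0 pw_Lam by blast
  show ?thesis
  proof (rule that[of "(\<lambda>i. g0 (e i)) ` J" "\<eta> / 3"])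
    fix h assume h: "h \<in> Lam" and close: "\<And>v. v \<in> (\<lambda>i. g0 (e i)) ` J \<Longrightarrow> norm (h v - v) < \<eta> / 3"
    have "h \<circ> g0 \<in> pw W 124"
    proof (rule Y)
      show "h \<circ> g0 \<in> Lam" using h g0L Lam_comp by blast
      fix i j assume ij: "i \<in> J" "j \<in> J"
      have "B (g0 (e i)) (e j) = M i j" using block[OF k0(1) ij] k0(2)[OF ij] by (simp add: g0_def)
      then have "\<bar>B ((h \<circ> g0) (e i)) (e j) - M i j\<bar> = \<bar>B (h (g0 (e i)) - g0 (e i)) (e j)\<bar>"
        by (simp add: B_simps)
      also have "\<dots> \<le> 3 * norm (h (g0 (e i)) - g0 (e i)) * norm (e j)" by (rule B_bound)
      also have "\<dots> \<le> \<eta>" using close[of "g0 (e i)"] ij by simp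
      finally show "\<bar>B ((h \<circ> g0) (e i)) (e j) - M i j\<bar> \<le> \<eta>" .
    qed
    then have "h \<circ> g0 \<circ> inv g0 \<in> pw W 168" by (rule pw_comp[OF _ pw_inv[OF g0]]) simp
    moreover have "h = h \<circ> g0 \<circ> inv g0" using Lam_f_inv[OF g0L] by (auto simp: fun_eq_iff)
    ultimately show "h \<in> pw W 168" by simp
  qed (use J \<eta> in auto)
qed

end

section \<open>Minimality\<close>

lemma pw_split: "a \<in> pw W (m + n) \<Longrightarrow> \<exists>b\<in>pw W m. \<exists>c\<in>pw W n. a = b \<circ> c"
proof (induction m arbitrary: a)
  case (Suc m)
  then obtain b c where bc: "a = b \<circ> c" "b \<in> W" "c \<in> pw W (m + n)" by auto
  then obtain c1 c2 where c: "c1 \<in> pw W m" "c2 \<in> pw W n" "c = c1 \<circ> c2" using Suc.IH by blast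
  then have "b \<circ> c1 \<in> pw W (Suc m)" using bc(2) unfolding pw.simps by blast
  moreover have "a = (b \<circ> c1) \<circ> c2" using bc c by (simp add: comp_assoc)
  ultimately show ?case using c(2) by blast
qed simp

text \<open>A filter base that contains sets with finite covers by arbitrarily small balls: some
  ball of each cover still meets every member, and nested choices of such balls have Cauchy
  centres.\<close>

lemma cluster_point_exists:
  fixes \<A> :: "'b::complete_space set set"
  assumes ne: "\<A> \<noteq> {}" "\<And>A. A \<in> \<A> \<Longrightarrow> A \<noteq> {}"
    and dir: "\<And>A B. A \<in> \<A> \<Longrightarrow> B \<in> \<A> \<Longrightarrow> \<exists>C\<in>\<A>. C \<subseteq> A \<inter> B"
    and tb: "\<And>r::real. r > 0 \<Longrightarrow> \<exists>A\<in>\<A>. \<exists>K. finite K \<and> A \<subseteq> (\<Union>k\<in>K. ball k r)"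
  obtains y where "\<And>A. A \<in> \<A> \<Longrightarrow> y \<in> closure A"
proof -
  define pos where "pos X \<longleftrightarrow> (\<forall>A\<in>\<A>. A \<inter> X \<noteq> {})" for X
  have step: "\<exists>k. pos (X \<inter> ball k r)" if X: "pos X" and r: "r > 0" for X and r :: real
  proof (rule ccontr)
    assume neg: "\<nexists>k. pos (X \<inter> ball k r)"
    obtain A0 K where A0: "A0 \<in> \<A>" "finite K" "A0 \<subseteq> (\<Union>k\<in>K. ball k r)" using tb[OF r] by blast
    have "\<exists>A\<in>\<A>. A \<subseteq> A0 \<and> (\<forall>k\<in>K. A \<inter> (X \<inter> ball k r) = {})"
      using A0(2)
    proof (induction K)
      case empty
      then show ?case using A0(1) by blast
    next
      case (insert k K)
      then obtain A where A: "A \<in> \<A>" "A \<subseteq> A0" "\<forall>k\<in>K. A \<inter> (X \<inter> ball k r) = {}" by blast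
      obtain A' where A': "A' \<in> \<A>" "A' \<inter> (X \<inter> ball k r) = {}" using neg unfolding pos_def by blast
      obtain C where C: "C \<in> \<A>" "C \<subseteq> A \<inter> A'" using dir[OF A(1) A'(1)] by blast
      have "C \<inter> (X \<inter> ball i r) = {}" if "i \<in> insert k K" for i
      proof (cases "i = k")
        case True
        then show ?thesis using C(2) A'(2) by auto
      next
        case False
        then have "A \<inter> (X \<inter> ball i r) = {}" using that A(3) by simp
        then show ?thesis using C(2) by auto
      qed
      moreover have "C \<subseteq> A0" using C(2) A(2) by auto
      ultimately show ?case using C(1) by auto
    qed
    \<comment> \<open>If every ball failed, directedness would produce one member that misses all of
      them inside \<open>X\<close> although it is covered by them.\<close>
    then obtain A where A: "A \<in> \<A>" "A \<subseteq> A0" "\<forall>k\<in>K. A \<inter> (X \<inter> ball k r) = {}" by auto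
    obtain z where z: "z \<in> A" "z \<in> X" using X A(1) by (auto simp: pos_def)
    then obtain k where k: "k \<in> K" "z \<in> ball k r" using A(2) A0(3) by blast
    then have "A \<inter> (X \<inter> ball k r) = {}" using A(3) by blast
    then show False using k(2) z by blast
  qed
  have "\<exists>f. \<forall>n. pos (snd (f n)) \<and>
      (snd (f (Suc n)) \<subseteq> snd (f n) \<and> snd (f (Suc n)) \<subseteq> ball (fst (f (Suc n))) ((1/2) ^ n))"
  proof (rule dependent_nat_choice)
    show "\<exists>x. pos (snd x)" using ne(2) by (intro exI[of _ "(undefined, UNIV)"]) (auto simp: pos_def)
    fix x :: "'b \<times> 'b set" and n :: nat
    assume "pos (snd x)"
    then obtain k where "pos (snd x \<inter> ball k ((1/2) ^ n))" using step[of "snd x" "(1/2) ^ n"] by auto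
    then show "\<exists>y. pos (snd y) \<and> snd y \<subseteq> snd x \<and> snd y \<subseteq> ball (fst y) ((1/2) ^ n)"
      by (intro exI[of _ "(k, snd x \<inter> ball k ((1/2) ^ n))"]) auto
  qed
  then obtain f where f: "\<And>n. pos (snd (f n))" "\<And>n. snd (f (Suc n)) \<subseteq> snd (f n)"
    "\<And>n. snd (f (Suc n)) \<subseteq> ball (fst (f (Suc n))) ((1/2) ^ n)" by blast
  define X k where "X n = snd (f (Suc n))" and "k n = fst (f (Suc n))" for n
  have X: "pos (X n)" "X n \<subseteq> ball (k n) ((1/2) ^ n)" for n using f by (auto simp: X_def k_def)
  have Xdec: "X (n + m) \<subseteq> X n" for n m
    by (induction m) (use f(2) in \<open>auto simp: X_def\<close>)
  have kd: "dist (k n) (k (n + m)) \<le> 2 * (1/2) ^ n" for n m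
  proof -
    obtain A where "A \<in> \<A>" using ne(1) by blast
    then obtain z where z: "z \<in> X (n + m)" using X(1) unfolding pos_def by blast
    have "(1/2 :: real) ^ (n + m) \<le> (1/2) ^ n" by (rule power_decreasing) auto
    moreover have "dist (k n) z < (1/2) ^ n" "dist (k (n + m)) z < (1/2) ^ (n + m)"
      using X(2)[of n] X(2)[of "n + m"] z Xdec[of n m] by auto
    ultimately show ?thesis using dist_triangle2[of "k n" "k (n + m)" z] by linarith
  qed
  have half: "\<exists>n. (1/2 :: real) ^ n < r" if "r > 0" for r
    using real_arch_pow_inv[OF that, of "1/2"] by auto
  have "Cauchy k"
  proof (rule metric_CauchyI)
    fix r :: real assume "r > 0"
    then obtain n where n: "(1/2 :: real) ^ n < r / 4" using half[of "r / 4"] by auto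
    have "dist (k a) (k b) < r" if "a \<ge> n" "b \<ge> n" for a b
      using kd[of n "a - n"] kd[of n "b - n"] n that dist_triangle3[of "k a" "k b" "k n"] by simp
    then show "\<exists>M. \<forall>m\<ge>M. \<forall>n\<ge>M. dist (k m) (k n) < r" by blast
  qed
  then obtain y where y: "k \<longlonglongrightarrow> y" using Cauchy_convergent convergent_def by blast
  show ?thesis
  proof (rule that)
    fix A assume A: "A \<in> \<A>"
    show "y \<in> closure A"
      unfolding closure_approachable
    proof (intro allI impI)
      fix r :: real assume r: "r > 0"
      obtain n1 where n1: "(1/2 :: real) ^ n1 < r / 2" using half[of "r / 2"] r by auto
      obtain n2 where n2: "\<And>n. n \<ge> n2 \<Longrightarrow> dist (k n) y < r / 2"
        using metric_LIMSEQ_D[OF y, of "r / 2"] r by auto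
      define n where "n = max n1 n2"
      have "(1/2 :: real) ^ n \<le> (1/2) ^ n1" unfolding n_def by (rule power_decreasing) auto
      moreover obtain z where z: "z \<in> A" "z \<in> X n" using X(1)[of n] A unfolding pos_def by blast
      moreover have "dist (k n) z < (1/2) ^ n" using X(2)[of n] z by auto
      moreover have "dist (k n) y < r / 2" using n2[of n] by (simp add: n_def)
      ultimately have "dist z y < r" using n1 dist_triangle3[of z y "k n"] by linarith
      then show "\<exists>z\<in>A. dist z y < r" using z by blast
    qed
  qed
qed

section \<open>Control by finitely many basis vectors, and the braid relation\<close>

context hyp begin

text \<open>Closeness at \<open>e 0\<close> bounds the norms of \<open>h\<close> and
  \<open>g\<close> by a common \<open>K\<close>, so a finite part of the expansion of
  \<open>v\<close> decides.\<close>

lemma Lam_locally_determined: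
  assumes g: "g \<in> Lam" and r: "r > 0"
  obtains N \<delta> where "\<delta> > 0"
    "\<And>h. h \<in> Lam \<Longrightarrow> (\<And>i. i < N \<Longrightarrow> norm (h (e i) - g (e i)) < \<delta>) \<Longrightarrow> norm (h v - g v) < r"
proof -
  define K where "K = 5 * (norm (g (e 0)) + 2)"
  have K: "K > 0" by (simp add: K_def add_nonneg_pos)
  define s where "s n = (\<Sum>i<n. (v \<bullet> e i) *\<^sub>R e i)" for n
  have "s \<longlonglongrightarrow> v" using expand[of v] by (simp add: sums_def s_def[abs_def])
  then obtain n0 where n0: "\<And>n. n \<ge> n0 \<Longrightarrow> norm (s n - v) < r / (4 * K)"
    using LIMSEQ_D[of s v "r / (4 * K)"] r K by auto
  \<comment> \<open>The successor guarantees that index \<open>0\<close> is among those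
    controlled.\<close>
  define N where "N = Suc n0"
  have N: "norm (v - s N) < r / (4 * K)" using n0[of N] by (simp add: N_def norm_minus_commute)
  define \<delta> where "\<delta> = min 1 (r / (2 * (N * norm v + 1)))"
  have den: "N * norm v + 1 > 0" by (simp add: add_nonneg_pos)
  have \<delta>: "\<delta> > 0" using r den by (simp add: \<delta>_def)
  show ?thesis
  proof (rule that[OF \<delta>])
    fix h assume h: "h \<in> Lam" and close: "\<And>i. i < N \<Longrightarrow> norm (h (e i) - g (e i)) < \<delta>"
    have hl: "linear h" "linear g" using h g Lam_linear by auto
    have "norm (h (e 0) - g (e 0)) < 1" using close[of 0] by (simp add: N_def \<delta>_def)
    then have "norm (h (e 0)) \<le> norm (g (e 0)) + 1" using norm_triangle_ineq2[of "h (e 0)" "g (e 0)"] by linarith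
    then have "norm (h x) \<le> K * norm x" "norm (g x) \<le> K * norm x" for x
      using order_trans[OF Lam_bound[OF h, of x] mult_right_mono[of _ K]]
        order_trans[OF Lam_bound[OF g, of x] mult_right_mono[of _ K]] by (auto simp: K_def)
    note bnd = this
    have hv: "h v - g v = h (v - s N) - g (v - s N) + (h (s N) - g (s N))"
      by (simp add: linear_diff[OF hl(1)] linear_diff[OF hl(2)])
    have 1: "norm (h (v - s N) - g (v - s N)) \<le> 2 * K * norm (v - s N)"
      using norm_triangle_ineq4[of "h (v - s N)" "g (v - s N)"] bnd[of "v - s N"] by linarith
    have 2: "2 * K * norm (v - s N) < r / 2" using N K by (simp add: field_simps)
    have "h (s N) - g (s N) = (\<Sum>i<N. (v \<bullet> e i) *\<^sub>R (h (e i) - g (e i)))"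
      by (simp add: s_def linear_sum[OF hl(1)] linear_sum[OF hl(2)] linear_scale[OF hl(1)]
          linear_scale[OF hl(2)] sum_subtractf scaleR_diff_right)
    also have "norm \<dots> \<le> (\<Sum>i<N. norm v * \<delta>)"
    proof (rule sum_norm_le)
      fix i assume "i \<in> {..<N}"
      then have "norm (h (e i) - g (e i)) \<le> \<delta>" using close[of i] by simp
      then show "norm ((v \<bullet> e i) *\<^sub>R (h (e i) - g (e i))) \<le> norm v * \<delta>"
        unfolding norm_scaleR by (intro mult_mono abs_inner_e) auto
    qed
    also have "\<dots> \<le> (N * norm v + 1) * \<delta>" using \<delta> by (simp add: algebra_simps)
    also have "\<dots> \<le> (N * norm v + 1) * (r / (2 * (N * norm v + 1)))"
      using den by (intro mult_left_mono) (auto simp: \<delta>_def)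
    also have "\<dots> = r / 2" using den by (simp add: field_simps)
    finally show "norm (h v - g v) < r"
      unfolding hv using 1 2 norm_triangle_ineq[of "h (v - s N) - g (v - s N)" "h (s N) - g (s N)"] by linarith
  qed
qed

lemma Lam_near_id:
  assumes "finite F" and r: "r > 0"
  shows "\<exists>N. \<exists>\<delta>>0. \<forall>h\<in>Lam. (\<forall>i<N. norm (h (e i) - e i) < \<delta>) \<longrightarrow> (\<forall>v\<in>F. norm (h v - v) < r)"
  using assms(1)
proof (induction F)
  case empty
  then show ?case by (intro exI[of _ 0] exI[of _ 1]) auto
next
  case (insert v F)
  then obtain N \<delta> where N: "\<delta> > 0" "\<And>h. h \<in> Lam \<Longrightarrow> \<forall>i<N. norm (h (e i) - e i) < \<delta> \<Longrightarrow> \<forall>v\<in>F. norm (h v - v) < r"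
    by blast
  obtain N' \<delta>' where N': "\<delta>' > 0"
    "\<And>h. h \<in> Lam \<Longrightarrow> (\<And>i. i < N' \<Longrightarrow> norm (h (e i) - id (e i)) < \<delta>') \<Longrightarrow> norm (h v - id v) < r"
    using Lam_locally_determined[OF Lam_id r, where v = v] by metis
  show ?case
    by (rule exI[of _ "max N N'"], rule exI[of _ "min \<delta> \<delta>'"]) (use N N' in auto)
qed

lemma proj_inner_self: "proj A x \<bullet> x = (norm (proj A x))\<^sup>2"
proof -
  have "proj A x \<bullet> (x - proj A x) = 0" by (rule coord_orth[OF proj_coord proj_compl]) simp
  then show ?thesis by (simp add: inner_diff_right power2_norm_eq_inner)
qed

lemma proj_norm: "norm (proj A x) \<le> norm x"
proof -
  have "(norm (proj A x))\<^sup>2 \<le> norm (proj A x) * norm x"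
    using proj_inner_self[of A x] Cauchy_Schwarz_ineq2[of "proj A x" x] by simp
  then show ?thesis
    by (cases "proj A x = 0") (auto simp: power2_eq_square mult_le_cancel_left)
qed

lemma proj_proj: "A \<subseteq> A' \<Longrightarrow> proj A (proj A' x) = proj A x"
  by (rule e_eqI) (auto simp: proj_inner_e)

lemma proj_diff: "proj A (x - y) = proj A x - proj A y"
  by (rule e_eqI) (auto simp: proj_inner_e inner_diff_left)

lemma proj_scale: "proj A (c *\<^sub>R x) = c *\<^sub>R proj A x"
  by (rule e_eqI) (auto simp: proj_inner_e)

lemma refl_scale: "c \<noteq> 0 \<Longrightarrow> refl (c *\<^sub>R v) = refl v"
  by (rule ext) (simp add: refl_def B_simps)

text \<open>Points of \<open>Hs\<close> from which a spacelike basis vector is recovered by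
  subtracting a multiple of \<open>e 0\<close>; they transfer convergence on \<open>Hs\<close> to
  the basis.\<close>

lemma shifted_basis_Hs: "i \<noteq> 0 \<Longrightarrow> sqrt 2 *\<^sub>R e 0 + e i \<in> Hs"
  by (simp add: Hs_iff B_simps B_ee inner_add_left e_inner)

text \<open>Unit vectors with \<open>B n m = \<plusminus>1/2\<close> give reflections satisfying the braid relation, so that the
  reflection in \<open>m\<close> is a product of conjugates of the reflection in \<open>n\<close>.\<close>

lemma refl_braid:
  assumes n: "B n n = - 1" and m: "B m m = - 1" and nm: "(B n m)\<^sup>2 = 1 / 4"
  shows "refl m = refl n \<circ> (refl m \<circ> refl n \<circ> refl m) \<circ> refl n"
proof -
  define c where "c = 2 * B n m"
  have cc: "c * c = 1" using nm by (simp add: c_def power2_eq_square)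
  have L: "refl n \<in> Lam" "refl m \<in> Lam" using refl_Lam n m by auto
  have nn: "refl n (refl n x) = x" "refl m (refl m x) = x" for x using refl_refl n m by auto
  have "refl m (refl n (refl m x)) = refl (refl m n) x" for x
    using refl_conj[OF L(2), of n x] refl_inv[of m] m by simp
  moreover have "refl n (refl m (refl n x)) = refl (refl n m) x" for x
    using refl_conj[OF L(1), of m x] refl_inv[of n] n by simp
  \<comment> \<open>The vectors \<open>n + c m\<close> and \<open>m + c n\<close> are proportional
    because \<open>c\<close> is a sign, so both threefold products are the same reflection.\<close>
  moreover have "refl m n = c *\<^sub>R refl n m"
    using n m cc by (simp add: refl_def c_def B_sym[of m n] scaleR_add_right)
  then have "refl (refl m n) = refl (refl n m)" using refl_scale[of c] cc by (metis mult_zero_left zero_neq_one)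
  ultimately have "refl m (refl n (refl m x)) = refl n (refl m (refl n x))" for x by metis
  from this[of "refl n _"] show ?thesis by (simp add: fun_eq_iff nn)
qed

end

text \<open>The axioms of an identity neighbourhood base of a separable Hausdorff group topology,
  stated for linear maps; \<open>V_cover\<close> is the trace of a dense sequence.\<close>

locale nbhd_system = hyp e for e :: "nat \<Rightarrow> 'a::{real_inner, complete_space}" +
  fixes \<V> :: "('a \<Rightarrow> 'a) set set"
  assumes V_Lam: "V \<in> \<V> \<Longrightarrow> V \<subseteq> Lam" and V_id: "V \<in> \<V> \<Longrightarrow> id \<in> V"
    and V_mult: "V \<in> \<V> \<Longrightarrow> \<exists>V'\<in>\<V>. \<forall>a\<in>V'. \<forall>b\<in>V'. a \<circ> b \<in> V"
    and V_inv: "V \<in> \<V> \<Longrightarrow> \<exists>V'\<in>\<V>. \<forall>a\<in>V'. inv a \<in> V"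
    and V_int: "V \<in> \<V> \<Longrightarrow> V' \<in> \<V> \<Longrightarrow> \<exists>V''\<in>\<V>. V'' \<subseteq> V \<inter> V'"
    and V_conj: "V \<in> \<V> \<Longrightarrow> \<gamma> \<in> Lam \<Longrightarrow> \<exists>V'\<in>\<V>. \<forall>a\<in>V'. \<gamma> \<circ> a \<circ> inv \<gamma> \<in> V"
    and V_sep: "g \<in> Lam \<Longrightarrow> g \<noteq> id \<Longrightarrow> \<exists>V\<in>\<V>. g \<notin> V"
    and V_cover: "V \<in> \<V> \<Longrightarrow> \<exists>k :: nat \<Rightarrow> 'a \<Rightarrow> 'a. range k \<subseteq> Lam \<and> (\<forall>g\<in>Lam. \<exists>n. inv (k n) \<circ> g \<in> V)"
begin

lemma V_pw: "V \<in> \<V> \<Longrightarrow> \<exists>U\<in>\<V>. pw U (2 ^ n) \<subseteq> V"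
proof (induction n arbitrary: V)
  case 0
  then show ?case by (intro bexI[of _ V]) auto
next
  case (Suc n)
  obtain V' where V': "V' \<in> \<V>" "\<forall>a\<in>V'. \<forall>b\<in>V'. a \<circ> b \<in> V" using V_mult[OF Suc.prems] by blast
  obtain U where U: "U \<in> \<V>" "pw U (2 ^ n) \<subseteq> V'" using Suc.IH[OF V'(1)] by blast
  have "pw U (2 ^ Suc n) \<subseteq> V"
  proof
    fix a assume "a \<in> pw U (2 ^ Suc n)"
    then have "a \<in> pw U (2 ^ n + 2 ^ n)" by (simp add: mult_2)
    then show "a \<in> V" using pw_split U(2) V'(2) by blast
  qed
  then show ?case using U by blast
qed

lemma V_inv_both: "V \<in> \<V> \<Longrightarrow> \<exists>V'\<in>\<V>. \<forall>a\<in>V'. a \<in> V \<and> inv a \<in> V"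
proof -
  assume V: "V \<in> \<V>"
  obtain V1 where V1: "V1 \<in> \<V>" "\<forall>a\<in>V1. inv a \<in> V" using V_inv[OF V] by blast
  obtain V2 where V2: "V2 \<in> \<V>" "V2 \<subseteq> V \<inter> V1" using V_int[OF V V1(1)] by blast
  show ?thesis using V1(2) V2 by (intro bexI[of _ V2]) auto
qed

text \<open>The symmetric part \<open>W\<close> of a small \<open>U\<close> is covered by countably
  many translates, because a smaller neighbourhood already lies in it. The power
  \<open>2 ^ 8\<close> is the first power of two above \<open>168\<close>.\<close>

lemma automatic_continuity:
  assumes V: "V \<in> \<V>"
  obtains F r where "finite F" "r > 0"
    "\<And>h. h \<in> Lam \<Longrightarrow> (\<And>v. v \<in> F \<Longrightarrow> norm (h v - v) < r) \<Longrightarrow> h \<in> V"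
proof -
  obtain U where U: "U \<in> \<V>" "pw U (2 ^ 8) \<subseteq> V" using V_pw[OF V] by blast
  obtain U' where U': "U' \<in> \<V>" "\<And>a. a \<in> U' \<Longrightarrow> a \<in> U \<and> inv a \<in> U" using V_inv_both[OF U(1)] by blast
  define W where "W = {a \<in> U. inv a \<in> U}"
  have WL: "W \<subseteq> Lam" using V_Lam[OF U(1)] by (auto simp: W_def)
  interpret W: syndetic e W
  proof
    show "W \<subseteq> Lam" by (rule WL)
    show "id \<in> W" using V_id[OF U(1)] by (simp add: W_def)
    show "inv w \<in> W" if "w \<in> W" for w
      using that Lam_inv_inv WL by (auto simp: W_def)
    obtain k :: "nat \<Rightarrow> 'a \<Rightarrow> 'a" where k: "range k \<subseteq> Lam" "\<forall>g\<in>Lam. \<exists>n. inv (k n) \<circ> g \<in> U'"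
      using V_cover[OF U'(1)] by blast
    have "\<exists>n. \<exists>w\<in>W. g = k n \<circ> w" if g: "g \<in> Lam" for g
    proof -
      obtain n where n: "inv (k n) \<circ> g \<in> U'" using k(2) g by blast
      then have "inv (k n) \<circ> g \<in> W" using U'(2) by (simp add: W_def)
      moreover have "g = k n \<circ> (inv (k n) \<circ> g)"
        using Lam_f_inv[of "k n"] k(1) by (simp add: fun_eq_iff range_subsetD)
      ultimately show ?thesis by blast
    qed
    then show "\<exists>k :: nat \<Rightarrow> 'a \<Rightarrow> 'a. range k \<subseteq> Lam \<and> (\<forall>g\<in>Lam. \<exists>n. \<exists>w\<in>W. g = k n \<circ> w)"
      using k(1) by blast
  qed
  have "pw W 168 \<subseteq> pw W (2 ^ 8)" by (rule pw_mono[OF W.W_id]) simp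
  also have "\<dots> \<subseteq> pw U (2 ^ 8)" by (rule pw_mono_base) (auto simp: W_def)
  finally have "pw W 168 \<subseteq> V" using U(2) by blast
  then show ?thesis using W.nbhd_in_pw that by (metis subsetD)
qed

text \<open>Otherwise some unit vector \<open>f\<close> almost orthogonal to the first basis vectors has inner product
  \<open>1/2\<close> with \<open>g m\<close>, and \<open>n = g\<^sup>-\<^sup>1 f\<close> satisfies the braid relation with \<open>m\<close>.\<close>

lemma orbit_tail_bounded:
  assumes m: "B m m = - 1"
  shows "\<exists>V\<in>\<V>. \<exists>N R. \<forall>g\<in>V. norm (proj {N..} (g m)) \<le> 1 / 2 \<and> norm (g m) \<le> R"
proof -
  have mL: "refl m \<in> Lam" using refl_Lam m by simp
  have minv: "inv (refl m) = refl m" using refl_inv m by simp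
  have "refl m m = - m" using m by (simp add: refl_def scaleR_2)
  moreover have "m \<noteq> 0" using m by (auto simp: B_simps)
  ultimately have "refl m m \<noteq> m" by (metis add.right_inverse scaleR_2 scaleR_eq_0_iff zero_neq_numeral)
  then have "refl m \<noteq> id" by auto
  then obtain U where U: "U \<in> \<V>" "refl m \<notin> U" using V_sep mL by blast
  obtain U2 where U2: "U2 \<in> \<V>" "pw U2 (2 ^ 2) \<subseteq> U" using V_pw[OF U(1)] by blast
  obtain U2' where U2': "U2' \<in> \<V>" "\<forall>a\<in>U2'. refl m \<circ> a \<circ> inv (refl m) \<in> U2"
    using V_conj[OF U2(1) mL] by blast
  obtain U1 where U1: "U1 \<in> \<V>" "U1 \<subseteq> U2 \<inter> U2'" using V_int[OF U2(1) U2'(1)] by blast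
  \<comment> \<open>Otherwise the braid relation writes \<open>refl m\<close> as three elements of
    \<open>U2\<close>, the middle one being a conjugate by the fixed map
    \<open>refl m\<close>.\<close>
  have no: "refl n \<notin> U1" if n: "B n n = - 1" "(B n m)\<^sup>2 = 1 / 4" for n
  proof
    assume "refl n \<in> U1"
    then have a: "refl n \<in> pw U2 1" "refl m \<circ> refl n \<circ> refl m \<in> pw U2 1"
      using U1(2) U2'(2) minv by (auto simp: pw_one simp del: pw.simps)
    have "refl m \<in> pw U2 (1 + 1 + 1)"
      by (subst refl_braid[OF n(1) m n(2)]) (intro pw_add a)
    also have "\<dots> \<subseteq> pw U2 (2 ^ 2)" by (rule pw_mono[OF V_id[OF U2(1)]]) simp
    finally show False using U2(2) U(2) by blast
  qed
  obtain U3 where U3: "U3 \<in> \<V>" "pw U3 (2 ^ 2) \<subseteq> U1" using V_pw[OF U1(1)] by blast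
  obtain V where V: "V \<in> \<V>" "\<And>a. a \<in> V \<Longrightarrow> a \<in> U3 \<and> inv a \<in> U3" using V_inv_both[OF U3(1)] by blast
  obtain F r where F: "finite F" "r > 0"
    "\<And>h. h \<in> Lam \<Longrightarrow> (\<And>v. v \<in> F \<Longrightarrow> norm (h v - v) < r) \<Longrightarrow> h \<in> U3"
    using automatic_continuity[OF U3(1)] by metis
  obtain N0 \<delta> where \<delta>: "\<delta> > 0"
    "\<And>h. h \<in> Lam \<Longrightarrow> \<forall>i<N0. norm (h (e i) - e i) < \<delta> \<Longrightarrow> \<forall>v\<in>F. norm (h v - v) < r"
    using Lam_near_id[OF F(1,2)] by blast
  define N where "N = Suc N0"
  \<comment> \<open>Near orthogonality to the first basis vectors puts \<open>refl f\<close> into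
    \<open>U3\<close> by automatic continuity; its conjugate by \<open>inv g\<close> is
    \<open>refl n\<close> with \<open>B n m = - 1 / 2\<close>.\<close>
  have avoid: False if g: "g \<in> V" and f: "norm f = 1" "f \<bullet> e 0 = 0" "f \<bullet> g m = 1 / 2"
    "\<And>i. i < N \<Longrightarrow> \<bar>f \<bullet> e i\<bar> < \<delta> / 2" for g f
  proof -
    have gL: "g \<in> Lam" using g V(1) V_Lam by blast
    have Bf: "B f y = - (f \<bullet> y)" for y using f(2) by (simp add: B_def)
    have ff: "B f f = - 1" using f(1) by (simp add: Bf dot_square_norm)
    have fL: "refl f \<in> Lam" using refl_Lam ff by simp
    have "norm (refl f (e i) - e i) < \<delta>" if "i < N" for i
    proof -
      have "refl f (e i) - e i = (- 2 * (f \<bullet> e i)) *\<^sub>R f" using B_sym[of "e i" f] Bf[of "e i"] by (simp add: refl_def ff)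
      then show ?thesis using f(1) f(4)[OF that] by simp
    qed
    then have "refl f \<in> U3" using F(3)[OF fL] \<delta>(2)[OF fL] by (simp add: N_def)
    moreover have "g \<in> U3" "inv g \<in> U3" using V(2) g by auto
    moreover define n where "n = inv g f"
    have "refl n = inv g \<circ> refl f \<circ> g"
      using refl_conj[OF Lam_inv[OF gL], of f] Lam_inv_inv[OF gL] by (auto simp: n_def)
    ultimately have "refl n \<in> pw U3 (1 + 1 + 1)" by (simp only:) (intro pw_add; simp)
    moreover have "pw U3 (1 + 1 + 1) \<subseteq> pw U3 (2 ^ 2)" by (rule pw_mono[OF V_id[OF U3(1)]]) simp
    ultimately have "refl n \<in> U1" using U3(2) by (meson subsetD)
    moreover have "B n n = - 1" using Lam_B[OF Lam_inv[OF gL]] ff by (simp add: n_def)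
    moreover have "B n m = - 1 / 2"
      using Lam_adj[OF Lam_inv[OF gL], of f m] Lam_inv_inv[OF gL] Bf f(3) by (simp add: n_def)
    ultimately show False using no[of n] by (simp add: power2_eq_square)
  qed
  \<comment> \<open>\<open>u\<close> is rescaled so that its inner product with \<open>g m\<close>
    becomes \<open>1/2\<close>; its norm is then \<open>1 / (2 * norm u)\<close>, at most
    \<open>1\<close>, and \<open>f'\<close>, orthogonal to \<open>u\<close>, \<open>g m\<close> and
    the first \<open>N\<close> basis vectors, fills it up to norm \<open>1\<close>.\<close>
  have small: False if g: "g \<in> V" and u: "u \<bullet> e 0 = 0" "u \<bullet> g m = (norm u)\<^sup>2" "norm u \<ge> 1 / 2"
    "\<And>i. i < N \<Longrightarrow> \<bar>u \<bullet> e i\<bar> < \<delta> * (norm u)\<^sup>2" for g u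
  proof -
    obtain f' where f': "f' \<in> coord {N..}" "norm f' = 1" "f' \<bullet> u = 0" "f' \<bullet> g m = 0"
    proof (rule orth_vector_exists[of "{N..}" "{u, g m}"])
    qed (use infinite_Ici in auto)
    have u0: "norm u > 0" using u(3) by linarith
    define s where "s = 1 - 1 / (4 * (norm u)\<^sup>2)"
    have "(1 / 2)\<^sup>2 \<le> (norm u)\<^sup>2" using u(3) by (intro power_mono) auto
    then have s: "s \<ge> 0" using u0 by (simp add: s_def field_simps power2_eq_square)
    define f where "f = (1 / (2 * (norm u)\<^sup>2)) *\<^sub>R u + sqrt s *\<^sub>R f'"
    have f'i: "f' \<bullet> e i = 0" if "i < N" for i using f'(1) that by (simp add: coord_def)
    have "f \<bullet> f = (1 / (2 * (norm u)\<^sup>2))\<^sup>2 * (norm u)\<^sup>2 + s"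
    proof -
      have "u \<bullet> f' = 0" "f' \<bullet> f' = 1" "u \<bullet> u = norm u * norm u"
        using f' by (auto simp: inner_commute dot_square_norm power2_eq_square)
      then show ?thesis
        using f'(3) s by (simp add: f_def inner_add_left inner_add_right power2_eq_square)
    qed
    also have "\<dots> = 1" using u0 by (simp add: s_def field_simps power2_eq_square)
    finally have "norm f = 1" by (simp add: norm_eq_sqrt_inner)
    moreover have "f \<bullet> e 0 = 0" using u(1) f'i[of 0] by (simp add: f_def inner_add_left N_def)
    moreover have "f \<bullet> g m = 1 / 2" using u(2) f'(4) u0 by (simp add: f_def inner_add_left)
    moreover have "\<bar>f \<bullet> e i\<bar> < \<delta> / 2" if "i < N" for i
    proof -
      have "\<bar>f \<bullet> e i\<bar> = \<bar>u \<bullet> e i\<bar> / (2 * (norm u)\<^sup>2)" using f'i[OF that] by (simp add: f_def inner_add_left)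
      also have "\<dots> < \<delta> * (norm u)\<^sup>2 / (2 * (norm u)\<^sup>2)"
        using u(4)[OF that] u0 by (intro divide_strict_right_mono) auto
      also have "\<dots> = \<delta> / 2" using u0 by simp
      finally show ?thesis .
    qed
    ultimately show False using avoid[OF g] by blast
  qed
  \<comment> \<open>Beyond \<open>1 / \<delta>\<close> the coordinates of \<open>u\<close>, bounded
    by \<open>norm u\<close>, are below \<open>\<delta> * (norm u)\<^sup>2\<close>; beyond
    \<open>1 / 2\<close> the rescaling is admissible. For the tail the first \<open>N\<close>
    coordinates vanish, and only the second threshold counts.\<close>
  define \<rho> where "\<rho> = max (1 / \<delta>) (1 / 2)"
  have "norm (proj {N..} (g m)) \<le> 1 / 2 \<and> norm (g m) \<le> 2 * (\<rho> + 1 / 2)" if g: "g \<in> V" for g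
  proof -
    define x where "x = g m"
    have tail: "norm (proj {N..} x) \<le> 1 / 2"
    proof (rule ccontr)
      assume "\<not> ?thesis"
      then have "norm (proj {N..} x) \<ge> 1 / 2" "norm (proj {N..} x) > 0" by auto
      then show False
        using small[OF g, of "proj {N..} x"] \<delta>(1) proj_inner_self
        by (auto simp: proj_inner_e x_def N_def)
    qed
    have head: "norm (proj {1..<N} x) \<le> \<rho>"
    proof (rule ccontr)
      let ?u = "proj {1..<N} x"
      assume "\<not> ?thesis"
      then have u: "norm ?u > 1 / \<delta>" "norm ?u \<ge> 1 / 2" by (auto simp: \<rho>_def)
      have "\<bar>?u \<bullet> e i\<bar> < \<delta> * (norm ?u)\<^sup>2" for i
      proof -
        have "1 < \<delta> * norm ?u" using u(1) \<delta>(1) by (simp add: field_simps)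
        then have "1 * norm ?u < \<delta> * norm ?u * norm ?u" using u(2) by (intro mult_strict_right_mono) auto
        then show ?thesis using abs_inner_e[of ?u i] by (simp add: power2_eq_square)
      qed
      note bd = this
      have "?u \<bullet> e 0 = 0" by (simp add: proj_inner_e)
      moreover have "?u \<bullet> g m = (norm ?u)\<^sup>2" using proj_inner_self[of "{1..<N}" x] by (simp add: x_def)
      ultimately show False using small[OF g, of ?u] u(2) bd by blast
    qed
    have "x - (x \<bullet> e 0) *\<^sub>R e 0 = proj {1..<N} x + proj {N..} x"
    proof (rule e_eqI)
      show "(x - (x \<bullet> e 0) *\<^sub>R e 0) \<bullet> e i = (proj {1..<N} x + proj {N..} x) \<bullet> e i" for i
        by (cases "i = 0") (auto simp: proj_inner_e inner_diff_left inner_add_left e_inner N_def)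
    qed
    then have le: "norm (x - (x \<bullet> e 0) *\<^sub>R e 0) \<le> \<rho> + 1 / 2"
      using norm_triangle_ineq[of "proj {1..<N} x" "proj {N..} x"] tail head by simp
    have gL: "g \<in> Lam" using g V(1) V_Lam by blast
    have "B x x = - 1" using Lam_B[OF gL] m by (simp add: x_def)
    then have "(norm x)\<^sup>2 \<le> 2 * (norm (x - (x \<bullet> e 0) *\<^sub>R e 0))\<^sup>2"
      using perp_norm2[of x] norm2_eq[of x] by simp
    also have "\<dots> \<le> 2 * (\<rho> + 1 / 2)\<^sup>2" using le by (intro mult_left_mono power_mono) auto
    also have "\<dots> \<le> (2 * (\<rho> + 1 / 2))\<^sup>2" unfolding power_mult_distrib by simp
    finally have "norm x \<le> 2 * (\<rho> + 1 / 2)"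
      by (rule power2_le_imp_le) (simp add: \<rho>_def)
    then show ?thesis using tail by (simp add: x_def)
  qed
  then show ?thesis using V(1) by blast
qed

text \<open>The base point is a small multiple of the difference of two unit spacelike vectors, so that the
  fixed bound \<open>1/2\<close> for these becomes arbitrarily small.\<close>

lemma base_orbit_tail_small:
  assumes \<eta>: "\<eta> > 0"
  shows "\<exists>V\<in>\<V>. \<exists>N R. \<forall>g\<in>V. norm (proj {N..} (g (e 0))) \<le> \<eta> \<and> norm (g (e 0)) \<le> R"
proof -
  define s where "s = 1 / (2 * \<eta>)"
  have s: "s > 0" using \<eta> by (simp add: s_def)
  \<comment> \<open>For the signs \<open>1\<close> and \<open>-1\<close> the difference of these
    unit spacelike vectors is \<open>2 * s\<close> times \<open>e 0\<close>, that is
    \<open>e 0\<close> divided by \<open>\<eta>\<close>.\<close>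
  define m where "m \<sigma> = sqrt (1 + s\<^sup>2) *\<^sub>R e 1 + (\<sigma> * s) *\<^sub>R e 0" for \<sigma>
  have mm: "B (m \<sigma>) (m \<sigma>) = - 1" if "\<sigma> * \<sigma> = 1" for \<sigma>
    using that by (simp add: m_def B_simps B_ee power2_eq_square algebra_simps)
  obtain V1 N1 R1 where V1: "V1 \<in> \<V>"
    "\<And>g. g \<in> V1 \<Longrightarrow> norm (proj {N1..} (g (m 1))) \<le> 1 / 2 \<and> norm (g (m 1)) \<le> R1"
    using orbit_tail_bounded[OF mm[of 1]] by auto
  obtain V2 N2 R2 where V2: "V2 \<in> \<V>"
    "\<And>g. g \<in> V2 \<Longrightarrow> norm (proj {N2..} (g (m (- 1)))) \<le> 1 / 2 \<and> norm (g (m (- 1))) \<le> R2"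
    using orbit_tail_bounded[OF mm[of "- 1"]] by auto
  obtain V where V: "V \<in> \<V>" "V \<subseteq> V1 \<inter> V2" using V_int[OF V1(1) V2(1)] by blast
  have "norm (proj {max N1 N2..} (g (e 0))) \<le> \<eta> \<and> norm (g (e 0)) \<le> \<eta> * (R1 + R2)" if g: "g \<in> V" for g
  proof -
    have gl: "linear g" using g V V_Lam Lam_linear by blast
    have "e 0 = \<eta> *\<^sub>R (m 1 - m (- 1))" using \<eta> by (simp add: m_def s_def scaleR_add_left[symmetric])
    then have ge: "g (e 0) = \<eta> *\<^sub>R (g (m 1) - g (m (- 1)))"
      by (metis linear_diff[OF gl] linear_scale[OF gl])
    have p: "norm (proj {max N1 N2..} (g (m 1))) \<le> 1 / 2" "norm (proj {max N1 N2..} (g (m (- 1)))) \<le> 1 / 2"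
      using V1(2)[of g] V2(2)[of g] g V(2) proj_norm[of "{max N1 N2..}" "proj {N1..} (g (m 1))"]
        proj_norm[of "{max N1 N2..}" "proj {N2..} (g (m (- 1)))"]
      by (auto simp: proj_proj)
    have "norm (proj {max N1 N2..} (g (e 0))) \<le> \<eta> * (1 / 2 + 1 / 2)"
      unfolding ge proj_scale proj_diff norm_scaleR
      using \<eta> p norm_triangle_ineq4[of "proj {max N1 N2..} (g (m 1))" "proj {max N1 N2..} (g (m (- 1)))"]
      by (auto intro!: mult_left_mono)
    moreover have "norm (g (e 0)) \<le> \<eta> * (R1 + R2)"
      unfolding ge norm_scaleR
    proof -
      have "norm (g (m 1)) \<le> R1" "norm (g (m (- 1))) \<le> R2" using V1(2) V2(2) g V(2) by auto
      then have "norm (g (m 1) - g (m (- 1))) \<le> R1 + R2"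
        using norm_triangle_ineq4[of "g (m 1)" "g (m (- 1))"] by linarith
      then show "\<bar>\<eta>\<bar> * norm (g (m 1) - g (m (- 1))) \<le> \<eta> * (R1 + R2)"
        using \<eta> by (simp add: mult_left_mono)
    qed
    ultimately show ?thesis by simp
  qed
  then show ?thesis using V(1) by blast
qed

text \<open>If \<open>z = g (e 0)\<close> is near \<open>y\<close>, automatic continuity makes
  \<open>sig y \<circ> sig z\<close> small, and \<open>sig z \<circ> sig (e 0)\<close> is the
  commutator of \<open>g\<close> and \<open>sig (e 0)\<close>, small with \<open>g\<close>. Their
  product is the fixed map \<open>sig y \<circ> sig (e 0)\<close>, which differs from the
  identity.\<close>

lemma base_orbit_avoids:
  assumes y: "y \<in> Hs" "y \<noteq> e 0"
  shows "\<exists>V\<in>\<V>. \<exists>r>0. \<forall>g\<in>V. norm (g (e 0) - y) \<ge> r"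
proof -
  have yL: "sig y \<in> Lam" "sig (e 0) \<in> Lam" using sig_Lam y(1) e0_Hs by auto
  have inv0: "inv (sig (e 0)) = sig (e 0)" using sig_sig[OF e0_Hs] by (intro inv_unique_comp) auto
  have "sig y \<circ> sig (e 0) \<noteq> id"
  proof
    assume "sig y \<circ> sig (e 0) = id"
    then have "sig y (sig (e 0) y) = y" by (metis comp_apply id_apply)
    then have "sig (e 0) y = sig y y" using sig_sig[OF y(1)] by metis
    moreover have "sig y y = y" using y(1) by (simp add: sig_def Hs_iff scaleR_2)
    ultimately have "(2 * (y \<bullet> e 0)) *\<^sub>R e 0 - y = y" by (simp add: sig_def B_e0)
    then have "2 *\<^sub>R y = 2 *\<^sub>R ((y \<bullet> e 0) *\<^sub>R e 0)" by (simp add: scaleR_2 algebra_simps)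
    then have "y = (y \<bullet> e 0) *\<^sub>R e 0" by (simp only: scaleR_cancel_left) simp
    then obtain a where a: "y = a *\<^sub>R e 0" by blast
    have "a * a = 1" "a > 0" using y(1) by (auto simp: Hs_iff a B_simps B_ee e_inner)
    then have "a = 1" by (simp add: square_eq_1_iff)
    then show False using a y(2) by simp
  qed
  then obtain U where U: "U \<in> \<V>" "sig y \<circ> sig (e 0) \<notin> U" using V_sep[OF Lam_comp[OF yL]] by blast
  obtain U1 where U1: "U1 \<in> \<V>" "pw U1 (2 ^ 2) \<subseteq> U" using V_pw[OF U(1)] by blast
  obtain F r where F: "finite F" "r > 0"
    "\<And>h. h \<in> Lam \<Longrightarrow> (\<And>v. v \<in> F \<Longrightarrow> norm (h v - v) < r) \<Longrightarrow> h \<in> U1"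
    using automatic_continuity[OF U1(1)] by metis
  have "\<forall>v\<in>F. \<forall>\<^sub>F z in nhds y. norm (sig y (sig z v) - v) < r"
  proof
    fix v
    have "isCont (\<lambda>z. norm (sig y (sig z v) - v)) y"
      unfolding sig_def B_def by (intro continuous_intros)
    then have "((\<lambda>z. norm (sig y (sig z v) - v)) \<longlongrightarrow> norm (sig y (sig y v) - v)) (nhds y)"
      unfolding isCont_def
      by (rule tendsto_at_iff_tendsto_nhds[where g = "\<lambda>z. norm (sig y (sig z v) - v)", THEN iffD1])
    then show "\<forall>\<^sub>F z in nhds y. norm (sig y (sig z v) - v) < r"
      using F(2) by (simp add: sig_sig[OF y(1)] order_tendstoD(2))
  qed
  then have "\<forall>\<^sub>F z in nhds y. \<forall>v\<in>F. norm (sig y (sig z v) - v) < r"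
    using F(1) by (simp add: eventually_ball_finite)
  then obtain d where d: "d > 0" "\<And>z v. dist z y < d \<Longrightarrow> v \<in> F \<Longrightarrow> norm (sig y (sig z v) - v) < r"
    unfolding eventually_nhds_metric by blast
  obtain V1 where V1: "V1 \<in> \<V>" "\<forall>a\<in>V1. sig (e 0) \<circ> a \<circ> inv (sig (e 0)) \<in> U1"
    using V_conj[OF U1(1) yL(2)] by blast
  obtain V2 where V2: "V2 \<in> \<V>" "V2 \<subseteq> U1 \<inter> V1" using V_int[OF U1(1) V1(1)] by blast
  obtain V3 where V3: "V3 \<in> \<V>" "\<And>a. a \<in> V3 \<Longrightarrow> a \<in> V2 \<and> inv a \<in> V2" using V_inv_both[OF V2(1)] by blast
  have "norm (g (e 0) - y) \<ge> d" if g: "g \<in> V3" for g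
  proof (rule ccontr)
    assume "\<not> ?thesis"
    then have near: "dist (g (e 0)) y < d" by (simp add: dist_norm)
    have gL: "g \<in> Lam" using g V3(1) V_Lam by blast
    define z where "z = g (e 0)"
    have zH: "z \<in> Hs" using gL Lam_e0_Hs by (simp add: z_def)
    have "sig y \<circ> sig z \<in> U1"
      by (rule F(3)[OF Lam_comp[OF yL(1) sig_Lam[OF zH]]]) (use d(2) near in \<open>auto simp: z_def\<close>)
    moreover have "g \<in> U1" "sig (e 0) \<circ> inv g \<circ> sig (e 0) \<in> U1"
      using V3(2)[OF g] V2(2) V1(2) inv0 by auto
    ultimately have "(sig y \<circ> sig z) \<circ> g \<circ> (sig (e 0) \<circ> inv g \<circ> sig (e 0)) \<in> pw U1 (1 + 1 + 1)"
      by (intro pw_add) (simp_all add: pw_one)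
    moreover have "(sig y \<circ> sig z) \<circ> g \<circ> (sig (e 0) \<circ> inv g \<circ> sig (e 0)) = sig y \<circ> sig (e 0)"
      using sig_conj[OF gL, of "e 0"] sig_sig[OF zH] by (auto simp: fun_eq_iff z_def)
    ultimately have "sig y \<circ> sig (e 0) \<in> pw U1 (1 + 1 + 1)" by metis
    moreover have "pw U1 (1 + 1 + 1) \<subseteq> pw U1 (2 ^ 2)" by (rule pw_mono[OF V_id[OF U1(1)]]) simp
    ultimately have "sig y \<circ> sig (e 0) \<in> U" using U1(2) by (meson subsetD)
    then show False using U(2) by simp
  qed
  then show ?thesis using V3(1) d(1) by blast
qed

lemma base_orbit_converges:
  assumes r: "r > 0"
  shows "\<exists>V\<in>\<V>. \<forall>g\<in>V. norm (g (e 0) - e 0) < r"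
proof (rule ccontr)
  assume "\<not> ?thesis"
  then have far: "\<And>V. V \<in> \<V> \<Longrightarrow> \<exists>g\<in>V. norm (g (e 0) - e 0) \<ge> r" by (meson linorder_not_less)
  \<comment> \<open>Only the far part of the orbit is kept, so a cluster point cannot be
    \<open>e 0\<close>.\<close>
  define S where "S V = {g (e 0) | g. g \<in> V \<and> norm (g (e 0) - e 0) \<ge> r}" for V
  have ne: "S ` \<V> \<noteq> {}" using orbit_tail_bounded[of "e 1"] by (auto simp: B_ee)
  have dir: "\<exists>C\<in>S ` \<V>. C \<subseteq> A \<inter> A'" if "A \<in> S ` \<V>" "A' \<in> S ` \<V>" for A A'
  proof -
    obtain V V' where V: "V \<in> \<V>" "V' \<in> \<V>" "A = S V" "A' = S V'" using \<open>A \<in> S ` \<V>\<close> \<open>A' \<in> S ` \<V>\<close> by blast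
    obtain V'' where "V'' \<in> \<V>" "V'' \<subseteq> V \<inter> V'" using V_int V by blast
    moreover have "S V'' \<subseteq> A \<inter> A'" using calculation by (auto simp: V S_def)
    ultimately show ?thesis by blast
  qed
  have tb: "\<exists>A\<in>S ` \<V>. \<exists>K. finite K \<and> A \<subseteq> (\<Union>k\<in>K. ball k \<eta>)" if \<eta>: "\<eta> > 0" for \<eta> :: real
  proof -
    obtain V N R where V: "V \<in> \<V>"
      "\<And>g. g \<in> V \<Longrightarrow> norm (proj {N..} (g (e 0))) \<le> \<eta> / 2 \<and> norm (g (e 0)) \<le> R"
      using base_orbit_tail_small[of "\<eta> / 2"] \<eta> by auto
    \<comment> \<open>The box of bounded coefficients in the first \<open>n\<close> basis
      directions; an orbit point lies within \<open>\<eta> / 2\<close> of such a box.\<close>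
    have "compact {x. \<exists>t. (\<forall>i<n. \<bar>t i\<bar> \<le> R) \<and> x = (\<Sum>i<n. t i *\<^sub>R e i)}" (is "compact (?C n)") for n
    proof (induction n)
      case (Suc n)
      have "?C (Suc n) = {x + y | x y. x \<in> ?C n \<and> y \<in> (\<lambda>t. t *\<^sub>R e n) ` {-R..R}}"
      proof (intro equalityI subsetI)
        fix x assume "x \<in> ?C (Suc n)"
        then obtain t where t: "\<forall>i<Suc n. \<bar>t i\<bar> \<le> R" "x = (\<Sum>i<Suc n. t i *\<^sub>R e i)" by blast
        have "t n \<in> {-R..R}" using t(1) by (auto simp: abs_le_iff)
        moreover have "(\<Sum>i<n. t i *\<^sub>R e i) \<in> ?C n" using t(1) by (intro CollectI exI[of _ t]) auto
        moreover have "x = (\<Sum>i<n. t i *\<^sub>R e i) + t n *\<^sub>R e n" using t(2) by simp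
        ultimately show "x \<in> {x + y | x y. x \<in> ?C n \<and> y \<in> (\<lambda>t. t *\<^sub>R e n) ` {-R..R}}" by blast
      next
        fix x assume "x \<in> {x + y | x y. x \<in> ?C n \<and> y \<in> (\<lambda>t. t *\<^sub>R e n) ` {-R..R}}"
        then obtain t s where ts: "\<forall>i<n. \<bar>t i\<bar> \<le> R" "s \<in> {-R..R}"
          "x = (\<Sum>i<n. t i *\<^sub>R e i) + s *\<^sub>R e n" by blast
        have "x = (\<Sum>i<Suc n. (t(n := s)) i *\<^sub>R e i)" using ts(3) by simp
        moreover have "\<forall>i<Suc n. \<bar>(t(n := s)) i\<bar> \<le> R" using ts by (auto simp: less_Suc_eq)
        ultimately show "x \<in> ?C (Suc n)" by blast
      qed
      moreover have "compact ((\<lambda>t. t *\<^sub>R e n) ` {-R..R})"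
        by (intro compact_continuous_image continuous_intros) simp
      ultimately show ?case using compact_sums[OF Suc.IH] by simp
    qed simp
    then obtain K where K: "finite K" "?C N \<subseteq> (\<Union>k\<in>K. ball k (\<eta> / 2))"
      using compactE_image[of "?C N" UNIV "\<lambda>k. ball k (\<eta> / 2)"] \<eta> by (metis (no_types, lifting) UNIV_I UN_I centre_in_ball half_gt_zero open_ball subsetI)
    have "S V \<subseteq> (\<Union>k\<in>K. ball k \<eta>)"
    proof
      fix x assume "x \<in> S V"
      then have x: "norm (proj {N..} x) \<le> \<eta> / 2" "norm x \<le> R" using V(2) by (auto simp: S_def)
      have "x - proj {N..} x = (\<Sum>i<N. (x \<bullet> e i) *\<^sub>R e i)"
        by (rule e_eqI) (auto simp: proj_inner_e inner_diff_left inner_sum_left e_inner if_distrib cong: if_cong)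
      moreover have "\<bar>x \<bullet> e i\<bar> \<le> R" for i using order_trans[OF abs_inner_e x(2)] .
      ultimately have "x - proj {N..} x \<in> ?C N" by (intro CollectI exI[of _ "\<lambda>i. x \<bullet> e i"]) simp
      then have "x - proj {N..} x \<in> (\<Union>k\<in>K. ball k (\<eta> / 2))" using K(2) by (rule subsetD[rotated])
      then obtain k where k: "k \<in> K" "dist k (x - proj {N..} x) < \<eta> / 2" by (metis UN_E mem_ball)
      have "dist k x < \<eta>"
        using dist_triangle[of k x "x - proj {N..} x"] k(2) x(1) by (simp add: dist_norm)
      then show "x \<in> (\<Union>k\<in>K. ball k \<eta>)" using k(1) by auto
    qed
    then show ?thesis using V(1) K(1) by blast
  qed
  have Sne: "A \<noteq> {}" if "A \<in> S ` \<V>" for A using far that by (auto simp: S_def)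
  obtain y where y: "\<And>A. A \<in> S ` \<V> \<Longrightarrow> y \<in> closure A"
    using cluster_point_exists[OF ne Sne dir tb] by blast
  obtain V0 where V0: "V0 \<in> \<V>" using ne by blast
  have "y \<in> Hs"
  proof -
    \<comment> \<open>On \<open>Hs\<close> positivity of the 0-th coordinate amounts to
      \<open>\<ge> 1\<close>, and in that form it passes to limits.\<close>
    have "closed {x. B x x = 1 \<and> x \<bullet> e 0 \<ge> 1}"
      unfolding B_def by (intro closed_Collect_conj closed_Collect_eq closed_Collect_le continuous_intros)
    moreover have "S V0 \<subseteq> {x. B x x = 1 \<and> x \<bullet> e 0 \<ge> 1}"
    proof
      fix x assume "x \<in> S V0"
      then have "x \<in> Hs" using V_Lam[OF V0] Lam_e0_Hs by (auto simp: S_def)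
      then show "x \<in> {x. B x x = 1 \<and> x \<bullet> e 0 \<ge> 1}" using Hs_ge1[of x] by (simp add: Hs_iff)
    qed
    ultimately have "y \<in> {x. B x x = 1 \<and> x \<bullet> e 0 \<ge> 1}"
      using y V0 closure_minimal by blast
    then show ?thesis by (simp add: Hs_iff)
  qed
  moreover have "y \<noteq> e 0"
  proof
    assume "y = e 0"
    then obtain x where "x \<in> S V0" "dist x (e 0) < r"
      using y[of "S V0"] V0 r unfolding closure_approachable by blast
    then show False by (auto simp: S_def dist_norm)
  qed
  ultimately obtain V d where V: "V \<in> \<V>" "d > 0" "\<forall>g\<in>V. norm (g (e 0) - y) \<ge> d"
    using base_orbit_avoids by blast
  obtain x where "x \<in> S V" "dist x y < d"
    using y[of "S V"] V unfolding closure_approachable by blast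
  then show False using V(3) by (auto simp: S_def dist_norm)
qed

text \<open>Conjugation by an isometry exchanging \<open>e 0\<close> and \<open>x\<close> reduces
  this to the base point.\<close>

lemma orbit_converges:
  assumes x: "x \<in> Hs" and r: "r > 0"
  shows "\<exists>V\<in>\<V>. \<forall>g\<in>V. norm (g x - x) < r"
proof -
  obtain s where s: "s \<in> Lam" "s (e 0) = x" "s x = e 0" "\<And>z. s (s z) = z" "inv s = s"
    using Hs_trans[OF e0_Hs x] by metis
  define K where "K = 5 * (norm (s (e 0)) + 1)"
  have K: "K > 0" by (simp add: K_def add_nonneg_pos)
  obtain V where V: "V \<in> \<V>" "\<forall>g\<in>V. norm (g (e 0) - e 0) < r / K"
    using base_orbit_converges[of "r / K"] r K by auto
  obtain V' where V': "V' \<in> \<V>" "\<forall>a\<in>V'. s \<circ> a \<circ> inv s \<in> V" using V_conj[OF V(1) s(1)] by blast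
  have "norm (g x - x) < r" if "g \<in> V'" for g
  proof -
    have "norm (s (g (s (e 0))) - e 0) < r / K" using V(2) V'(2) that s(5) by fastforce
    moreover have "g x - x = s (s (g (s (e 0))) - e 0)"
      by (simp add: linear_diff[OF Lam_linear[OF s(1)]] s)
    then have "norm (g x - x) \<le> K * norm (s (g (s (e 0))) - e 0)"
      using Lam_bound[OF s(1)] by (simp add: K_def)
    moreover have "K * norm (s (g (s (e 0))) - e 0) < r"
      using \<open>norm (s (g (s (e 0))) - e 0) < r / K\<close> K by (simp add: field_simps)
    ultimately show ?thesis by linarith
  qed
  then show ?thesis using V'(1) by blast
qed

lemma near_identity:
  assumes r: "r > 0"
  shows "\<exists>V\<in>\<V>. \<forall>g\<in>V. \<forall>i<n. norm (g (e i) - e i) < r"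
proof (induction n)
  case 0
  then show ?case using orbit_converges[OF e0_Hs r] by blast
next
  case (Suc n)
  have "\<exists>V\<in>\<V>. \<forall>g\<in>V. norm (g (e n) - e n) < r"
  proof (cases "n = 0")
    case True
    then show ?thesis using orbit_converges[OF e0_Hs r] by simp
  next
    case False
    let ?x = "sqrt 2 *\<^sub>R e 0 + e n"
    obtain V1 where V1: "V1 \<in> \<V>" "\<forall>g\<in>V1. norm (g ?x - ?x) < r / 2"
      using orbit_converges[OF shifted_basis_Hs[OF False], of "r / 2"] r by auto
    obtain V2 where V2: "V2 \<in> \<V>" "\<forall>g\<in>V2. norm (g (e 0) - e 0) < r / 4"
      using orbit_converges[OF e0_Hs, of "r / 4"] r by auto
    obtain V where V: "V \<in> \<V>" "V \<subseteq> V1 \<inter> V2" using V_int[OF V1(1) V2(1)] by blast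
    have "norm (g (e n) - e n) < r" if g: "g \<in> V" for g
    proof -
      have gl: "linear g" using g V V_Lam Lam_linear by blast
      have "g (e n) - e n = (g ?x - ?x) - sqrt 2 *\<^sub>R (g (e 0) - e 0)"
        by (simp add: linear_add[OF gl] linear_scale[OF gl] algebra_simps)
      then have "norm (g (e n) - e n) \<le> norm (g ?x - ?x) + sqrt 2 * norm (g (e 0) - e 0)"
        using norm_triangle_ineq4[of "g ?x - ?x" "sqrt 2 *\<^sub>R (g (e 0) - e 0)"]
        by (simp only: norm_scaleR) simp
      also have "\<dots> \<le> norm (g ?x - ?x) + 2 * norm (g (e 0) - e 0)"
        using sqrt2_less_2 by (intro add_left_mono mult_right_mono) auto
      finally show ?thesis using V1(2) V2(2) V(2) g by fastforce
    qed
    then show ?thesis using V(1) by blast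
  qed
  then obtain V where V: "V \<in> \<V>" "\<forall>g\<in>V. norm (g (e n) - e n) < r" by blast
  obtain V' where V': "V' \<in> \<V>" "\<forall>g\<in>V'. \<forall>i<n. norm (g (e i) - e i) < r" using Suc.IH by blast
  obtain V'' where "V'' \<in> \<V>" "V'' \<subseteq> V \<inter> V'" using V_int[OF V(1) V'(1)] by blast
  then show ?case using V(2) V'(2) by (intro bexI[of _ V'']) (auto simp: less_Suc_eq)
qed

end

section \<open>The isometry group of hyperbolic space\<close>

lemma group_topology_translate_open:
  assumes T: "group_topology G T" and g: "g \<in> carrier G" and U: "openin T U"
  shows "openin T {h \<in> carrier G. g \<otimes>\<^bsub>G\<^esub> h \<in> U}"
proof -
  have "continuous_map T (prod_topology T T) (\<lambda>h. (g, h))"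
    using T g by (intro continuous_map_pairedI) (auto simp: group_topology_def)
  moreover have "continuous_map (prod_topology T T) T (\<lambda>(g, h). g \<otimes>\<^bsub>G\<^esub> h)"
    using T by (simp add: group_topology_def)
  ultimately have "continuous_map T T ((\<lambda>(g, h). g \<otimes>\<^bsub>G\<^esub> h) \<circ> (\<lambda>h. (g, h)))"
    by (rule continuous_map_compose)
  from openin_continuous_map_preimage[OF this U] T show ?thesis
    by (simp add: group_topology_def)
qed

lemma group_topology_coarser:
  fixes G (structure)
  assumes S: "group_topology G S" and T: "group_topology G T"
    and nb: "\<And>U. openin S U \<Longrightarrow> \<one>\<^bsub>G\<^esub> \<in> U \<Longrightarrow> \<exists>N. openin T N \<and> \<one>\<^bsub>G\<^esub> \<in> N \<and> N \<subseteq> U"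
    and U: "openin S U"
  shows "openin T U"
proof -
  interpret group G using S by (simp add: group_topology_def)
  have UG: "U \<subseteq> carrier G" using openin_subset[OF U] S by (simp add: group_topology_def)
  show ?thesis
  proof (subst openin_subopen, intro ballI)
    fix f assume f: "f \<in> U"
    then have fG: "f \<in> carrier G" using UG by blast
    obtain N where N: "openin T N" "\<one> \<in> N" "N \<subseteq> {h \<in> carrier G. f \<otimes> h \<in> U}"
      using nb[OF group_topology_translate_open[OF S fG U]] f fG by auto
    let ?M = "{h \<in> carrier G. m_inv G f \<otimes> h \<in> N}"
    have "openin T ?M" by (rule group_topology_translate_open[OF T _ N(1)]) (simp add: fG)
    moreover have "f \<in> ?M" using fG N(2) by simp
    moreover have "?M \<subseteq> U"
    proof
      fix h assume h: "h \<in> ?M"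
      then have "f \<otimes> (m_inv G f \<otimes> h) \<in> U" using N(3) by blast
      then show "h \<in> U" using h fG by (simp add: m_assoc[symmetric])
    qed
    ultimately show "\<exists>M. openin T M \<and> f \<in> M \<and> M \<subseteq> U" by blast
  qed
qed

lemma openin_eqI: "(\<And>U. openin S U \<Longrightarrow> openin T U) \<Longrightarrow> (\<And>U. openin T U \<Longrightarrow> openin S U) \<Longrightarrow> S = T"
  by (auto simp: topology_eq)

context hyp begin

lemma hyperbolic_dist_eq: "x \<in> Hs \<Longrightarrow> y \<in> Hs \<Longrightarrow> hyperbolic_dist e x y = arcosh (B x y)"
  by (simp add: hyperbolic_dist_def lorentz_form_eq)

lemma arcosh_le_cosh: "1 \<le> c \<Longrightarrow> 0 \<le> s \<Longrightarrow> c \<le> cosh s \<Longrightarrow> arcosh c \<le> (s::real)"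
  by (metis arcosh_cosh_real arcosh_less_iff_real cosh_real_ge_1 linorder_not_less)

lemma Metric_space_hyperbolic: "Metric_space Hs (hyperbolic_dist e)"
proof
  show "0 \<le> hyperbolic_dist e x y" for x y
  proof (cases "x \<in> Hs \<and> y \<in> Hs")
    case True
    then show ?thesis using B_ge_1[of x y] by (simp add: hyperbolic_dist_eq)
  qed (auto simp: hyperbolic_dist_def)
  show "hyperbolic_dist e x y = hyperbolic_dist e y x" for x y
    using B_sym[of x y] by (auto simp: lorentz_form_eq hyperbolic_dist_def)
  show "hyperbolic_dist e x y = 0 \<longleftrightarrow> x = y" if "x \<in> Hs" "y \<in> Hs" for x y
    using that Hs_eqI[OF that] B_ge_1[OF that] by (auto simp: hyperbolic_dist_eq Hs_iff)
  show "hyperbolic_dist e x z \<le> hyperbolic_dist e x y + hyperbolic_dist e y z"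
    if H: "x \<in> Hs" "y \<in> Hs" "z \<in> Hs" for x y z
  proof -
    \<comment> \<open>With the middle point moved to \<open>e 0\<close>, the upper bound of
      \<open>Hs_form_bounds\<close> is the addition theorem for \<open>cosh\<close>.\<close>
    obtain r where r: "r \<in> Lam" "r y = e 0" using Hs_trans[OF H(2) e0_Hs] by metis
    define a b where "a = r x \<bullet> e 0" and "b = r z \<bullet> e 0"
    have rH: "r x \<in> Hs" "r z \<in> Hs" using Lam_Hs r(1) H by auto
    have ab: "a \<ge> 1" "b \<ge> 1" using Hs_ge1 rH by (auto simp: a_def b_def)
    have xy: "B x y = a" "B y z = b"
      using Lam_B[OF r(1), of x y] Lam_B[OF r(1), of z y] by (auto simp: r(2) B_e0 a_def b_def B_sym[of y z])
    have "B x z \<le> cosh (arcosh a + arcosh b)"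
      using Hs_form_bounds(1)[OF rH] ab
      by (simp add: Lam_B[OF r(1)] cosh_add sinh_arcosh_real a_def b_def)
    then have "arcosh (B x z) \<le> arcosh a + arcosh b"
      using ab H B_ge_1 by (intro arcosh_le_cosh) auto
    then show ?thesis using H by (simp add: hyperbolic_dist_eq xy)
  qed
qed

text \<open>One inclusion is continuity of the form. For the other, the centre is moved to
  \<open>e 0\<close>, where the squared norm distance is \<open>2 * b * (b - 1)\<close> with
  \<open>b = B x y\<close>, and moved back at the cost of the factor \<open>K\<close>.\<close>

lemma hyperbolic_topology_eq: "hyperbolic_topology e = top_of_set Hs"
proof -
  interpret M: Metric_space Hs "hyperbolic_dist e" by (rule Metric_space_hyperbolic)
  have 1: "\<exists>s>0. \<forall>y\<in>Hs. dist x y < s \<longrightarrow> hyperbolic_dist e x y < r" if x: "x \<in> Hs" and r: "r > 0" for x r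
  proof -
    define s where "s = (cosh r - 1) / (3 * norm x + 1)"
    have "cosh r > 1" using r cosh_real_strict_mono[of 0 r] by simp
    moreover have den: "3 * norm x + 1 > 0" by (simp add: add_nonneg_pos)
    ultimately have s: "s > 0" by (simp add: s_def)
    have "hyperbolic_dist e x y < r" if y: "y \<in> Hs" "dist x y < s" for y
    proof -
      have "B x y - 1 = B x (y - x)" using x by (simp add: B_simps Hs_iff)
      also have "\<dots> \<le> (3 * norm x) * norm (y - x)" using B_bound[of x "y - x"] by simp
      also have "\<dots> \<le> (3 * norm x + 1) * norm (y - x)" by (simp add: mult_right_mono)
      also have "\<dots> < (3 * norm x + 1) * s"
        using y(2) den by (intro mult_strict_left_mono) (auto simp: dist_norm norm_minus_commute)
      also have "\<dots> = cosh r - 1" using den by (simp add: s_def)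
      finally have "B x y < cosh r" by simp
      then have "arcosh (B x y) < arcosh (cosh r)" using B_ge_1[OF x y(1)] by simp
      then show ?thesis using r x y by (simp add: hyperbolic_dist_eq arcosh_cosh_real)
    qed
    then show ?thesis using s by blast
  qed
  have 2: "\<exists>s>0. \<forall>y\<in>Hs. hyperbolic_dist e x y < s \<longrightarrow> dist x y < r" if x: "x \<in> Hs" and r: "r > 0" for x r
  proof -
    obtain p where p: "p \<in> Lam" "p x = e 0" "p (e 0) = x" "\<And>z. p (p z) = z" using Hs_trans[OF x e0_Hs] by metis
    define K where "K = 5 * (norm (p (e 0)) + 1)"
    have K: "K > 0" by (simp add: K_def add_nonneg_pos)
    \<comment> \<open>The bound \<open>\<eta> \<le> 1\<close> gives \<open>b \<le> 2\<close>, hence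
      \<open>2 * b * (b - 1) < 4 * \<eta>\<close>.\<close>
    define \<eta> where "\<eta> = min 1 ((r / K)\<^sup>2 / 4)"
    have \<eta>: "\<eta> > 0" "\<eta> \<le> 1" "\<eta> \<le> (r / K)\<^sup>2 / 4" using r K by (auto simp: \<eta>_def)
    have "dist x y < r" if y: "y \<in> Hs" "hyperbolic_dist e x y < arcosh (1 + \<eta>)" for y
    proof -
      define b where "b = B x y"
      have b: "1 \<le> b" "b < 1 + \<eta>" using y x \<eta> B_ge_1[OF x y(1)] by (auto simp: hyperbolic_dist_eq b_def)
      have pb: "p y \<bullet> e 0 = b"
        using Lam_B[OF p(1), of y x] by (simp add: p(2) B_e0 b_def B_sym[of x y])
      have "(norm (p y - e 0))\<^sup>2 = (norm (p y))\<^sup>2 - 2 * (p y \<bullet> e 0) + 1"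
        by (simp add: power2_norm_eq_inner inner_diff_left inner_diff_right inner_commute e_inner)
      also have "\<dots> = 2 * b * (b - 1)"
        using Hs_norm[OF Lam_Hs[OF p(1) y(1)]] by (simp add: pb power2_eq_square algebra_simps)
      also have "\<dots> < 4 * \<eta>"
      proof -
        have "2 * b * (b - 1) \<le> 4 * (b - 1)" using b \<eta> by (intro mult_right_mono) auto
        also have "\<dots> < 4 * \<eta>" using b(2) by simp
        finally show ?thesis .
      qed
      also have "\<dots> \<le> (r / K)\<^sup>2" using \<eta> by simp
      finally have "norm (p y - e 0) < r / K"
        by (rule power_less_imp_less_base) (use r K in simp)
      then have "K * norm (p y - e 0) < r" using K by (simp add: field_simps)
      moreover have "y - x = p (p y - e 0)" by (simp add: linear_diff[OF Lam_linear[OF p(1)]] p)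
      then have "norm (y - x) \<le> K * norm (p y - e 0)" using Lam_bound[OF p(1)] by (simp add: K_def)
      ultimately show ?thesis by (simp add: dist_norm norm_minus_commute)
    qed
    moreover have "arcosh (1 + \<eta>) > 0" using \<eta> by simp
    ultimately show ?thesis by blast
  qed
  show ?thesis
    unfolding hyperbolic_topology_def topology_eq
  proof (intro allI iffI)
    fix U assume "openin M.mtopology U"
    then have U: "U \<subseteq> Hs" "\<And>x. x \<in> U \<Longrightarrow> \<exists>r>0. M.mball x r \<subseteq> U" by (auto simp: M.openin_mtopology)
    have "\<exists>s>0. ball x s \<inter> Hs \<subseteq> U" if x: "x \<in> U" for x
    proof -
      obtain r where r: "r > 0" "M.mball x r \<subseteq> U" using U(2)[OF x] by blast
      have xH: "x \<in> Hs" using x U(1) by blast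
      obtain s where s: "s > 0" "\<forall>y\<in>Hs. dist x y < s \<longrightarrow> hyperbolic_dist e x y < r"
        using 1[OF xH r(1)] by blast
      have "ball x s \<inter> Hs \<subseteq> M.mball x r" using s(2) xH by (auto simp: M.in_mball)
      then show ?thesis using s(1) r(2) by blast
    qed
    then show "openin (top_of_set Hs) U" using U(1) by (auto simp: openin_contains_ball)
  next
    fix U assume "openin (top_of_set Hs) U"
    then have U: "U \<subseteq> Hs" "\<And>x. x \<in> U \<Longrightarrow> \<exists>r>0. ball x r \<inter> Hs \<subseteq> U" by (auto simp: openin_contains_ball)
    have "\<exists>s>0. M.mball x s \<subseteq> U" if x: "x \<in> U" for x
    proof -
      obtain r where r: "r > 0" "ball x r \<inter> Hs \<subseteq> U" using U(2)[OF x] by blast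
      have xH: "x \<in> Hs" using x U(1) by blast
      obtain s where s: "s > 0" "\<forall>y\<in>Hs. hyperbolic_dist e x y < s \<longrightarrow> dist x y < r"
        using 2[OF xH r(1)] by blast
      have "M.mball x s \<subseteq> ball x r \<inter> Hs" using s(2) xH by (auto simp: M.in_mball)
      then show ?thesis using s(1) r(2) by blast
    qed
    then show "openin M.mtopology U" using U(1) by (auto simp: M.openin_mtopology)
  qed
qed

section \<open>Isometries as restrictions of linear maps\<close>

definition rho :: "('a \<Rightarrow> 'a) \<Rightarrow> 'a \<Rightarrow> 'a" where
  "rho g = restrict g Hs"

lemma Lam_bij_Hs: assumes g: "g \<in> Lam" shows "bij_betw g Hs Hs"
  by (rule bij_betw_byWitness[where f' = "inv g"])
     (use Lam_Hs[OF g] Lam_Hs[OF Lam_inv[OF g]] Lam_inv_f[OF g] Lam_f_inv[OF g] in auto)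

lemma Isom_carrier_iff: "f \<in> carrier (Isom e) \<longleftrightarrow>
    f \<in> extensional Hs \<and> bij_betw f Hs Hs \<and> (\<forall>x\<in>Hs. \<forall>y\<in>Hs. hyperbolic_dist e (f x) (f y) = hyperbolic_dist e x y)"
  by (auto simp: Isom_def Bij_def)

lemma rho_carrier: assumes g: "g \<in> Lam" shows "rho g \<in> carrier (Isom e)"
proof -
  have "bij_betw (rho g) Hs Hs"
    using Lam_bij_Hs[OF g] by (rule bij_betw_cong[THEN iffD1, rotated]) (simp add: rho_def)
  then show ?thesis
    using Lam_Hs[OF g] by (simp add: Isom_carrier_iff) (simp add: rho_def hyperbolic_dist_eq Lam_B[OF g])
qed

lemma group_Isom: "group (Isom e)"
proof -
  let ?C = "{g \<in> Bij Hs. \<forall>x\<in>Hs. \<forall>y\<in>Hs. hyperbolic_dist e (g x) (g y) = hyperbolic_dist e x y}"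
  have "subgroup ?C (BijGroup Hs)"
  proof (rule subgroup.intro)
    show "?C \<subseteq> carrier (BijGroup Hs)" by (auto simp: BijGroup_def)
    show "x \<otimes>\<^bsub>BijGroup Hs\<^esub> y \<in> ?C" if "x \<in> ?C" "y \<in> ?C" for x y
    proof -
      have xy: "x \<in> Bij Hs" "y \<in> Bij Hs" using that by auto
      have yH: "y z \<in> Hs" if "z \<in> Hs" for z using Bij_imp_funcset[OF xy(2)] that by blast
      have "hyperbolic_dist e (compose Hs x y z) (compose Hs x y z') = hyperbolic_dist e z z'"
        if "z \<in> Hs" "z' \<in> Hs" for z z'
        using that yH \<open>x \<in> ?C\<close> \<open>y \<in> ?C\<close> by (simp add: compose_eq)
      then show ?thesis using compose_Bij[OF xy] xy by (simp add: BijGroup_def)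
    qed
    show "\<one>\<^bsub>BijGroup Hs\<^esub> \<in> ?C" by (simp add: BijGroup_def id_Bij)
    show "m_inv (BijGroup Hs) f \<in> ?C" if f: "f \<in> ?C" for f
    proof -
      have fB: "f \<in> Bij Hs" using f by simp
      have ff: "f (inv_into Hs f x) = x" "inv_into Hs f x \<in> Hs" if "x \<in> Hs" for x
        using that fB f_inv_into_f[of x f Hs] Bij_inv_into_mem[OF fB] by (auto simp: Bij_def bij_betw_def)
      have "hyperbolic_dist e (inv_into Hs f x) (inv_into Hs f y) = hyperbolic_dist e x y"
        if "x \<in> Hs" "y \<in> Hs" for x y
      proof -
        have "hyperbolic_dist e (f (inv_into Hs f x)) (f (inv_into Hs f y))
            = hyperbolic_dist e (inv_into Hs f x) (inv_into Hs f y)"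
          using f ff(2)[OF that(1)] ff(2)[OF that(2)] by blast
        then show ?thesis by (simp add: ff(1) that)
      qed
      then show ?thesis using restrict_inv_into_Bij[OF fB] by (simp add: inv_BijGroup[OF fB])
    qed
  qed
  then show ?thesis unfolding Isom_def by (rule subgroup.subgroup_is_group[OF _ group_BijGroup])
qed

lemma rho_mult: assumes "f \<in> Lam" "g \<in> Lam" shows "rho f \<otimes>\<^bsub>Isom e\<^esub> rho g = rho (f \<circ> g)"
proof -
  have "rho f \<in> Bij Hs" "rho g \<in> Bij Hs"
    using rho_carrier assms by (auto simp: Isom_carrier_iff Bij_def)
  then have "rho f \<otimes>\<^bsub>Isom e\<^esub> rho g = compose Hs (rho f) (rho g)" by (simp add: Isom_def BijGroup_def)
  also have "\<dots> = rho (f \<circ> g)" using Lam_Hs[OF assms(2)] by (auto simp: rho_def compose_def fun_eq_iff)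
  finally show ?thesis .
qed

lemma rho_one: "\<one>\<^bsub>Isom e\<^esub> = rho id"
  by (simp add: Isom_def BijGroup_def rho_def restrict_def id_def fun_eq_iff)

lemma rho_inv: assumes "g \<in> Lam" shows "m_inv (Isom e) (rho g) = rho (inv g)"
proof (rule group.inv_equality[OF group_Isom])
  have "inv g \<circ> g = id" using Lam_inv_f[OF assms] by auto
  then show "rho (inv g) \<otimes>\<^bsub>Isom e\<^esub> rho g = \<one>\<^bsub>Isom e\<^esub>"
    using rho_mult[OF Lam_inv[OF assms] assms] rho_one by simp
qed (use rho_carrier assms Lam_inv in auto)

text \<open>The timelike part of the unique point of \<open>Hs\<close> above a vector
  \<open>v\<close> orthogonal to \<open>e 0\<close>.\<close>

definition height :: "'a \<Rightarrow> 'a" where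
  "height v = sqrt (1 + (norm v)\<^sup>2) *\<^sub>R e 0"

lemma height_Hs: "v \<bullet> e 0 = 0 \<Longrightarrow> height v + v \<in> Hs"
proof -
  assume v: "v \<bullet> e 0 = 0"
  have "1 + (norm v)\<^sup>2 > 0" by (simp add: add_pos_nonneg)
  then show ?thesis using v
    by (simp add: Hs_iff height_def B_def inner_add_left inner_add_right e_inner inner_commute[of "e 0"]
        power2_norm_eq_inner mult.assoc)
qed

lemma Hs_height: assumes "x \<in> Hs" shows "height (x - (x \<bullet> e 0) *\<^sub>R e 0) = (x \<bullet> e 0) *\<^sub>R e 0"
  using perp_norm2[of x] assms by (simp add: height_def Hs_iff)

lemma Hs_span: "\<exists>x\<in>Hs. \<exists>c. v = x + c *\<^sub>R e 0"
proof -
  define p where "p = v - (v \<bullet> e 0) *\<^sub>R e 0"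
  have "p \<bullet> e 0 = 0" by (simp add: p_def inner_diff_left e_inner)
  moreover have "v = (height p + p) + (v \<bullet> e 0 - sqrt (1 + (norm p)\<^sup>2)) *\<^sub>R e 0"
    by (simp add: height_def p_def scaleR_diff_left)
  ultimately show ?thesis using height_Hs by blast
qed

text \<open>\<open>F\<close> preserves the 0-th coordinate and so induces a map
  \<open>\<phi>\<close> of the spatial vectors that preserves inner products. Surjectivity of the
  extension comes from that of \<open>F\<close>, since \<open>Hs\<close> and \<open>e 0\<close> span
  the space.\<close>

lemma isometry_fixing_base_linear:
  assumes F: "F ` Hs = Hs" "\<And>x y. x \<in> Hs \<Longrightarrow> y \<in> Hs \<Longrightarrow> B (F x) (F y) = B x y" "F (e 0) = e 0"
  shows "\<exists>G\<in>Lam. \<forall>x\<in>Hs. G x = F x"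
proof -
  have F0: "F x \<bullet> e 0 = x \<bullet> e 0" if "x \<in> Hs" for x
    using F(2)[OF that e0_Hs] by (simp add: F(3) B_e0)
  define p where "p x = x - (x \<bullet> e 0) *\<^sub>R e 0" for x
  define \<phi> where "\<phi> v = F (height v + v) - height v" for v
  define G where "G x = (x \<bullet> e 0) *\<^sub>R e 0 + \<phi> (p x)" for x
  have p0: "p x \<bullet> e 0 = 0" for x by (simp add: p_def inner_diff_left e_inner)
  have pl: "p (x + y) = p x + p y" "p (c *\<^sub>R x) = c *\<^sub>R p x" for x y c
    by (simp_all add: p_def inner_add_left algebra_simps)
  have \<phi>0: "\<phi> v \<bullet> e 0 = 0" if "v \<bullet> e 0 = 0" for v
    using F0[OF height_Hs[OF that]] that by (simp add: \<phi>_def inner_diff_left inner_add_left)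
  have \<phi>i: "\<phi> v \<bullet> \<phi> w = v \<bullet> w" if v: "v \<bullet> e 0 = 0" and w: "w \<bullet> e 0 = 0" for v w
  proof -
    have d: "B (height a + x) (height b + y) = B (height a) (height b) - x \<bullet> y"
      if "x \<bullet> e 0 = 0" "y \<bullet> e 0 = 0" for a b x y
      using that by (simp add: B_def height_def inner_add_left inner_add_right e_inner inner_commute[of "e 0"] algebra_simps)
    have "B (height v + \<phi> v) (height w + \<phi> w) = B (height v + v) (height w + w)"
      using F(2)[OF height_Hs[OF v] height_Hs[OF w]] by (simp add: \<phi>_def)
    then show ?thesis using d[OF \<phi>0[OF v] \<phi>0[OF w]] d[OF v w] by simp
  qed
  have "linear G"
  proof (rule linearI)
    fix x y :: 'a and c :: real
    have p0': "(p x + p y) \<bullet> e 0 = 0" "(c *\<^sub>R p x) \<bullet> e 0 = 0" by (simp_all add: p0 inner_add_left)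
    \<comment> \<open>Expanding the square leaves only inner products that \<open>\<phi>\<close>
      preserves, so it equals the corresponding square without \<open>\<phi>\<close>, which is
      zero.\<close>
    have "(\<phi> (p x + p y) - \<phi> (p x) - \<phi> (p y)) \<bullet> (\<phi> (p x + p y) - \<phi> (p x) - \<phi> (p y)) = 0"
      by (simp add: inner_diff_left inner_diff_right \<phi>i p0 p0' inner_add_left inner_add_right
          del: inner_eq_zero_iff)
    then have "\<phi> (p x + p y) = \<phi> (p x) + \<phi> (p y)"
      by (simp only: inner_eq_zero_iff) (simp add: algebra_simps)
    then show "G (x + y) = G x + G y" by (simp add: G_def pl inner_add_left algebra_simps)
    have "(\<phi> (c *\<^sub>R p x) - c *\<^sub>R \<phi> (p x)) \<bullet> (\<phi> (c *\<^sub>R p x) - c *\<^sub>R \<phi> (p x)) = 0"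
      by (simp add: inner_diff_left inner_diff_right \<phi>i p0 p0' del: inner_eq_zero_iff)
    then have "\<phi> (c *\<^sub>R p x) = c *\<^sub>R \<phi> (p x)" by (simp only: inner_eq_zero_iff) simp
    then show "G (c *\<^sub>R x) = c *\<^sub>R G x" by (simp add: G_def pl algebra_simps)
  qed
  have GB: "B (G x) (G y) = B x y" for x y
    unfolding form_decomp[of x y]
    by (simp add: G_def B_def inner_add_left inner_add_right \<phi>0[OF p0] inner_commute[of "e 0"] e_inner \<phi>i p0 p_def[symmetric])
  have GF: "G x = F x" if x: "x \<in> Hs" for x
    using Hs_height[OF x] by (simp add: G_def \<phi>_def p_def)
  have "inj G" by (rule injI, rule B_eqI') (metis GB)
  moreover have "surj G"
  proof (rule surjI)
    fix v
    obtain x c where xc: "x \<in> Hs" "v = x + c *\<^sub>R e 0" using Hs_span by blast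
    from xc(1) have "x \<in> F ` Hs" by (simp only: F(1))
    then obtain y where y: "x = F y" "y \<in> Hs" by (rule imageE)
    have "G (y + c *\<^sub>R e 0) = v"
      using linear_add[OF \<open>linear G\<close>] linear_scale[OF \<open>linear G\<close>] GF[OF y(2)] GF[OF e0_Hs] y xc F(3) by simp
    then show "G (SOME y. G y = v) = v" by (rule someI)
  qed
  moreover have "G (e 0) \<bullet> e 0 > 0" using GF[OF e0_Hs] F(3) by (simp add: e_inner)
  ultimately have "G \<in> Lam" using \<open>linear G\<close> GB by (simp add: Lam_def bij_def)
  then show ?thesis using GF by blast
qed

lemma Isom_eq_rho: assumes f: "f \<in> carrier (Isom e)" shows "\<exists>g\<in>Lam. f = rho g"
proof -
  have f1: "f \<in> extensional Hs" "f ` Hs = Hs" using f by (auto simp: Isom_carrier_iff bij_betw_def)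
  have fH: "f x \<in> Hs" if "x \<in> Hs" for x using f1(2) that by blast
  have fB: "B (f x) (f y) = B x y" if "x \<in> Hs" "y \<in> Hs" for x y
  proof -
    have "arcosh (B (f x) (f y)) = arcosh (B x y)"
      using f that fH by (auto simp: Isom_carrier_iff hyperbolic_dist_eq)
    then show ?thesis using B_ge_1 fH that cosh_arcosh_real by metis
  qed
  obtain r where r: "r \<in> Lam" "r (f (e 0)) = e 0" "\<And>z. r (r z) = z"
    using Hs_trans[OF fH[OF e0_Hs] e0_Hs] by metis
  have "(r \<circ> f) ` Hs = r ` (f ` Hs)" by (simp add: image_comp)
  then have "(r \<circ> f) ` Hs = Hs" using Lam_bij_Hs[OF r(1)] by (simp add: f1(2) bij_betw_def)
  then obtain G where G: "G \<in> Lam" "\<And>x. x \<in> Hs \<Longrightarrow> G x = r (f x)"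
    using isometry_fixing_base_linear[of "r \<circ> f"] fB Lam_B[OF r(1)] r(2) by auto
  have "f = rho (r \<circ> G)"
    using f1(1) G(2) r(3) by (auto simp: rho_def fun_eq_iff extensional_def)
  then show ?thesis using G r Lam_comp by blast
qed

lemma rho_inj: assumes "f \<in> Lam" "g \<in> Lam" "rho f = rho g" shows "f = g"
proof
  fix v
  have eq: "f x = g x" if "x \<in> Hs" for x using assms(3) that by (metis rho_def restrict_apply')
  obtain x c where "x \<in> Hs" "v = x + c *\<^sub>R e 0" using Hs_span by blast
  then show "f v = g v"
    using eq e0_Hs by (simp add: linear_add linear_scale Lam_linear assms)
qed

text \<open>The inverse of the isomorphism \<open>rho\<close> from \<open>Lam\<close> to the
  isometry group; topological questions are settled on the linear side through it.\<close>

definition lift :: "('a \<Rightarrow> 'a) \<Rightarrow> 'a \<Rightarrow> 'a" where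
  "lift f = (THE g. g \<in> Lam \<and> rho g = f)"

lemma lift_rho: "g \<in> Lam \<Longrightarrow> lift (rho g) = g"
  unfolding lift_def by (rule the_equality) (auto intro: rho_inj)

lemma lift_Lam: "f \<in> carrier (Isom e) \<Longrightarrow> lift f \<in> Lam"
  and rho_lift: "f \<in> carrier (Isom e) \<Longrightarrow> rho (lift f) = f"
  using Isom_eq_rho lift_rho by force+

lemma lift_mult: "f \<in> carrier (Isom e) \<Longrightarrow> g \<in> carrier (Isom e) \<Longrightarrow> lift (f \<otimes>\<^bsub>Isom e\<^esub> g) = lift f \<circ> lift g"
  using rho_mult lift_rho rho_lift lift_Lam Lam_comp by metis

lemma lift_inv: "f \<in> carrier (Isom e) \<Longrightarrow> lift (m_inv (Isom e) f) = inv (lift f)"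
  using rho_inv lift_rho rho_lift lift_Lam Lam_inv by metis

lemma lift_apply: "f \<in> carrier (Isom e) \<Longrightarrow> x \<in> Hs \<Longrightarrow> lift f x = f x"
  using rho_lift by (metis rho_def restrict_apply')

end

section \<open>The topology of pointwise convergence\<close>

lemma openin_ball_preimage:
  fixes u :: "'b \<Rightarrow> 'c::metric_space"
  assumes "continuous_map X euclidean u"
  shows "openin X {x \<in> topspace X. dist (u x) c < r}"
  using openin_continuous_map_preimage[OF assms, of "ball c r"] by (simp add: dist_commute)

lemma openin_all_less:
  assumes "\<And>i::nat. i < n \<Longrightarrow> openin X {x \<in> topspace X. P i x}"
  shows "openin X {x \<in> topspace X. \<forall>i<n. P i x}"
  using assms
proof (induction n)
  case (Suc n)
  have "{x \<in> topspace X. \<forall>i<Suc n. P i x} = {x \<in> topspace X. \<forall>i<n. P i x} \<inter> {x \<in> topspace X. P n x}"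
    by (auto simp: less_Suc_eq)
  then show ?case using Suc by (simp add: openin_Int)
qed simp

lemma continuous_map_euclidean_metricI:
  fixes u :: "'b \<Rightarrow> 'c::metric_space"
  assumes "\<And>x r. x \<in> topspace X \<Longrightarrow> r > 0 \<Longrightarrow> \<exists>U. openin X U \<and> x \<in> U \<and> (\<forall>y\<in>U. dist (u y) (u x) < r)"
  shows "continuous_map X euclidean u"
  using assms Met_TC.continuous_map_to_metric[of X u] by (simp add: dist_commute)

lemma second_countable_pullback:
  fixes f :: "'b \<Rightarrow> 'c::second_countable_topology"
  shows "second_countable (pullback_topology A f euclidean)"
proof -
  obtain \<B> :: "'c set set" where \<B>: "countable \<B>" "\<And>C. C \<in> \<B> \<Longrightarrow> open C"
    "\<And>S. open S \<Longrightarrow> \<exists>U. U \<subseteq> \<B> \<and> S = \<Union>U"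
    using univ_second_countable[where 'a = 'c] by metis
  show ?thesis
    unfolding second_countable_def
  proof (intro exI conjI allI impI ballI)
    show "countable ((\<lambda>C. f -` C \<inter> A) ` \<B>)" using \<B>(1) by simp
    show "openin (pullback_topology A f euclidean) V" if "V \<in> (\<lambda>C. f -` C \<inter> A) ` \<B>" for V
      using that \<B>(2) by (auto simp: openin_pullback_topology)
    fix U x assume "openin (pullback_topology A f euclidean) U \<and> x \<in> U"
    then obtain S where S: "open S" "U = f -` S \<inter> A" "x \<in> U" by (auto simp: openin_pullback_topology)
    then obtain C where "C \<in> \<B>" "f x \<in> C" "C \<subseteq> S" using \<B>(3)[OF S(1)] by auto
    then show "\<exists>V\<in>(\<lambda>C. f -` C \<inter> A) ` \<B>. x \<in> V \<and> V \<subseteq> U" using S by auto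
  qed
qed

lemma group_topology_continuous_mult:
  assumes T: "group_topology G T" and "continuous_map X T a" "continuous_map X T b"
  shows "continuous_map X T (\<lambda>x. a x \<otimes>\<^bsub>G\<^esub> b x)"
proof -
  have "continuous_map X (prod_topology T T) (\<lambda>x. (a x, b x))"
    using assms by (intro continuous_map_pairedI)
  moreover have "continuous_map (prod_topology T T) T (\<lambda>(g, h). g \<otimes>\<^bsub>G\<^esub> h)"
    using T by (simp add: group_topology_def)
  ultimately have "continuous_map X T ((\<lambda>(g, h). g \<otimes>\<^bsub>G\<^esub> h) \<circ> (\<lambda>x. (a x, b x)))"
    by (rule continuous_map_compose)
  then show ?thesis by (simp add: comp_def)
qed

context hyp begin

text \<open>Strong convergence gives joint continuity here because the value at \<open>e 0\<close>
  bounds the norm of \<open>F x\<close> locally. Continuity of the multiplication follows.\<close>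

lemma eval_continuous:
  assumes F: "\<And>x. x \<in> topspace X \<Longrightarrow> F x \<in> Lam" "\<And>i. continuous_map X euclidean (\<lambda>x. F x (e i))"
    and u: "continuous_map X euclidean u"
  shows "continuous_map X euclidean (\<lambda>x. F x (u x))"
proof (rule continuous_map_euclidean_metricI)
  fix x0 and r :: real assume x0: "x0 \<in> topspace X" and r: "r > 0"
  define K where "K = 5 * (norm (F x0 (e 0)) + 2)"
  have K: "K > 0" by (simp add: K_def add_nonneg_pos)
  obtain N \<delta> where N: "\<delta> > 0"
    "\<And>h. h \<in> Lam \<Longrightarrow> (\<And>i. i < N \<Longrightarrow> norm (h (e i) - F x0 (e i)) < \<delta>) \<Longrightarrow> norm (h (u x0) - F x0 (u x0)) < r / 2"
    using Lam_locally_determined[OF F(1)[OF x0], of "r / 2" "u x0"] r by (metis half_gt_zero)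
  let ?U = "{x \<in> topspace X. \<forall>i<N. dist (F x (e i)) (F x0 (e i)) < \<delta>} \<inter>
    ({x \<in> topspace X. dist (F x (e 0)) (F x0 (e 0)) < 1} \<inter> {x \<in> topspace X. dist (u x) (u x0) < r / (2 * K)})"
  have "openin X ?U" by (intro openin_Int openin_all_less openin_ball_preimage F u)
  moreover have "x0 \<in> ?U" using x0 N(1) r K by simp
  moreover have "dist (F x (u x)) (F x0 (u x0)) < r" if x: "x \<in> ?U" for x
  proof -
    have FL: "F x \<in> Lam" using x F(1) by blast
    have "norm (F x (e 0) - F x0 (e 0)) < 1" using x by (simp add: dist_norm)
    then have n0: "norm (F x (e 0)) + 1 \<le> norm (F x0 (e 0)) + 2"
      using norm_triangle_ineq2[of "F x (e 0)" "F x0 (e 0)"] by linarith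
    have "norm (F x (u x - u x0)) \<le> 5 * (norm (F x (e 0)) + 1) * norm (u x - u x0)"
      by (rule Lam_bound[OF FL])
    also have "\<dots> \<le> K * norm (u x - u x0)"
      unfolding K_def using n0 by (intro mult_right_mono) auto
    also have "\<dots> < r / 2" using x K by (simp add: dist_norm field_simps)
    finally have "norm (F x (u x) - F x (u x0)) < r / 2" by (simp add: linear_diff[OF Lam_linear[OF FL]])
    moreover have "norm (F x (u x0) - F x0 (u x0)) < r / 2"
      by (rule N(2)[OF FL]) (use x in \<open>simp add: dist_norm\<close>)
    ultimately show ?thesis
      using norm_triangle_ineq[of "F x (u x) - F x (u x0)" "F x (u x0) - F x0 (u x0)"] by (simp add: dist_norm)
  qed
  ultimately show "\<exists>U. openin X U \<and> x0 \<in> U \<and> (\<forall>y\<in>U. dist (F y (u y)) (F x0 (u x0)) < r)" by blast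
qed

text \<open>On a level set of the quadratic form the norm is controlled by the \<open>0\<close>-th coordinate, so weak
  continuity implies strong continuity.\<close>

lemma weak_continuous_imp_continuous:
  assumes u: "\<And>j. continuous_map X euclideanreal (\<lambda>x. u x \<bullet> e j)"
    and k: "\<And>x. x \<in> topspace X \<Longrightarrow> B (u x) (u x) = k"
  shows "continuous_map X euclidean u"
proof (rule continuous_map_euclidean_metricI)
  fix x0 and r :: real assume x0: "x0 \<in> topspace X" and r: "r > 0"
  define v where "v = u x0"
  define M where "M = norm v + 1"
  define s where "s n = (\<Sum>i<n. (v \<bullet> e i) *\<^sub>R e i)" for n
  have M: "M > 0" by (simp add: M_def add_nonneg_pos)
  have "s \<longlonglongrightarrow> v" using expand[of v] by (simp add: sums_def s_def[abs_def])
  moreover have pos: "r\<^sup>2 / (32 * M) > 0" using r M by simp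
  ultimately obtain n where n: "norm (s n - v) < r\<^sup>2 / (32 * M)" using LIMSEQ_D[of s v] by blast
  have c1: "continuous_map X euclideanreal (\<lambda>x. 2 * (u x \<bullet> e 0)\<^sup>2 - k)"
    unfolding power2_eq_square by (intro continuous_map_diff continuous_map_real_mult u continuous_map_canonical_const)
  have c2: "continuous_map X euclideanreal (\<lambda>x. \<Sum>i<n. (v \<bullet> e i) * (u x \<bullet> e i))"
    by (intro continuous_map_sum continuous_map_real_mult u continuous_map_canonical_const) auto
  have us: "(\<Sum>i<n. (v \<bullet> e i) * (u x \<bullet> e i)) = u x \<bullet> s n" for x
    by (simp add: s_def inner_sum_right)
  have un: "2 * (u x \<bullet> e 0)\<^sup>2 - k = (norm (u x))\<^sup>2" if "x \<in> topspace X" for x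
    using norm2_eq[of "u x"] k[OF that] by simp
  define d where "d = min (r\<^sup>2 / 4) 1"
  have d: "d > 0" using r by (simp add: d_def)
  let ?U = "{x \<in> topspace X. dist (2 * (u x \<bullet> e 0)\<^sup>2 - k) (2 * (u x0 \<bullet> e 0)\<^sup>2 - k) < d} \<inter>
    {x \<in> topspace X. dist (\<Sum>i<n. (v \<bullet> e i) * (u x \<bullet> e i)) (\<Sum>i<n. (v \<bullet> e i) * (u x0 \<bullet> e i)) < r\<^sup>2 / 8}"
  have "openin X ?U" by (intro openin_Int openin_ball_preimage c1 c2)
  moreover have "x0 \<in> ?U" using x0 d r by simp
  moreover have "dist (u x) (u x0) < r" if x: "x \<in> ?U" for x
  proof -
    have 1: "\<bar>(norm (u x))\<^sup>2 - (norm v)\<^sup>2\<bar> < d"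
    proof -
      have xX: "x \<in> topspace X" using x by blast
      have "dist (2 * (u x \<bullet> e 0)\<^sup>2 - k) (2 * (u x0 \<bullet> e 0)\<^sup>2 - k) < d" using x by blast
      then show ?thesis unfolding un[OF xX] un[OF x0] by (simp add: dist_real_def v_def)
    qed
    have 2: "\<bar>u x \<bullet> s n - v \<bullet> s n\<bar> < r\<^sup>2 / 8"
      using x unfolding us by (simp add: dist_real_def v_def)
    have "(norm (u x))\<^sup>2 \<le> (norm v)\<^sup>2 + 1" using 1 by (auto simp: d_def)
    also have "\<dots> \<le> M\<^sup>2" by (simp add: M_def power2_eq_square algebra_simps)
    finally have "(norm (u x))\<^sup>2 \<le> M\<^sup>2" .
    then have uM: "norm (u x) \<le> M" by (rule power2_le_imp_le) (use M in simp)
    have "\<bar>(u x - v) \<bullet> (v - s n)\<bar> \<le> norm (u x - v) * norm (v - s n)" by (rule Cauchy_Schwarz_ineq2)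
    also have "\<dots> \<le> (2 * M) * (r\<^sup>2 / (32 * M))"
      using n uM M norm_triangle_ineq4[of "u x" v]
      by (intro mult_mono) (auto simp: M_def norm_minus_commute)
    also have "\<dots> = r\<^sup>2 / 16" using M by simp
    finally have 3: "\<bar>(u x - v) \<bullet> (v - s n)\<bar> \<le> r\<^sup>2 / 16" .
    \<comment> \<open>The three terms are small for different reasons: the norms are close through
      the 0-th coordinate, finitely many coordinates are close, and the tail \<open>v - s n\<close>
      is short.\<close>
    have "(norm (u x - v))\<^sup>2 = (norm (u x))\<^sup>2 - (norm v)\<^sup>2 - 2 * (u x \<bullet> s n - v \<bullet> s n) - 2 * ((u x - v) \<bullet> (v - s n))"
      by (simp add: power2_norm_eq_inner inner_diff_left inner_diff_right inner_commute[of v "u x"])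
    also have "\<dots> < r\<^sup>2"
    proof -
      have "(norm (u x))\<^sup>2 - (norm v)\<^sup>2 < r\<^sup>2 / 4" using 1 unfolding d_def by linarith
      moreover have "0 < r\<^sup>2" using r by simp
      moreover have "a - 2 * b - 2 * c < R" if "a < R / 4" "\<bar>b\<bar> < R / 8" "\<bar>c\<bar> \<le> R / 16" "0 < R" for a b c R :: real
        using that by (auto simp: abs_if split: if_splits)
      ultimately show ?thesis using 2 3 by blast
    qed
    finally have "norm (u x - v) < r" by (rule power_less_imp_less_base) (use r in simp)
    then show ?thesis by (simp add: dist_norm v_def)
  qed
  ultimately show "\<exists>U. openin X U \<and> x0 \<in> U \<and> (\<forall>y\<in>U. dist (u y) (u x0) < r)" by blast
qed

text \<open>Recording the inverse as well makes inversion a swap of the two components and keeps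
  invertibility under limits.\<close>

definition coordinates :: "('a \<Rightarrow> 'a) \<Rightarrow> (nat \<Rightarrow> 'a) \<times> (nat \<Rightarrow> 'a)" where
  "coordinates f = (\<lambda>i. lift f (e i), \<lambda>i. inv (lift f) (e i))"

definition isom_topology :: "('a \<Rightarrow> 'a) topology" where
  "isom_topology = pullback_topology (carrier (Isom e)) coordinates euclidean"

lemma topspace_isom_topology: "topspace isom_topology = carrier (Isom e)"
  by (simp add: isom_topology_def topspace_pullback_topology)

lemma continuous_lift_e: "continuous_map isom_topology euclidean (\<lambda>f. lift f (e i))"
  and continuous_inv_lift_e: "continuous_map isom_topology euclidean (\<lambda>f. inv (lift f) (e i))"
proof -
  have "continuous_on UNIV (\<lambda>p :: (nat \<Rightarrow> 'a) \<times> (nat \<Rightarrow> 'a). fst p i)"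
    "continuous_on UNIV (\<lambda>p :: (nat \<Rightarrow> 'a) \<times> (nat \<Rightarrow> 'a). snd p i)"
    by (rule continuous_on_product_then_coordinatewise[OF continuous_on_fst[OF continuous_on_id]],
        rule continuous_on_product_then_coordinatewise[OF continuous_on_snd[OF continuous_on_id]])
  then have "continuous_map isom_topology euclidean ((\<lambda>p. fst p i) \<circ> coordinates)"
    "continuous_map isom_topology euclidean ((\<lambda>p. snd p i) \<circ> coordinates)"
    unfolding isom_topology_def by (intro continuous_map_pullback; simp)+
  then show "continuous_map isom_topology euclidean (\<lambda>f. lift f (e i))"
    "continuous_map isom_topology euclidean (\<lambda>f. inv (lift f) (e i))"
    by (simp_all add: comp_def coordinates_def)
qed

lemma continuous_into_isom_topology:
  assumes "\<And>x. x \<in> topspace X \<Longrightarrow> h x \<in> carrier (Isom e)"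
    "\<And>i. continuous_map X euclidean (\<lambda>x. lift (h x) (e i))"
    "\<And>i. continuous_map X euclidean (\<lambda>x. inv (lift (h x)) (e i))"
  shows "continuous_map X isom_topology h"
  unfolding isom_topology_def
proof (rule continuous_map_pullback')
  have "continuous_map X (product_topology (\<lambda>i. euclidean) UNIV) (\<lambda>x i. lift (h x) (e i))"
    "continuous_map X (product_topology (\<lambda>i. euclidean) UNIV) (\<lambda>x i. inv (lift (h x)) (e i))"
    using assms by (simp_all add: continuous_map_componentwise_UNIV)
  then have "continuous_map X (prod_topology euclidean euclidean) (coordinates \<circ> h)"
    by (simp add: euclidean_product_topology coordinates_def comp_def continuous_map_pairedI del: prod_topology_euclidean)
  then show "continuous_map X euclidean (coordinates \<circ> h)" by simp
qed (use assms(1) in auto)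

lemma group_topology_isom_topology: "group_topology (Isom e) isom_topology"
  unfolding group_topology_def
proof (intro conjI)
  interpret G: group "Isom e" by (rule group_Isom)
  show "group (Isom e)" by (rule group_Isom)
  show "topspace isom_topology = carrier (Isom e)" by (rule topspace_isom_topology)
  let ?X = "prod_topology isom_topology isom_topology"
  have c1: "continuous_map ?X euclidean (\<lambda>p. lift (fst p) (e i))" "continuous_map ?X euclidean (\<lambda>p. lift (snd p) (e i))"
    "continuous_map ?X euclidean (\<lambda>p. inv (lift (fst p)) (e i))" "continuous_map ?X euclidean (\<lambda>p. inv (lift (snd p)) (e i))" for i
    using continuous_map_compose[OF continuous_map_fst continuous_lift_e]
      continuous_map_compose[OF continuous_map_snd continuous_lift_e]
      continuous_map_compose[OF continuous_map_fst continuous_inv_lift_e]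
      continuous_map_compose[OF continuous_map_snd continuous_inv_lift_e]
    by (simp_all add: comp_def)
  have mem: "fst p \<in> carrier (Isom e)" "snd p \<in> carrier (Isom e)" if "p \<in> topspace ?X" for p
    using that by (auto simp: topspace_isom_topology)
  have "continuous_map ?X euclidean (\<lambda>p. lift (fst p) (lift (snd p) (e i)))" for i
    by (rule eval_continuous) (use mem lift_Lam c1 in auto)
  moreover have "continuous_map ?X euclidean (\<lambda>p. inv (lift (snd p)) (inv (lift (fst p)) (e i)))" for i
    by (rule eval_continuous) (use mem lift_Lam Lam_inv c1 in auto)
  ultimately have "continuous_map ?X isom_topology (\<lambda>p. fst p \<otimes>\<^bsub>Isom e\<^esub> snd p)"
  proof (intro continuous_into_isom_topology)
    fix i
    assume a: "\<And>i. continuous_map ?X euclidean (\<lambda>p. lift (fst p) (lift (snd p) (e i)))"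
      and b: "\<And>i. continuous_map ?X euclidean (\<lambda>p. inv (lift (snd p)) (inv (lift (fst p)) (e i)))"
    show "continuous_map ?X euclidean (\<lambda>p. lift (fst p \<otimes>\<^bsub>Isom e\<^esub> snd p) (e i))"
      by (rule continuous_map_eq[OF a[of i]]) (use mem in \<open>auto simp: lift_mult\<close>)
    show "continuous_map ?X euclidean (\<lambda>p. inv (lift (fst p \<otimes>\<^bsub>Isom e\<^esub> snd p)) (e i))"
      by (rule continuous_map_eq[OF b[of i]]) (use mem in \<open>auto simp: lift_mult lift_Lam Lam_inv_comp\<close>)
  qed (use mem in auto)
  then show "continuous_map ?X isom_topology (\<lambda>(g, h). g \<otimes>\<^bsub>Isom e\<^esub> h)" by (simp add: case_prod_unfold)
  show "continuous_map isom_topology isom_topology (m_inv (Isom e))"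
  proof (rule continuous_into_isom_topology)
    show "continuous_map isom_topology euclidean (\<lambda>f. lift (m_inv (Isom e) f) (e i))" for i
      by (rule continuous_map_eq[OF continuous_inv_lift_e[of i]]) (simp add: topspace_isom_topology lift_inv)
    show "continuous_map isom_topology euclidean (\<lambda>f. inv (lift (m_inv (Isom e) f)) (e i))" for i
      by (rule continuous_map_eq[OF continuous_lift_e[of i]])
         (simp add: topspace_isom_topology lift_inv lift_Lam Lam_inv_inv)
  qed (simp add: topspace_isom_topology)
qed

text \<open>Continuity of the evaluations suffices: those of the inverse follow by composing with
  the continuous inversion of \<open>S\<close>.\<close>

lemma isom_topology_coarsest:
  assumes S: "group_topology (Isom e) S" and c: "\<And>i. continuous_map S euclidean (\<lambda>f. lift f (e i))"
    and U: "openin isom_topology U"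
  shows "openin S U"
proof -
  have tS: "topspace S = carrier (Isom e)" and ci: "continuous_map S S (m_inv (Isom e))"
    using S by (auto simp: group_topology_def)
  have "continuous_map S isom_topology (\<lambda>f. f)"
  proof (rule continuous_into_isom_topology)
    fix i
    have "continuous_map S euclidean ((\<lambda>f. lift f (e i)) \<circ> m_inv (Isom e))"
      by (rule continuous_map_compose[OF ci c])
    then show "continuous_map S euclidean (\<lambda>f. inv (lift f) (e i))"
      by (rule continuous_map_eq) (simp add: tS lift_inv)
  qed (use tS c in auto)
  from openin_continuous_map_preimage[OF this U] have "openin S {x \<in> topspace S. x \<in> U}" .
  moreover have "{x \<in> topspace S. x \<in> U} = U"
    using openin_subset[OF U] by (auto simp: tS topspace_isom_topology)
  ultimately show ?thesis by simp
qed

lemma pointwise_convergence_isom_topology: "pointwise_convergence_topology e isom_topology"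
  unfolding pointwise_convergence_topology_def
proof (intro conjI allI impI)
  show "group_topology (Isom e) isom_topology" by (rule group_topology_isom_topology)
  show "orbit_maps_continuous e isom_topology"
    unfolding orbit_maps_continuous_def hyperbolic_topology_eq
  proof
    fix x assume x: "x \<in> Hs"
    have "continuous_map isom_topology euclidean (\<lambda>f. lift f x)"
      by (rule eval_continuous) (use continuous_lift_e lift_Lam in \<open>auto simp: topspace_isom_topology\<close>)
    then have "continuous_map isom_topology euclidean (\<lambda>f. f x)"
      by (rule continuous_map_eq) (simp add: topspace_isom_topology lift_apply x)
    moreover have "f x \<in> Hs" if "f \<in> carrier (Isom e)" for f
      using Lam_Hs[OF lift_Lam[OF that] x] lift_apply[OF that x] by simp
    ultimately show "continuous_map isom_topology (top_of_set Hs) (\<lambda>f. f x)"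
      by (auto simp: continuous_map_in_subtopology topspace_isom_topology)
  qed
  fix S U assume S: "group_topology (Isom e) S \<and> orbit_maps_continuous e S" and U: "openin isom_topology U"
  have tS: "topspace S = carrier (Isom e)" using S by (simp add: group_topology_def)
  have orb: "continuous_map S euclidean (\<lambda>f. f x)" if "x \<in> Hs" for x
    using S that by (auto simp: orbit_maps_continuous_def hyperbolic_topology_eq continuous_map_in_subtopology)
  have "continuous_map S euclidean (\<lambda>f. lift f (e i))" for i
  proof (cases "i = 0")
    case True
    show ?thesis
      by (rule continuous_map_eq[OF orb[OF e0_Hs]]) (simp add: tS lift_apply e0_Hs True)
  next
    case False
    let ?x = "sqrt 2 *\<^sub>R e 0 + e i"
    have x: "?x \<in> Hs" using False by (rule shifted_basis_Hs)
    have "continuous_map S euclidean (\<lambda>f. f ?x - sqrt 2 *\<^sub>R f (e 0))"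
    proof (rule continuous_map_euclidean_metricI)
      fix f0 and r :: real assume f0: "f0 \<in> topspace S" and r: "r > 0"
      let ?U = "{f \<in> topspace S. dist (f ?x) (f0 ?x) < r / 2} \<inter> {f \<in> topspace S. dist (f (e 0)) (f0 (e 0)) < r / 4}"
      have "openin S ?U" by (intro openin_Int openin_ball_preimage orb x e0_Hs)
      moreover have "f0 \<in> ?U" using f0 r by simp
      moreover have "dist (f ?x - sqrt 2 *\<^sub>R f (e 0)) (f0 ?x - sqrt 2 *\<^sub>R f0 (e 0)) < r" if f: "f \<in> ?U" for f
      proof -
        have "(f ?x - sqrt 2 *\<^sub>R f (e 0)) - (f0 ?x - sqrt 2 *\<^sub>R f0 (e 0))
            = (f ?x - f0 ?x) - sqrt 2 *\<^sub>R (f (e 0) - f0 (e 0))" by (simp add: algebra_simps)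
        also have "norm \<dots> \<le> norm (f ?x - f0 ?x) + norm (sqrt 2 *\<^sub>R (f (e 0) - f0 (e 0)))"
          by (rule norm_triangle_ineq4)
        also have "norm (sqrt 2 *\<^sub>R (f (e 0) - f0 (e 0))) \<le> 2 * norm (f (e 0) - f0 (e 0))"
          using sqrt2_less_2 by (simp add: mult_right_mono)
        finally show ?thesis using f by (simp add: dist_norm)
      qed
      ultimately show "\<exists>U. openin S U \<and> f0 \<in> U \<and>
        (\<forall>f\<in>U. dist (f ?x - sqrt 2 *\<^sub>R f (e 0)) (f0 ?x - sqrt 2 *\<^sub>R f0 (e 0)) < r)" by blast
    qed
    then show ?thesis
    proof (rule continuous_map_eq)
      fix f assume "f \<in> topspace S"
      then have f: "f \<in> carrier (Isom e)" by (simp add: tS)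
      have l: "linear (lift f)" using Lam_linear lift_Lam f by blast
      have "f ?x = lift f ?x" "f (e 0) = lift f (e 0)" using lift_apply[OF f] x e0_Hs by auto
      then show "f ?x - sqrt 2 *\<^sub>R f (e 0) = lift f (e i)"
        by (simp add: linear_add[OF l] linear_scale[OF l])
    qed
  qed
  then show "openin S U" using isom_topology_coarsest S U by blast
qed

text \<open>The topology of matrix coefficients is pulled back from a second countable space, hence
  separable. The identity map from it to \<open>isom_topology\<close> is continuous, as weak
  continuity implies strong continuity on level sets of the form.\<close>

lemma separable_isom_topology: "separable_space isom_topology"
proof -
  define \<Psi> :: "('a \<Rightarrow> 'a) \<Rightarrow> nat \<times> nat \<Rightarrow> real" where "\<Psi> f = (\<lambda>(i, j). lift f (e i) \<bullet> e j)" for f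
  define X where "X = pullback_topology (carrier (Isom e)) \<Psi> euclidean"
  have tX: "topspace X = carrier (Isom e)" by (simp add: X_def topspace_pullback_topology)
  have m: "continuous_map X euclideanreal (\<lambda>f. lift f (e i) \<bullet> e j)" for i j
  proof -
    have "continuous_on UNIV (\<lambda>p :: nat \<times> nat \<Rightarrow> real. p (i, j))"
      by (rule continuous_on_product_then_coordinatewise[OF continuous_on_id])
    then have "continuous_map X euclideanreal ((\<lambda>p. p (i, j)) \<circ> \<Psi>)"
      unfolding X_def by (intro continuous_map_pullback) simp
    then show ?thesis by (simp add: comp_def \<Psi>_def)
  qed
  have m': "continuous_map X euclideanreal (\<lambda>f. inv (lift f) (e i) \<bullet> e j)" for i j
  proof -
    \<comment> \<open>By invariance of the form the inverse has the transposed matrix up to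
      signs.\<close>
    define c :: real where "c = (if i = 0 then 1 else - 1) * (if j = 0 then 1 else - 1)"
    have "continuous_map X euclideanreal (\<lambda>f. c * (lift f (e j) \<bullet> e i))"
      by (intro continuous_map_real_mult m continuous_map_canonical_const)
    then show ?thesis
    proof (rule continuous_map_eq)
      fix f assume "f \<in> topspace X"
      then have L: "lift f \<in> Lam" using lift_Lam tX by blast
      have "B (inv (lift f) (e i)) (e j) = B (lift f (e j)) (e i)"
        using Lam_adj[OF L, of "e j" "e i"] by (simp add: B_sym)
      then show "c * (lift f (e j) \<bullet> e i) = inv (lift f) (e i) \<bullet> e j"
        by (cases "i = 0"; cases "j = 0") (auto simp: c_def B_e0 B_e)
    qed
  qed
  have "continuous_map X isom_topology (\<lambda>f. f)"
  proof (rule continuous_into_isom_topology)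
    fix i
    show "continuous_map X euclidean (\<lambda>f. lift f (e i))"
      by (rule weak_continuous_imp_continuous[OF m, where k = "B (e i) (e i)"]) (simp add: tX lift_Lam Lam_B)
    show "continuous_map X euclidean (\<lambda>f. inv (lift f) (e i))"
      by (rule weak_continuous_imp_continuous[OF m', where k = "B (e i) (e i)"]) (simp add: tX lift_Lam Lam_B Lam_inv)
  qed (simp add: tX)
  moreover have "separable_space X"
    unfolding X_def by (intro second_countable_imp_separable_space second_countable_pullback)
  ultimately show ?thesis
    using separable_space_continuous_map_image[of X isom_topology "\<lambda>f. f"] by (simp add: tX topspace_isom_topology)
qed

text \<open>The mixed condition says that the two form-preserving maps are adjoint to each other,
  which makes them mutually inverse. All conditions are equations or weak inequalities and therefore
  closed.\<close>

lemma coordinates_image: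
  "coordinates ` carrier (Isom e) = {(a, b). (\<forall>i j. B (a i) (a j) = B (e i) (e j)) \<and>
     (\<forall>i j. B (b i) (b j) = B (e i) (e j)) \<and> (\<forall>i j. B (a i) (e j) = B (e i) (b j)) \<and>
     a 0 \<bullet> e 0 \<ge> 1 \<and> b 0 \<bullet> e 0 \<ge> 1}" (is "_ = ?Z")
proof
  show "coordinates ` carrier (Isom e) \<subseteq> ?Z"
  proof
    fix p assume "p \<in> coordinates ` carrier (Isom e)"
    then obtain f where f: "f \<in> carrier (Isom e)" "p = coordinates f" by blast
    have L: "lift f \<in> Lam" "inv (lift f) \<in> Lam" using lift_Lam[OF f(1)] Lam_inv by auto
    show "p \<in> ?Z"
      using Hs_ge1[OF Lam_e0_Hs[OF L(1)]] Hs_ge1[OF Lam_e0_Hs[OF L(2)]]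
      by (auto simp: f(2) coordinates_def Lam_B[OF L(1)] Lam_B[OF L(2)] Lam_adj[OF L(1)] Lam_inv_f[OF L(1)])
  qed
  show "?Z \<subseteq> coordinates ` carrier (Isom e)"
  proof
    fix p assume "p \<in> ?Z"
    then obtain a b where p: "p = (a, b)" and a: "\<forall>i j. B (a i) (a j) = B (e i) (e j)" and b: "\<forall>i j. B (b i) (b j) = B (e i) (e j)"
      and ab: "\<forall>i j. B (a i) (e j) = B (e i) (b j)" and ge: "1 \<le> a 0 \<bullet> e 0" "1 \<le> b 0 \<bullet> e 0"
      by blast
    have H: "a 0 \<in> Hs" "b 0 \<in> Hs" using a b ge by (auto simp: Hs_iff B_ee)
    obtain g where g: "bounded_linear g" "\<And>x y. B (g x) (g y) = B x y" "\<And>i. g (e i) = a i"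
      by (rule form_map_exists[OF a[rule_format] H(1)], rule that; assumption)
    obtain h where h: "bounded_linear h" "\<And>x y. B (h x) (h y) = B x y" "\<And>i. h (e i) = b i"
      by (rule form_map_exists[OF b[rule_format] H(2)], rule that; assumption)
    have bl: "bounded_linear (\<lambda>x. B y x)" for y using B_bounded_linear[of y] by (simp add: B_sym[of y])
    have adj1: "B (a i) y = B (e i) (h y)" for i y
      by (rule bounded_linear_eqI[where f = "\<lambda>z. B (a i) z" and g = "\<lambda>z. B (e i) (h z)",
            OF bl bounded_linear_compose[OF bl h(1)]]) (simp add: h(3) ab)
    have adj: "B (g x) y = B x (h y)" for x y
      by (rule bounded_linear_eqI[where f = "\<lambda>z. B (g z) y" and g = "\<lambda>z. B z (h y)",
            OF bounded_linear_compose[OF B_bounded_linear g(1)] B_bounded_linear]) (simp add: g(3) adj1)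
    have gh: "g (h y) = y" for y
      by (rule B_eqI') (simp add: adj h(2))
    have hg: "h (g x) = x" for x
    proof (rule B_eqI')
      fix z
      have "B (h (g x)) z = B z (h (g x))" by (rule B_sym)
      also have "\<dots> = B (g z) (g x)" by (rule adj[symmetric])
      also have "\<dots> = B x z" by (simp only: g(2) B_sym[of z x])
      finally show "B (h (g x)) z = B x z" .
    qed
    have "bij g" using gh hg by (intro o_bij[of h]) auto
    then have gL: "g \<in> Lam"
      using g H by (auto simp: Lam_def Hs_iff bounded_linear.linear)
    have "inv g = h" by (rule inv_unique_comp) (auto simp: gh hg)
    then have "coordinates (rho g) = (a, b)" by (simp add: coordinates_def lift_rho[OF gL] g(3) h(3))
    then show "p \<in> coordinates ` carrier (Isom e)" unfolding p using rho_carrier[OF gL] by (metis imageI)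
  qed
qed

text \<open>\<open>coordinates\<close> is a homeomorphism onto a closed subset of a countable
  product of complete spaces.\<close>

lemma completely_metrizable_isom_topology: "completely_metrizable_space isom_topology"
proof -
  let ?C = "carrier (Isom e)" and ?Z = "coordinates ` carrier (Isom e)"
  have inj: "inj_on coordinates ?C"
  proof (rule inj_onI)
    fix f g assume fg: "f \<in> ?C" "g \<in> ?C" "coordinates f = coordinates g"
    then have "lift f (e i) = lift g (e i)" for i by (auto simp: coordinates_def dest: fun_cong)
    then have "lift f = lift g" using fg lift_Lam Lam_eqI by blast
    then show "f = g" using fg rho_lift by metis
  qed
  have coord: "continuous_on UNIV (\<lambda>p :: (nat \<Rightarrow> 'a) \<times> (nat \<Rightarrow> 'a). fst p i)"
    "continuous_on UNIV (\<lambda>p :: (nat \<Rightarrow> 'a) \<times> (nat \<Rightarrow> 'a). snd p i)" for i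
    by (rule continuous_on_product_then_coordinatewise[OF continuous_on_fst[OF continuous_on_id]],
        rule continuous_on_product_then_coordinatewise[OF continuous_on_snd[OF continuous_on_id]])
  have "closed {p. (\<forall>i j. B (fst p i) (fst p j) = B (e i) (e j)) \<and>
     (\<forall>i j. B (snd p i) (snd p j) = B (e i) (e j)) \<and> (\<forall>i j. B (fst p i) (e j) = B (e i) (snd p j)) \<and>
     fst p 0 \<bullet> e 0 \<ge> 1 \<and> snd p 0 \<bullet> e 0 \<ge> 1}"
    unfolding B_def
    by (intro closed_Collect_conj closed_Collect_all closed_Collect_eq closed_Collect_le
        continuous_intros coord)
  then have "closed ?Z" unfolding coordinates_image by (simp add: case_prod_unfold)
  then have "completely_metrizable_space (top_of_set ?Z)"
    by (intro completely_metrizable_space_closedin completely_metrizable_space_euclidean) simp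
  moreover have "isom_topology homeomorphic_space top_of_set ?Z"
    unfolding homeomorphic_space_def homeomorphic_maps_def
  proof (intro exI conjI ballI)
    have "continuous_map isom_topology euclidean (id \<circ> coordinates)"
      unfolding isom_topology_def by (intro continuous_map_pullback) simp
    then show "continuous_map isom_topology (top_of_set ?Z) coordinates"
      by (auto simp: continuous_map_in_subtopology topspace_isom_topology)
    show "continuous_map (top_of_set ?Z) isom_topology (inv_into ?C coordinates)"
      unfolding isom_topology_def
    proof (rule continuous_map_pullback')
      have "continuous_map (top_of_set ?Z) euclidean (\<lambda>p. p)" by simp
      then show "continuous_map (top_of_set ?Z) euclidean (coordinates \<circ> inv_into ?C coordinates)"
        by (rule continuous_map_eq) (auto simp: f_inv_into_f)
    qed (auto intro: inv_into_into)
    show "inv_into ?C coordinates (coordinates f) = f" if "f \<in> topspace isom_topology" for f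
      using that inj by (simp add: topspace_isom_topology)
    show "coordinates (inv_into ?C coordinates p) = p" if "p \<in> topspace (top_of_set ?Z)" for p
      using that by (auto simp: f_inv_into_f)
  qed
  ultimately show ?thesis using homeomorphic_completely_metrizable_space by blast
qed

section \<open>Uniqueness among separable Hausdorff group topologies\<close>

lemma nbhd_system_of_group_topology:
  assumes S: "group_topology (Isom e) S" and sep: "separable_space S" and haus: "Hausdorff_space S"
  shows "nbhd_system e {{g \<in> Lam. rho g \<in> U} | U. openin S U \<and> \<one>\<^bsub>Isom e\<^esub> \<in> U}"
proof -
  interpret G: group "Isom e" by (rule group_Isom)
  have tS: "topspace S = carrier (Isom e)" and ci: "continuous_map S S (m_inv (Isom e))"
    using S by (auto simp: group_topology_def)
  have cc: "continuous_map S S (\<lambda>h. g)" if "g \<in> carrier (Isom e)" for g using that tS by simp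
  have cid: "continuous_map S S (\<lambda>h. h)" by simp
  let ?V = "\<lambda>U. {g \<in> Lam. rho g \<in> U}"
  let ?N = "\<lambda>U. openin S U \<and> \<one>\<^bsub>Isom e\<^esub> \<in> U"
  have mem: "?V U \<in> {?V U | U. ?N U}" if "openin S U" "\<one>\<^bsub>Isom e\<^esub> \<in> U" for U using that by blast
  have pre: "openin S {h \<in> carrier (Isom e). F h \<in> U}" if "continuous_map S S F" "openin S U" for F U
    using openin_continuous_map_preimage[OF that] by (simp add: tS)
  show ?thesis
  proof
    fix V V' \<gamma> g
    assume "V \<in> {?V U | U. ?N U}"
    then obtain U where U: "V = ?V U" "openin S U" "\<one>\<^bsub>Isom e\<^esub> \<in> U" by blast
    show "V \<subseteq> Lam" "id \<in> V" using U Lam_id by (auto simp: rho_one)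
    show "\<exists>V'\<in>{?V U | U. ?N U}. \<forall>a\<in>V'. \<forall>b\<in>V'. a \<circ> b \<in> V"
    proof -
      have "continuous_map (prod_topology S S) S (\<lambda>(g, h). g \<otimes>\<^bsub>Isom e\<^esub> h)"
        using S by (simp add: group_topology_def)
      from openin_continuous_map_preimage[OF this U(2)]
      have op: "openin (prod_topology S S) {p \<in> carrier (Isom e) \<times> carrier (Isom e). fst p \<otimes>\<^bsub>Isom e\<^esub> snd p \<in> U}"
        by (simp add: tS case_prod_unfold)
      have one: "(\<one>\<^bsub>Isom e\<^esub>, \<one>\<^bsub>Isom e\<^esub>) \<in> {p \<in> carrier (Isom e) \<times> carrier (Isom e). fst p \<otimes>\<^bsub>Isom e\<^esub> snd p \<in> U}"
        using U(3) by simp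
      obtain U1 U2 where U12: "openin S U1" "openin S U2" "\<one>\<^bsub>Isom e\<^esub> \<in> U1" "\<one>\<^bsub>Isom e\<^esub> \<in> U2"
        "U1 \<times> U2 \<subseteq> {p \<in> carrier (Isom e) \<times> carrier (Isom e). fst p \<otimes>\<^bsub>Isom e\<^esub> snd p \<in> U}"
        using op[unfolded openin_prod_topology_alt, rule_format, OF one]
        by (elim exE conjE) (rule that; assumption)
      have "a \<circ> b \<in> V" if "a \<in> ?V (U1 \<inter> U2)" "b \<in> ?V (U1 \<inter> U2)" for a b
        using that U12(5) Lam_comp[of a b] rho_mult[of a b] by (auto simp: U(1))
      then show ?thesis using mem[of "U1 \<inter> U2"] U12 by (intro bexI[of _ "?V (U1 \<inter> U2)"]) auto
    qed
    show "\<exists>V'\<in>{?V U | U. ?N U}. \<forall>a\<in>V'. inv a \<in> V"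
    proof -
      let ?U = "{h \<in> carrier (Isom e). m_inv (Isom e) h \<in> U}"
      have "openin S ?U" using pre[OF ci U(2)] .
      moreover have "inv a \<in> V" if "a \<in> ?V ?U" for a
        using that Lam_inv[of a] rho_inv[of a] by (auto simp: U(1))
      ultimately show ?thesis using mem[of ?U] U(3) by (intro bexI[of _ "?V ?U"]) auto
    qed
    show "\<exists>k :: nat \<Rightarrow> 'a \<Rightarrow> 'a. range k \<subseteq> Lam \<and> (\<forall>g\<in>Lam. \<exists>n. inv (k n) \<circ> g \<in> V)"
    proof -
      obtain C where C: "countable C" "C \<subseteq> carrier (Isom e)" "S closure_of C = carrier (Isom e)"
        using sep by (auto simp: separable_space_def tS)
      have Cne: "C \<noteq> {}" using C(3) G.one_closed by force
      define k where "k n = lift (from_nat_into C n)" for n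
      have kC: "from_nat_into C n \<in> carrier (Isom e)" for n using from_nat_into[OF Cne] C(2) by blast
      have "\<exists>n. inv (k n) \<circ> g \<in> V" if g: "g \<in> Lam" for g
      proof -
        \<comment> \<open>The \<open>h\<close> whose translate of \<open>U\<close> contains
          \<open>rho g\<close> form an open set around \<open>rho g\<close>, so the dense sequence
          meets it.\<close>
        let ?U = "{h \<in> carrier (Isom e). m_inv (Isom e) h \<otimes>\<^bsub>Isom e\<^esub> rho g \<in> U}"
        have op: "openin S ?U"
          by (rule pre[OF group_topology_continuous_mult[OF S ci cc[OF rho_carrier[OF g]]] U(2)])
        have gU: "rho g \<in> ?U" using rho_carrier[OF g] U(3) by simp
        have "rho g \<in> S closure_of C" using C(3) rho_carrier[OF g] by simp
        then have "rho g \<in> ?U \<and> openin S ?U \<longrightarrow> (\<exists>h. h \<in> C \<and> h \<in> ?U)"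
          unfolding in_closure_of by (elim conjE allE)
        then obtain h where h: "h \<in> C" "h \<in> ?U" using op gU by (elim impE exE conjE) (rule conjI)
        then obtain n where n: "h = from_nat_into C n" using from_nat_into_surj[OF C(1)] by metis
        have "rho (inv (k n) \<circ> g) = m_inv (Isom e) h \<otimes>\<^bsub>Isom e\<^esub> rho g"
          using rho_mult[OF Lam_inv[OF lift_Lam[OF kC]] g, of n] rho_inv[OF lift_Lam[OF kC], of n] rho_lift[OF kC, of n]
          by (simp add: k_def n)
        then have "inv (k n) \<circ> g \<in> V"
          using h(2) Lam_comp[OF Lam_inv[OF lift_Lam[OF kC]] g, of n] by (simp add: U(1) k_def)
        then show ?thesis by blast
      qed
      then show ?thesis using lift_Lam[OF kC] by (intro exI[of _ k]) (auto simp: k_def)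
    qed
    show "\<exists>V''\<in>{?V U | U. ?N U}. V'' \<subseteq> V \<inter> V'" if V': "V' \<in> {?V U | U. ?N U}"
    proof -
      obtain U' where U': "V' = ?V U'" "openin S U'" "\<one>\<^bsub>Isom e\<^esub> \<in> U'" using V' by blast
      then show ?thesis using mem[of "U \<inter> U'"] U by (intro bexI[of _ "?V (U \<inter> U')"]) auto
    qed
    show "\<exists>V'\<in>{?V U | U. ?N U}. \<forall>a\<in>V'. \<gamma> \<circ> a \<circ> inv \<gamma> \<in> V" if \<gamma>: "\<gamma> \<in> Lam"
    proof -
      let ?U = "{h \<in> carrier (Isom e). (rho \<gamma> \<otimes>\<^bsub>Isom e\<^esub> h) \<otimes>\<^bsub>Isom e\<^esub> rho (inv \<gamma>) \<in> U}"
      have "openin S ?U"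
        using \<gamma> Lam_inv rho_carrier
        by (intro pre[OF _ U(2)] group_topology_continuous_mult[OF S] cc cid) auto
      moreover have "\<one>\<^bsub>Isom e\<^esub> \<in> ?U"
        using U(3) rho_carrier[OF \<gamma>] G.r_inv[OF rho_carrier[OF \<gamma>]] by (simp add: rho_inv[OF \<gamma>])
      moreover have "\<gamma> \<circ> a \<circ> inv \<gamma> \<in> V" if "a \<in> ?V ?U" for a
      proof -
        have a: "a \<in> Lam" "(rho \<gamma> \<otimes>\<^bsub>Isom e\<^esub> rho a) \<otimes>\<^bsub>Isom e\<^esub> rho (inv \<gamma>) \<in> U" using that by auto
        have L: "\<gamma> \<circ> a \<in> Lam" "inv \<gamma> \<in> Lam" using \<gamma> a Lam_comp Lam_inv by auto
        show ?thesis using a(2) Lam_comp[OF L] unfolding rho_mult[OF \<gamma> a(1)] rho_mult[OF L] by (simp add: U(1))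
      qed
      ultimately show ?thesis using mem[of ?U] by (intro bexI[of _ "?V ?U"]) auto
    qed
  next
    fix g assume g: "g \<in> Lam" "g \<noteq> id"
    then have "rho g \<noteq> \<one>\<^bsub>Isom e\<^esub>" using rho_inj[OF g(1) Lam_id] rho_one by auto
    then obtain U where "openin S U" "\<one>\<^bsub>Isom e\<^esub> \<in> U" "rho g \<notin> U"
      using haus rho_carrier[OF g(1)] G.one_closed unfolding Hausdorff_space_def tS disjnt_iff by metis
    then show "\<exists>V\<in>{?V U | U. ?N U}. g \<notin> V" using mem[of U] by (intro bexI[of _ "?V U"]) auto
  qed
qed

theorem isom_topology_unique:
  assumes S: "group_topology (Isom e) S" and sep: "separable_space S" and haus: "Hausdorff_space S"
  shows "S = isom_topology"
proof (rule openin_eqI)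
  define \<V> where "\<V> = {{g \<in> Lam. rho g \<in> U} | U. openin S U \<and> \<one>\<^bsub>Isom e\<^esub> \<in> U}"
  interpret nbhd_system e \<V>
    unfolding \<V>_def by (rule nbhd_system_of_group_topology[OF assms])
  interpret G: group "Isom e" by (rule group_Isom)
  have tS: "topspace S = carrier (Isom e)" using S by (simp add: group_topology_def)
  show "openin isom_topology U" if "openin S U" for U
  proof (rule group_topology_coarser[OF S group_topology_isom_topology _ that])
    fix U assume U: "openin S U" "\<one>\<^bsub>Isom e\<^esub> \<in> U"
    then have UV: "{g \<in> Lam. rho g \<in> U} \<in> \<V>" by (auto simp: \<V>_def)
    have "\<exists>F r. finite F \<and> r > 0 \<and> (\<forall>h\<in>Lam. (\<forall>v\<in>F. norm (h v - v) < r) \<longrightarrow> rho h \<in> U)"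
    proof (rule automatic_continuity[OF UV])
      fix F and r :: real
      assume "finite F" "r > 0"
        and F: "\<And>h. h \<in> Lam \<Longrightarrow> (\<And>v. v \<in> F \<Longrightarrow> norm (h v - v) < r) \<Longrightarrow> h \<in> {g \<in> Lam. rho g \<in> U}"
      moreover have "rho h \<in> U" if "h \<in> Lam" "\<forall>v\<in>F. norm (h v - v) < r" for h
        using F[of h] that by simp
      ultimately show ?thesis by (intro exI conjI ballI impI) auto
    qed
    then obtain F r where F: "finite F" "r > 0"
      "\<forall>h\<in>Lam. (\<forall>v\<in>F. norm (h v - v) < r) \<longrightarrow> rho h \<in> U" by (elim exE conjE)
    obtain n \<delta> where \<delta>: "\<delta> > 0"
      "\<And>h. h \<in> Lam \<Longrightarrow> \<forall>i<n. norm (h (e i) - e i) < \<delta> \<Longrightarrow> \<forall>v\<in>F. norm (h v - v) < r"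
      using Lam_near_id[OF F(1,2)] by blast
    let ?N = "{f \<in> topspace isom_topology. \<forall>i<n. dist (lift f (e i)) (e i) < \<delta>}"
    have "openin isom_topology ?N" by (intro openin_all_less openin_ball_preimage continuous_lift_e)
    moreover have "\<one>\<^bsub>Isom e\<^esub> \<in> ?N"
      using \<delta>(1) G.one_closed by (simp add: topspace_isom_topology rho_one lift_rho[OF Lam_id])
    moreover have "?N \<subseteq> U"
    proof
      fix f assume f: "f \<in> ?N"
      then have fc: "f \<in> carrier (Isom e)" by (simp add: topspace_isom_topology)
      have "\<forall>v\<in>F. norm (lift f v - v) < r" using \<delta>(2)[OF lift_Lam[OF fc]] f by (simp add: dist_norm)
      then show "f \<in> U" using F(3)[rule_format, OF lift_Lam[OF fc]] rho_lift[OF fc] by simp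
    qed
    ultimately show "\<exists>N. openin isom_topology N \<and> \<one>\<^bsub>Isom e\<^esub> \<in> N \<and> N \<subseteq> U" by blast
  qed
  \<comment> \<open>Continuity at \<open>f\<close> is continuity at the identity, translated by
    \<open>f\<close>; the factor \<open>K\<close> bounds \<open>lift f\<close>.\<close>
  have "continuous_map S euclidean (\<lambda>f. lift f (e i))" for i
  proof (rule continuous_map_euclidean_metricI)
    fix f and r :: real assume "f \<in> topspace S" and r: "r > 0"
    then have f: "f \<in> carrier (Isom e)" by (simp add: tS)
    define K where "K = 5 * (norm (lift f (e 0)) + 1)"
    have K: "K > 0" by (simp add: K_def add_nonneg_pos)
    obtain V where V: "V \<in> \<V>" "\<forall>g\<in>V. \<forall>j<Suc i. norm (g (e j) - e j) < r / K"
      using near_identity[of "r / K" "Suc i"] r K by auto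
    obtain U where U: "V = {g \<in> Lam. rho g \<in> U}" "openin S U" "\<one>\<^bsub>Isom e\<^esub> \<in> U"
      using V(1) by (auto simp: \<V>_def)
    let ?U = "{h \<in> carrier (Isom e). m_inv (Isom e) f \<otimes>\<^bsub>Isom e\<^esub> h \<in> U}"
    have "openin S ?U" by (rule group_topology_translate_open[OF S _ U(2)]) (simp add: f)
    moreover have "f \<in> ?U" using f U(3) by simp
    moreover have "dist (lift h (e i)) (lift f (e i)) < r" if h: "h \<in> ?U" for h
    proof -
      have hc: "h \<in> carrier (Isom e)" using h by simp
      have L: "lift f \<in> Lam" "lift h \<in> Lam" using lift_Lam f hc by auto
      have "rho (inv (lift f) \<circ> lift h) = m_inv (Isom e) f \<otimes>\<^bsub>Isom e\<^esub> h"
        using rho_mult[OF Lam_inv[OF L(1)] L(2)] rho_inv[OF L(1)] rho_lift f hc by simp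
      then have "inv (lift f) \<circ> lift h \<in> V" using h Lam_comp[OF Lam_inv[OF L(1)] L(2)] by (simp add: U(1))
      then have "norm (inv (lift f) (lift h (e i)) - e i) < r / K" using V(2) by auto
      then have "K * norm (inv (lift f) (lift h (e i)) - e i) < r" using K by (simp add: field_simps)
      moreover have "lift h (e i) - lift f (e i) = lift f (inv (lift f) (lift h (e i)) - e i)"
        by (simp add: linear_diff[OF Lam_linear[OF L(1)]] Lam_f_inv[OF L(1)])
      then have "norm (lift h (e i) - lift f (e i)) \<le> K * norm (inv (lift f) (lift h (e i)) - e i)"
        using Lam_bound[OF L(1)] by (simp add: K_def)
      ultimately show ?thesis by (simp add: dist_norm)
    qed
    ultimately show "\<exists>U. openin S U \<and> f \<in> U \<and> (\<forall>h\<in>U. dist (lift h (e i)) (lift f (e i)) < r)" by blast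
  qed
  then show "openin S U" if "openin isom_topology U" for U
    using isom_topology_coarsest[OF S _ that] by blast
qed

end

theorem corollary1p7:
  fixes e :: "nat \<Rightarrow> 'a::{real_inner, complete_space}"
  assumes "hilbert_basis e"
  shows "\<exists>T. pointwise_convergence_topology e T \<and> polish_space T \<and>
    (\<forall>S. group_topology (Isom e) S \<and> separable_space S \<and> Hausdorff_space S \<longleftrightarrow> S = T)"
proof -
  interpret hyp e by (rule hyp.intro[OF assms])
  have "polish_space isom_topology"
    by (simp add: polish_space_def separable_isom_topology completely_metrizable_isom_topology)
  moreover have "Hausdorff_space isom_topology"
    by (intro metrizable_imp_Hausdorff_space completely_metrizable_imp_metrizable_space
        completely_metrizable_isom_topology)
  ultimately show ?thesis
    using pointwise_convergence_isom_topology group_topology_isom_topology separable_isom_topology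
      isom_topology_unique by blast
qed

end
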